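(* Let $\theta=\pi(\bar\theta)\in\mathcal M_{p,k}$ with $\bar\theta=(U,\Sigma)$ and $\xi=D\pi(\bar\theta)[\bar\xi]\in T_\theta\mathcal M_{p,k}$, where $\bar\xi=(\xi_U,\xi_\Sigma)\in\mathcal H_{\bar\theta}$. The representative in $\overline{\mathcal M}_{p,k}$ of the geodesic in $\mathcal M_{p,k}$ associated with the metric induced by $\langle\cdot,\cdot\rangle$, starting at $\theta$ in the direction $\xi$, is $\bar\gamma(t)=(U(t),\Sigma(t))$ (that is, the geodesic is $\pi\circ\bar\gamma$), with $$U(t)=[\,U\ \ Q\,]\,\exp\!\left(t\begin{pmatrix}U^H\xi_U&-R^H\\R&0\end{pmatrix}\right)\begin{bmatrix}I_k\\0\end{bmatrix},$$ $$\Sigma(t)=\Sigma^{1/2}\exp\!\big(t\,\Sigma^{-1/2}\xi_\Sigma\Sigma^{-1/2}\big)\Sigma^{1/2},$$ where $Q$ and $R$ correspond to the QR decomposition of $(I_p-UU^H)\xi_U$. (Remark attached to the statement: this form of the geodesic $U(t)$ on $\mathrm{St}_{p,k}$ is optimal, from a dimensionality point of view, only if $k\le p/2$. If $k>p/2$, it is more advantageous to replace $Q$ with $U_\perp$ and $R$ with $U_\perp^H\xi_U$, where $U_\perp\in\mathrm{St}_{p,p-k}$ is such that $U^HU_\perp=0$.)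
   Context: Let $1\le k<p$ be integers. $\mathrm{St}_{p,m}=\{U\in\mathbb C^{p\times m}:U^HU=I_m\}$, $\mathcal H_k$ is the space of $k\times k$ Hermitian matrices, $\mathcal H_k^{++}$ the manifold of Hermitian positive definite $k\times k$ matrices, $\mathcal U_k$ the unitary group. Let $\overline{\mathcal M}_{p,k}=\mathrm{St}_{p,k}\times\mathcal H_k^{++}$, with tangent space at $\bar\theta=(U,\Sigma)$ $$T_{\bar\theta}\overline{\mathcal M}_{p,k}=\{(\xi_U,\xi_\Sigma)\in\mathbb C^{p\times k}\times\mathcal H_k:\ U^H\xi_U+\xi_U^HU=0\}.$$ For $\alpha>0$ and $\beta>-\alpha/k$, equip it with the Riemannian metric $$\langle\bar\xi,\bar\eta\rangle_{\bar\theta}=\mathrm{Re}\,\mathrm{tr}\big(\xi_U^H(I_p-\tfrac12UU^H)\eta_U\big)+\alpha\,\mathrm{tr}(\Sigma^{-1}\xi_\Sigma\Sigma^{-1}\eta_\Sigma)+\beta\,\mathrm{tr}(\Sigma^{-1}\xi_\Sigma)\,\mathrm{tr}(\Sigma^{-1}\eta_\Sigma).$$ $\mathcal U_k$ acts by isometries on $\overline{\mathcal M}_{p,k}$ via $(U,\Sigma)\mapsto(UO,O^H\Sigma O)$; $\mathcal M_{p,k}$ is the quotient manifold, $\pi:\overline{\mathcal M}_{p,k}\to\mathcal M_{p,k}$ the quotient map, and $\mathcal M_{p,k}$ carries the induced metric, i.e. the one making $\pi$ a Riemannian submersion. The horizontal space $\mathcal H_{\bar\theta}$ is the orthogonal complement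 in $T_{\bar\theta}\overline{\mathcal M}_{p,k}$ of the tangent space to the orbit of $\bar\theta$; explicitly $$\mathcal H_{\bar\theta}=\{(\xi_U,\xi_\Sigma)\in T_{\bar\theta}\overline{\mathcal M}_{p,k}:\ U^H\xi_U=2\alpha(\Sigma^{-1}\xi_\Sigma-\xi_\Sigma\Sigma^{-1})\}.$$ $\exp$ is the matrix exponential and $\Sigma^{1/2}$ the Hermitian positive definite square root. *)

theory Defs
  imports "HOL-Analysis.Analysis"
begin

section \<open>Complex matrices\<close>

text \<open>A \<open>p \<times> k\<close> matrix has type \<^typ>\<open>complex^'k^'p\<close>: rows are indexed by \<open>'p\<close>, columns by \<open>'k\<close>.\<close>

definition hconj :: "complex^'n^'m \<Rightarrow> complex^'m^'n" ("(_\<^sup>H)" [1000] 999)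
  where "A\<^sup>H = (\<chi> i j. cnj (A $ j $ i))"

definition stiefel :: "(complex^'k^'p) set"
  where "stiefel = {U. U\<^sup>H ** U = mat 1}"

definition unitary :: "(complex^'k^'k) set"
  where "unitary = {V. V\<^sup>H ** V = mat 1 \<and> V ** V\<^sup>H = mat 1}"

definition hermitian :: "(complex^'k^'k) set"
  where "hermitian = {A. A\<^sup>H = A}"

definition hpd :: "(complex^'k^'k) set"
  where "hpd = {A \<in> hermitian.
    \<forall>x. x \<noteq> 0 \<longrightarrow> 0 < Re (\<Sum>i\<in>UNIV. cnj (x $ i) * (A *v x) $ i)}"

definition hpd_sqrt :: "complex^'k^'k \<Rightarrow> complex^'k^'k"
  where "hpd_sqrt A = (THE B. B \<in> hpd \<and> B ** B = A)"

primrec matrix_power :: "complex^'n^'n \<Rightarrow> nat \<Rightarrow> complex^'n^'n" where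
  "matrix_power A 0 = mat 1"
| "matrix_power A (Suc n) = A ** matrix_power A n"

text \<open>The constants \<^const>\<open>times\<close> and \<^const>\<open>power\<close> act entrywise on type \<^typ>\<open>complex^'n^'n\<close>,
  so the exponential series is written with the matrix product.\<close>

definition matrix_exp :: "complex^'n^'n \<Rightarrow> complex^'n^'n"
  where "matrix_exp A = (\<Sum>n. matrix_power A n /\<^sub>R fact n)"

definition beside :: "complex^'k^'p \<Rightarrow> complex^'q^'p \<Rightarrow> complex^('k + 'q)^'p"
  where "beside A B = (\<chi> i j. case j of Inl l \<Rightarrow> A $ i $ l | Inr l \<Rightarrow> B $ i $ l)"

definition above :: "complex^'k^'m \<Rightarrow> complex^'k^'q \<Rightarrow> complex^'k^('m + 'q)"
  where "above A B = (\<chi> i. case i of Inl l \<Rightarrow> A $ l | Inr l \<Rightarrow> B $ l)"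

definition upper_triangular :: "complex^'k::{finite,linorder}^'k::{finite,linorder} \<Rightarrow> bool"
  where "upper_triangular R \<longleftrightarrow> (\<forall>i j. j < i \<longrightarrow> R $ i $ j = 0)"

text \<open>Thin QR decomposition. If \<open>A\<close> is column-rank deficient, \<open>Q\<close> and \<open>R\<close> are not determined
  by \<open>A\<close>; every admissible choice is allowed.\<close>

definition qr_decomposition ::
  "complex^'k::{finite,linorder}^'p \<Rightarrow> complex^'k::{finite,linorder}^'p
    \<Rightarrow> complex^'k::{finite,linorder}^'k::{finite,linorder} \<Rightarrow> bool"
  where "qr_decomposition A Q R \<longleftrightarrow> Q \<in> stiefel \<and> upper_triangular R \<and> A = Q ** R"


section \<open>Smooth maps\<close>

text \<open>Meant for open \<open>S\<close>: \<open>f\<close> is \<open>C^(n+1)\<close> iff it is differentiable and all its directional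
  derivatives are \<open>C^n\<close>.\<close>

primrec Ck_on :: "nat \<Rightarrow> 'a::real_normed_vector set \<Rightarrow> ('a \<Rightarrow> 'b::real_normed_vector) \<Rightarrow> bool" where
  "Ck_on 0 S f \<longleftrightarrow> continuous_on S f"
| "Ck_on (Suc n) S f \<longleftrightarrow> (\<forall>x\<in>S. f differentiable (at x)) \<and>
     (\<forall>v. Ck_on n S (\<lambda>x. frechet_derivative f (at x) v))"

definition smooth_on :: "'a::real_normed_vector set \<Rightarrow> ('a \<Rightarrow> 'b::real_normed_vector) \<Rightarrow> bool"
  where "smooth_on S f \<longleftrightarrow> (\<forall>n. Ck_on n S f)"

text \<open>Smoothness on a (not necessarily open) subset, such as a submanifold: local smooth
  extensions to the ambient space exist.\<close>

definition smooth_on_subset :: "'a::real_normed_vector set \<Rightarrow> ('a \<Rightarrow> 'b::real_normed_vector) \<Rightarrow> bool"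
  where "smooth_on_subset S f \<longleftrightarrow>
    (\<forall>x\<in>S. \<exists>N F. open N \<and> x \<in> N \<and> smooth_on N F \<and> (\<forall>y\<in>N \<inter> S. F y = f y))"


section \<open>Quotient manifolds in charts\<close>

text \<open>A chart is a domain with a coordinate map into a Euclidean model space \<open>'e\<close>.\<close>

type_synonym ('m, 'e) chart = "'m set \<times> ('m \<Rightarrow> 'e)"

text \<open>Let \<open>X\<close> be a submanifold of a Euclidean space and \<open>\<pi>\<close> a map on \<open>X\<close>. The set \<open>\<pi> ` X\<close> gets
  the quotient topology and the unique smooth structure for which \<open>\<pi>\<close> is a smooth submersion: a
  chart is smooth when composed with \<open>\<pi>\<close>, and its inverse lifts locally to smooth maps into \<open>X\<close>.
  The set below is the maximal atlas. It is empty whenever \<open>DIM('e)\<close> is not the dimension of the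
  quotient, so a statement for all \<open>'e\<close> is a statement about the right dimension.\<close>

definition quotient_atlas ::
  "'a::euclidean_space set \<Rightarrow> ('a \<Rightarrow> 'm) \<Rightarrow> ('m, 'e::euclidean_space) chart set"
  where "quotient_atlas X \<pi> = {(W, c).
    W \<noteq> {} \<and> W \<subseteq> \<pi> ` X \<and>
    openin (top_of_set X) {x \<in> X. \<pi> x \<in> W} \<and>
    inj_on c W \<and> open (c ` W) \<and>
    smooth_on_subset {x \<in> X. \<pi> x \<in> W} (c \<circ> \<pi>) \<and>
    (\<forall>v\<in>c ` W. \<exists>V s. open V \<and> v \<in> V \<and> V \<subseteq> c ` W \<and> smooth_on V s \<and> s ` V \<subseteq> X \<and>
       (\<forall>u\<in>V. \<pi> (s u) \<in> W \<and> c (\<pi> (s u)) = u))}"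

text \<open>A tangent vector at a point is represented by the family of its coordinate vectors in all
  charts around that point (and \<open>0\<close> elsewhere). Accordingly, \<open>proj_differential X \<pi> x \<xi>\<close> is
  \<open>D\<pi>(x)[\<xi>]\<close> for \<open>\<xi>\<close> tangent to \<open>X\<close> at \<open>x\<close>. Derivatives within \<open>X\<close> are unique only on
  tangent vectors, and are only applied to such.\<close>

definition proj_differential ::
  "'a::euclidean_space set \<Rightarrow> ('a \<Rightarrow> 'm) \<Rightarrow> 'a \<Rightarrow> 'a \<Rightarrow> ('m, 'e::euclidean_space) chart \<Rightarrow> 'e"
  where "proj_differential X \<pi> x \<xi> = (\<lambda>(W, c).
    if (W, c) \<in> quotient_atlas X \<pi> \<and> \<pi> x \<in> W
    then frechet_derivative (c \<circ> \<pi>) (at x within X) \<xi> else 0)"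

definition velocity ::
  "('m, 'e::euclidean_space) chart set \<Rightarrow> (real \<Rightarrow> 'm) \<Rightarrow> real \<Rightarrow> ('m, 'e) chart \<Rightarrow> 'e"
  where "velocity \<A> \<gamma> t = (\<lambda>(W, c).
    if (W, c) \<in> \<A> \<and> \<gamma> t \<in> W then vector_derivative (c \<circ> \<gamma>) (at t) else 0)"

text \<open>A metric on the manifold is given by its coordinate expressions: \<open>G (W, c) v a b\<close> is the
  inner product of the tangent vectors with coordinates \<open>a\<close> and \<open>b\<close> at the point with
  coordinates \<open>v\<close> in the chart \<open>(W, c)\<close>.\<close>

type_synonym ('m, 'e) coord_metric = "('m, 'e) chart \<Rightarrow> 'e \<Rightarrow> 'e \<Rightarrow> 'e \<Rightarrow> real"

text \<open>The metric making \<open>\<pi>\<close> a Riemannian submersion, i.e. making \<open>D\<pi>(x)\<close> isometric on the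
  horizontal space \<open>hor x\<close> for every \<open>x\<close>; here \<open>m\<close> is the metric on \<open>X\<close>.\<close>

definition submersion_metric ::
  "'a::euclidean_space set \<Rightarrow> ('a \<Rightarrow> 'm) \<Rightarrow> ('a \<Rightarrow> 'a set) \<Rightarrow> ('a \<Rightarrow> 'a \<Rightarrow> 'a \<Rightarrow> real)
    \<Rightarrow> ('m, 'e::euclidean_space) coord_metric"
  where "submersion_metric X \<pi> hor m = (\<lambda>(W, c) v. THE g.
    \<forall>x\<in>X. \<pi> x \<in> W \<and> c (\<pi> x) = v \<longrightarrow> (\<forall>\<xi>\<in>hor x. \<forall>\<eta>\<in>hor x.
      g (proj_differential X \<pi> x \<xi> (W, c)) (proj_differential X \<pi> x \<eta> (W, c)) = m x \<xi> \<eta>))"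

text \<open>The Levi-Civita connection of a metric \<open>g\<close> on an open subset of \<open>'e\<close>: \<open>christoffel g v a b\<close>
  is the covariant derivative at \<open>v\<close> of the constant field \<open>b\<close> in the direction \<open>a\<close>, as
  determined by Koszul's formula.\<close>

definition christoffel ::
  "('e::euclidean_space \<Rightarrow> 'e \<Rightarrow> 'e \<Rightarrow> real) \<Rightarrow> 'e \<Rightarrow> 'e \<Rightarrow> 'e \<Rightarrow> 'e"
  where "christoffel g v a b = (THE z. \<forall>w. g v z w =
    (frechet_derivative (\<lambda>u. g u b w) (at v) a
     + frechet_derivative (\<lambda>u. g u a w) (at v) b
     - frechet_derivative (\<lambda>u. g u a b) (at v) w) / 2)"

text \<open>A geodesic is a smooth curve whose covariant acceleration vanishes.\<close>

definition is_geodesic ::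
  "('m, 'e::euclidean_space) chart set \<Rightarrow> ('m, 'e) coord_metric \<Rightarrow> (real \<Rightarrow> 'm) \<Rightarrow> bool"
  where "is_geodesic \<A> G \<gamma> \<longleftrightarrow> (\<forall>(W, c)\<in>\<A>.
    open {t. \<gamma> t \<in> W} \<and> smooth_on {t. \<gamma> t \<in> W} (c \<circ> \<gamma>) \<and>
    (\<forall>t. \<gamma> t \<in> W \<longrightarrow>
      (let v = (\<lambda>s. vector_derivative (c \<circ> \<gamma>) (at s))
       in vector_derivative v (at t) + christoffel (G (W, c)) (c (\<gamma> t)) (v t) (v t) = 0)))"


section \<open>The manifold and its quotient\<close>

type_synonym ('p, 'k) pt = "(complex^'k^'p) \<times> (complex^'k^'k)"

definition total_space :: "('p::finite, 'k::finite) pt set"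
  where "total_space = stiefel \<times> hpd"

definition tangent :: "('p::finite, 'k::finite) pt \<Rightarrow> ('p, 'k) pt set"
  where "tangent = (\<lambda>(U, \<Sigma>).
    {(\<xi>U, \<xi>\<Sigma>). \<xi>\<Sigma> \<in> hermitian \<and> U\<^sup>H ** \<xi>U + \<xi>U\<^sup>H ** U = 0})"

text \<open>The real parts in the \<open>\<alpha>\<close> and \<open>\<beta>\<close> terms only convert types: these traces are real on
  tangent vectors.\<close>

definition total_metric ::
  "real \<Rightarrow> real \<Rightarrow> ('p::finite, 'k::finite) pt \<Rightarrow> ('p, 'k) pt \<Rightarrow> ('p, 'k) pt \<Rightarrow> real"
  where "total_metric \<alpha> \<beta> = (\<lambda>(U, \<Sigma>) (\<xi>U, \<xi>\<Sigma>) (\<eta>U, \<eta>\<Sigma>).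
    Re (trace (\<xi>U\<^sup>H ** (mat 1 - (1/2) *\<^sub>R (U ** U\<^sup>H)) ** \<eta>U))
    + \<alpha> * Re (trace (matrix_inv \<Sigma> ** \<xi>\<Sigma> ** matrix_inv \<Sigma> ** \<eta>\<Sigma>))
    + \<beta> * Re (trace (matrix_inv \<Sigma> ** \<xi>\<Sigma>)) * Re (trace (matrix_inv \<Sigma> ** \<eta>\<Sigma>)))"

text \<open>The points of the quotient are the orbits of the unitary group.\<close>

definition orbit :: "('p::finite, 'k::finite) pt \<Rightarrow> ('p, 'k) pt set"
  where "orbit = (\<lambda>(U, \<Sigma>). {(U ** V, V\<^sup>H ** \<Sigma> ** V) | V. V \<in> unitary})"

text \<open>The tangent space to the orbit: velocities at \<open>t = 0\<close> of
  \<open>(U exp(t\<Omega>), exp(-t\<Omega>) \<Sigma> exp(t\<Omega>))\<close> with \<open>\<Omega>\<close> skew-Hermitian.\<close>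

definition vertical :: "('p::finite, 'k::finite) pt \<Rightarrow> ('p, 'k) pt set"
  where "vertical = (\<lambda>(U, \<Sigma>). {(U ** \<Omega>, \<Sigma> ** \<Omega> - \<Omega> ** \<Sigma>) | \<Omega>. \<Omega>\<^sup>H = - \<Omega>})"

definition horizontal ::
  "real \<Rightarrow> real \<Rightarrow> ('p::finite, 'k::finite) pt \<Rightarrow> ('p, 'k) pt set"
  where "horizontal \<alpha> \<beta> x = {\<xi> \<in> tangent x. \<forall>\<zeta>\<in>vertical x. total_metric \<alpha> \<beta> x \<xi> \<zeta> = 0}"

lemma hconj_mult: "(A ** B)\<^sup>H = B\<^sup>H ** A\<^sup>H"
  by (simp add: hconj_def matrix_matrix_mult_def vec_eq_iff mult.commute)

lemma hconj_hconj: "(A\<^sup>H)\<^sup>H = A"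
  by (simp add: hconj_def vec_eq_iff)

lemma hconj_add: "(A + B)\<^sup>H = A\<^sup>H + B\<^sup>H"
  by (simp add: hconj_def vec_eq_iff)

lemma hconj_diff: "(A - B)\<^sup>H = A\<^sup>H - B\<^sup>H"
  by (simp add: hconj_def vec_eq_iff)

lemma hconj_scaleR: "(r *\<^sub>R A)\<^sup>H = r *\<^sub>R A\<^sup>H"
  by (simp add: hconj_def vec_eq_iff)

lemma hconj_mat_1: "(mat 1)\<^sup>H = mat 1"
  by (auto simp: hconj_def vec_eq_iff mat_def)

lemma scaleR_matrix_mult: "(r *\<^sub>R A) ** B = r *\<^sub>R (A ** B :: complex^'k^'m)"
  by (simp add: matrix_matrix_mult_def vec_eq_iff scaleR_sum_right)

lemma matrix_mult_scaleR: "A ** (r *\<^sub>R B) = r *\<^sub>R (A ** B :: complex^'k^'m)"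
  by (simp add: matrix_matrix_mult_def vec_eq_iff scaleR_sum_right)

lemma matrix_sub_rdistrib: "(A - B) ** C = A ** C - B ** (C :: complex^'k^'m)"
  by (simp add: matrix_matrix_mult_def vec_eq_iff sum_subtractf left_diff_distrib)

lemma matrix_sub_ldistrib: "C ** (A - B) = C ** A - C ** (B :: complex^'k^'m)"
  by (simp add: matrix_matrix_mult_def vec_eq_iff sum_subtractf right_diff_distrib)

lemma minus_matrix_mult: "(- A) ** B = - (A ** B :: complex^'k^'m)"
  by (simp add: matrix_matrix_mult_def vec_eq_iff sum_negf)

lemma trace_minus: "trace (- A) = - trace (A :: complex^'k^'k)"
  by (simp add: trace_def sum_negf)

lemma trace_scaleR: "trace (r *\<^sub>R A) = r *\<^sub>R trace (A :: complex^'k^'k)"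
  by (simp add: trace_def scaleR_sum_right)

lemma hpd_inverse:
  assumes "\<Sigma> \<in> hpd"
  shows "\<Sigma> ** matrix_inv \<Sigma> = mat 1" "matrix_inv \<Sigma> ** \<Sigma> = mat 1"
proof -
  have "x = 0" if "\<Sigma> *v x = 0" for x
    using assms that unfolding hpd_def by force
  then obtain B where "B ** \<Sigma> = mat 1"
    using matrix_left_invertible_ker by blast
  then have "invertible \<Sigma>"
    using matrix_left_right_inverse unfolding invertible_def by blast
  then have "\<Sigma> ** matrix_inv \<Sigma> = mat 1 \<and> matrix_inv \<Sigma> ** \<Sigma> = mat 1"
    unfolding invertible_def matrix_inv_def by (rule someI_ex)
  then show "\<Sigma> ** matrix_inv \<Sigma> = mat 1" "matrix_inv \<Sigma> ** \<Sigma> = mat 1"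
    by auto
qed

lemma hpd_inverse_hermitian:
  assumes "\<Sigma> \<in> hpd"
  shows "(matrix_inv \<Sigma>)\<^sup>H = matrix_inv \<Sigma>"
proof -
  have h: "\<Sigma>\<^sup>H = \<Sigma>"
    using assms by (simp add: hpd_def hermitian_def)
  have "(matrix_inv \<Sigma>)\<^sup>H = (matrix_inv \<Sigma>)\<^sup>H ** (\<Sigma> ** matrix_inv \<Sigma>)"
    using hpd_inverse[OF assms] by simp
  also have "\<dots> = (\<Sigma> ** matrix_inv \<Sigma>)\<^sup>H ** matrix_inv \<Sigma>"
    by (simp add: hconj_mult h matrix_mul_assoc)
  finally show ?thesis
    using hpd_inverse[OF assms] by (simp add: hconj_mat_1)
qed

lemma trace_hconj_mult_eq_0:
  fixes C :: "complex^'k^'m"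
  assumes "Re (trace (C\<^sup>H ** C)) = 0"
  shows "C = 0"
proof -
  have "Re (trace (C\<^sup>H ** C)) = (\<Sum>i\<in>UNIV. \<Sum>j\<in>UNIV. (cmod (C $ j $ i))\<^sup>2)"
    by (simp add: trace_def hconj_def matrix_matrix_mult_def cmod_power2)
      (simp add: power2_eq_square)
  then have "\<forall>i j. (cmod (C $ j $ i))\<^sup>2 = 0"
    using assms by (simp add: sum_nonneg_eq_0_iff sum_nonneg)
  then show ?thesis
    by (simp add: vec_eq_iff)
qed

lemma total_metric_vertical:
  assumes "U \<in> stiefel" "\<Sigma> \<in> hpd" "(\<xi>U, \<xi>\<Sigma>) \<in> tangent (U, \<Sigma>)"
  shows "total_metric \<alpha> \<beta> (U, \<Sigma>) (\<xi>U, \<xi>\<Sigma>) (U ** \<Omega>, \<Sigma> ** \<Omega> - \<Omega> ** \<Sigma>) =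
    Re (trace ((\<alpha> *\<^sub>R (matrix_inv \<Sigma> ** \<xi>\<Sigma> - \<xi>\<Sigma> ** matrix_inv \<Sigma>)
      - (1/2) *\<^sub>R (U\<^sup>H ** \<xi>U)) ** \<Omega>))"
proof -
  let ?S = "matrix_inv \<Sigma>"
  note inv = hpd_inverse[OF assms(2)]
  have U: "U\<^sup>H ** U = mat 1" using assms(1) by (simp add: stiefel_def)
  have "\<xi>U\<^sup>H ** U = - (U\<^sup>H ** \<xi>U)"
    using assms(3) by (simp add: tangent_def add_eq_0_iff)
  moreover have "\<xi>U\<^sup>H ** (mat 1 - (1/2) *\<^sub>R (U ** U\<^sup>H)) ** (U ** \<Omega>)
      = (1/2) *\<^sub>R (\<xi>U\<^sup>H ** U ** \<Omega>)"
  proof -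
    have "(mat 1 - (1/2) *\<^sub>R (U ** U\<^sup>H)) ** U = U - (1/2) *\<^sub>R (U ** (U\<^sup>H ** U))"
      by (simp add: matrix_sub_rdistrib scaleR_matrix_mult matrix_mul_assoc)
    also have "\<dots> = (1/2) *\<^sub>R U"
      by (simp add: U)
    finally have e: "(mat 1 - (1/2) *\<^sub>R (U ** U\<^sup>H)) ** U = (1/2) *\<^sub>R U" .
    have "\<xi>U\<^sup>H ** (mat 1 - (1/2) *\<^sub>R (U ** U\<^sup>H)) ** (U ** \<Omega>)
       = \<xi>U\<^sup>H ** ((mat 1 - (1/2) *\<^sub>R (U ** U\<^sup>H)) ** U) ** \<Omega>"
      by (simp add: matrix_mul_assoc)
    then show ?thesis
      by (simp only: e) (simp add: scaleR_matrix_mult matrix_mult_scaleR)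
  qed
  ultimately have 1: "\<xi>U\<^sup>H ** (mat 1 - (1/2) *\<^sub>R (U ** U\<^sup>H)) ** (U ** \<Omega>)
      = - ((1/2) *\<^sub>R (U\<^sup>H ** \<xi>U)) ** \<Omega>"
    by (simp add: minus_matrix_mult scaleR_matrix_mult)
  have "trace (?S ** \<xi>\<Sigma> ** ?S ** (\<Omega> ** \<Sigma>)) = trace ((?S ** \<xi>\<Sigma> ** ?S ** \<Omega>) ** \<Sigma>)"
    by (simp add: matrix_mul_assoc)
  also have "\<dots> = trace (\<Sigma> ** (?S ** \<xi>\<Sigma> ** ?S ** \<Omega>))"
    by (rule trace_mul_sym)
  also have "\<dots> = trace ((\<Sigma> ** ?S) ** \<xi>\<Sigma> ** ?S ** \<Omega>)"
    by (simp add: matrix_mul_assoc)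
  finally have a: "trace (?S ** \<xi>\<Sigma> ** ?S ** (\<Omega> ** \<Sigma>)) = trace (\<xi>\<Sigma> ** ?S ** \<Omega>)"
    by (simp add: inv)
  have "?S ** \<xi>\<Sigma> ** ?S ** (\<Sigma> ** \<Omega>) = ?S ** \<xi>\<Sigma> ** (?S ** \<Sigma>) ** \<Omega>"
    by (simp add: matrix_mul_assoc)
  then have b: "trace (?S ** \<xi>\<Sigma> ** ?S ** (\<Sigma> ** \<Omega>)) = trace (?S ** \<xi>\<Sigma> ** \<Omega>)"
    by (simp add: inv)
  have 2: "trace (?S ** \<xi>\<Sigma> ** ?S ** (\<Sigma> ** \<Omega> - \<Omega> ** \<Sigma>))
      = trace ((?S ** \<xi>\<Sigma> - \<xi>\<Sigma> ** ?S) ** \<Omega>)"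
    by (simp add: matrix_sub_ldistrib matrix_sub_rdistrib trace_sub a b)
  have c: "trace (?S ** (\<Omega> ** \<Sigma>)) = trace (?S ** (\<Sigma> ** \<Omega>))"
    using trace_mul_sym[of "?S ** \<Omega>" \<Sigma>] by (simp add: matrix_mul_assoc inv)
  have 3: "trace (?S ** (\<Sigma> ** \<Omega> - \<Omega> ** \<Sigma>)) = 0"
    by (simp add: matrix_sub_ldistrib trace_sub c)
  show ?thesis
    unfolding total_metric_def prod.case 1 2 3
    by (simp add: minus_matrix_mult trace_minus matrix_sub_rdistrib trace_sub scaleR_matrix_mult trace_scaleR)
qed

text \<open>The explicit form of the horizontal space.\<close>

lemma horizontal_explicit:
  assumes "(U, \<Sigma>) \<in> total_space"
  shows "horizontal \<alpha> \<beta> (U, \<Sigma>) = {(\<xi>U, \<xi>\<Sigma>). (\<xi>U, \<xi>\<Sigma>) \<in> tangent (U, \<Sigma>) \<and>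
    U\<^sup>H ** \<xi>U = (2 * \<alpha>) *\<^sub>R (matrix_inv \<Sigma> ** \<xi>\<Sigma> - \<xi>\<Sigma> ** matrix_inv \<Sigma>)}"
proof -
  have U: "U \<in> stiefel" and S: "\<Sigma> \<in> hpd"
    using assms by (auto simp: total_space_def)
  have "(\<forall>\<zeta>\<in>vertical (U, \<Sigma>). total_metric \<alpha> \<beta> (U, \<Sigma>) (\<xi>U, \<xi>\<Sigma>) \<zeta> = 0) \<longleftrightarrow>
      U\<^sup>H ** \<xi>U = (2 * \<alpha>) *\<^sub>R (matrix_inv \<Sigma> ** \<xi>\<Sigma> - \<xi>\<Sigma> ** matrix_inv \<Sigma>)"
    if T: "(\<xi>U, \<xi>\<Sigma>) \<in> tangent (U, \<Sigma>)" for \<xi>U \<xi>\<Sigma>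
  proof -
    define B where "B = matrix_inv \<Sigma> ** \<xi>\<Sigma> - \<xi>\<Sigma> ** matrix_inv \<Sigma>"
    define C where "C = \<alpha> *\<^sub>R B - (1/2) *\<^sub>R (U\<^sup>H ** \<xi>U)"
    have "B\<^sup>H = - B" "(U\<^sup>H ** \<xi>U)\<^sup>H = - (U\<^sup>H ** \<xi>U)"
      using T hpd_inverse_hermitian[OF S]
      by (auto simp: B_def tangent_def hermitian_def hconj_diff hconj_mult hconj_hconj
          eq_neg_iff_add_eq_0 add.commute)
    then have skew: "C\<^sup>H = - C"
      by (simp add: C_def hconj_diff hconj_scaleR)
    have "(\<forall>\<zeta>\<in>vertical (U, \<Sigma>). total_metric \<alpha> \<beta> (U, \<Sigma>) (\<xi>U, \<xi>\<Sigma>) \<zeta> = 0) \<longleftrightarrow>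
        (\<forall>\<Omega>. \<Omega>\<^sup>H = - \<Omega> \<longrightarrow> Re (trace (C ** \<Omega>)) = 0)"
      using total_metric_vertical[OF U S T, of \<alpha> \<beta>]
      unfolding vertical_def C_def B_def by fastforce
    also have "\<dots> \<longleftrightarrow> C = 0"
    proof
      assume "\<forall>\<Omega>. \<Omega>\<^sup>H = - \<Omega> \<longrightarrow> Re (trace (C ** \<Omega>)) = 0"
      then have "Re (trace (C ** C)) = 0"
        using skew by blast
      moreover have "C\<^sup>H ** C = - (C ** C)"
        unfolding skew by (rule minus_matrix_mult)
      ultimately have "Re (trace (C\<^sup>H ** C)) = 0"
        by (simp add: trace_def sum_negf)
      then show "C = 0"
        by (rule trace_hconj_mult_eq_0)
    qed (simp add: trace_def)
    also have "\<dots> \<longleftrightarrow> U\<^sup>H ** \<xi>U = (2 * \<alpha>) *\<^sub>R B"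
    proof
      assume "C = 0"
      then have "2 *\<^sub>R ((1/2) *\<^sub>R (U\<^sup>H ** \<xi>U)) = 2 *\<^sub>R (\<alpha> *\<^sub>R B)"
        by (simp add: C_def)
      then show "U\<^sup>H ** \<xi>U = (2 * \<alpha>) *\<^sub>R B" by simp
    qed (simp add: C_def)
    finally show ?thesis by (simp add: B_def)
  qed
  then show ?thesis
    unfolding horizontal_def by (intro set_eqI) (simp add: split_paired_all, blast)
qed

definition quotient_metric ::
  "real \<Rightarrow> real \<Rightarrow> (('p::finite, 'k::finite) pt set, 'e::euclidean_space) coord_metric"
  where "quotient_metric \<alpha> \<beta> =
    submersion_metric total_space orbit (horizontal \<alpha> \<beta>) (total_metric \<alpha> \<beta>)"

text \<open>The curve \<open>\<gamma>\<close> in the total space represents the geodesic of the quotient starting at \<open>\<theta>\<close>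
  in the direction \<open>\<xi>\<close>.\<close>

definition represents_geodesic ::
  "real \<Rightarrow> real \<Rightarrow> (real \<Rightarrow> ('p::finite, 'k::finite) pt) \<Rightarrow> ('p, 'k) pt set
    \<Rightarrow> ((('p, 'k) pt set, 'e::euclidean_space) chart \<Rightarrow> 'e) \<Rightarrow> bool"
  where "represents_geodesic \<alpha> \<beta> \<gamma> \<theta> \<xi> \<longleftrightarrow>
    (\<forall>t. \<gamma> t \<in> total_space) \<and>
    is_geodesic (quotient_atlas total_space orbit :: (('p, 'k) pt set, 'e) chart set)
      (quotient_metric \<alpha> \<beta>) (orbit \<circ> \<gamma>) \<and>
    orbit (\<gamma> 0) = \<theta> \<and>
    velocity (quotient_atlas total_space orbit) (orbit \<circ> \<gamma>) 0 = \<xi>"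

definition stiefel_curve ::
  "complex^'k^'p \<Rightarrow> complex^'q^'p \<Rightarrow> complex^'k^'k \<Rightarrow> complex^'k^'q \<Rightarrow> real \<Rightarrow> complex^'k^'p"
  where "stiefel_curve U Q A R t =
    beside U Q ** matrix_exp (t *\<^sub>R above (beside A (- (R\<^sup>H))) (beside R 0)) ** above (mat 1) 0"

definition hpd_curve :: "complex^'k^'k \<Rightarrow> complex^'k^'k \<Rightarrow> real \<Rightarrow> complex^'k^'k"
  where "hpd_curve \<Sigma> \<xi>\<Sigma> t =
    (let S = hpd_sqrt \<Sigma>; T = matrix_inv S
     in S ** matrix_exp (t *\<^sub>R (T ** \<xi>\<Sigma> ** T)) ** S)"

end

theory Submission
  imports Defs
begin

text \<open>In the total space the curve is a product of a geodesic of the Stiefel manifold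
  (\<open>U'' = U' A - U R\<^sup>H R\<close> with \<open>A = U\<^sup>H U'\<close> constant) and a geodesic of the positive definite cone
  (\<open>\<Sigma>'' = \<Sigma>' \<Sigma>\<^sup>-\<^sup>1 \<Sigma>'\<close>). Since \<open>U\<^sup>H U'\<close>, \<open>\<Sigma>\<^sup>-\<^sup>1 \<Sigma>'\<close> and \<open>\<Sigma>' \<Sigma>\<^sup>-\<^sup>1\<close> are all constant in time, a curve
  that starts horizontally stays horizontal, and a horizontal geodesic of the total space of a
  Riemannian submersion projects to a geodesic of the base. The latter is proved in a chart by
  verifying the Euler-Lagrange equation of the energy, which is equivalent to the vanishing of
  the covariant acceleration given by Koszul's formula.\<close>

section \<open>Calculus of \<open>C^k\<close> maps\<close>

text \<open>Two features of the formulation shape the proof. The quotient metric is given only by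
  definite descriptions in charts, so before an equation in a chart says anything, horizontal lifts
  must be shown to exist, to be unique and equivariant, and to vary differentiably along local
  sections. And no connection on the total space is introduced: that space lies in a vector space,
  \<open>total_metric\<close> is a formula in ambient vectors, and the geodesic equation uses the
  ambient acceleration, tested against tangent vectors only. The bound on \<open>\<beta>\<close> is
  what Cauchy-Schwarz for the trace requires to make the metric positive definite; positivity in
  turn makes horizontal lifts unique and lets Koszul's formula determine the Christoffel term. Since
  a QR factor \<open>Q\<close> may fail to be orthogonal to \<open>U\<close>, even staying on the
  Stiefel manifold needs an argument. The square root is a description as well, so its existence
  rests on a spectral theorem, obtained by maximising a trace over the compact unitary
  group.\<close>

lemma Ck_on_subset: "Ck_on n S f \<Longrightarrow> T \<subseteq> S \<Longrightarrow> Ck_on n T f"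
proof (induction n arbitrary: f)
  case 0 then show ?case by (auto intro: continuous_on_subset)
next
  case (Suc n) then show ?case by auto
qed

lemma Ck_on_cong:
  assumes "open S" "\<And>x. x \<in> S \<Longrightarrow> f x = g x" "Ck_on n S f"
  shows "Ck_on n S g"
  using assms(2,3)
proof (induction n arbitrary: f g)
  case 0
  then show ?case by (metis Ck_on.simps(1) continuous_on_cong)
next
  case (Suc n)
  have d: "(g has_derivative frechet_derivative f (at x)) (at x)" if "x \<in> S" for x
    using Suc.prems that frechet_derivative_works[of f "at x"] assms(1)
    by (auto intro: has_derivative_transform_within_open[of f _ x UNIV S g])
  then have e: "frechet_derivative f (at x) = frechet_derivative g (at x)" if "x \<in> S" for x
    using that frechet_derivative_at by blast
  have "Ck_on n S (\<lambda>x. frechet_derivative g (at x) v)" for v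
    by (rule Suc.IH[of "\<lambda>x. frechet_derivative f (at x) v"]) (use e Suc.prems in auto)
  then show ?case using d by (auto simp: differentiable_def)
qed

lemma Ck_on_continuous: "Ck_on n S f \<Longrightarrow> continuous_on S f"
  by (cases n) (auto intro!: continuous_at_imp_continuous_on differentiable_imp_continuous_within)

lemma Ck_on_Suc_imp: "Ck_on (Suc n) S f \<Longrightarrow> Ck_on n S f"
proof (induction n arbitrary: f)
  case 0 then show ?case by (metis Ck_on_continuous Ck_on.simps(1))
next
  case (Suc n)
  then show ?case by (metis Ck_on.simps(2))
qed

text \<open>Chart maps extend smoothly to the ambient space only near each point, so smoothness of a
  projected curve has to be checked locally.\<close>

lemma Ck_on_local:
  assumes "\<And>x. x \<in> S \<Longrightarrow> \<exists>N. open N \<and> x \<in> N \<and> Ck_on n N f"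
  shows "Ck_on n S f"
  using assms
proof (induction n arbitrary: f)
  case 0
  show ?case unfolding Ck_on.simps
    by (rule continuous_at_imp_continuous_on) (metis 0 Ck_on.simps(1) continuous_on_eq_continuous_at)
next
  case (Suc n)
  have "Ck_on n S (\<lambda>x. frechet_derivative f (at x) v)" for v
    by (rule Suc.IH) (use Suc.prems in fastforce)
  moreover have "f differentiable (at x)" if "x \<in> S" for x
    using Suc.prems[OF that] by auto
  ultimately show ?case by auto
qed

lemma Ck_on_const: "Ck_on n S (\<lambda>x. c)"
  by (induction n arbitrary: c) auto

lemma Ck_on_SucI:
  assumes "open S" "\<And>x. x \<in> S \<Longrightarrow> (f has_derivative f' x) (at x)"
    "\<And>v. Ck_on n S (\<lambda>x. f' x v)"
  shows "Ck_on (Suc n) S f"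
proof -
  have "Ck_on n S (\<lambda>x. frechet_derivative f (at x) v)" for v
    by (rule Ck_on_cong[OF assms(1) _ assms(3)[of v]]) (metis assms(2) frechet_derivative_at)
  then show ?thesis using assms(2) by (auto simp: differentiable_def)
qed

lemma Ck_on_has_derivative:
  "Ck_on (Suc n) S f \<Longrightarrow> x \<in> S \<Longrightarrow> (f has_derivative frechet_derivative f (at x)) (at x)"
  by (simp add: frechet_derivative_works[symmetric])

lemma Ck_on_add:
  assumes "open S" "Ck_on n S f" "Ck_on n S g"
  shows "Ck_on n S (\<lambda>x. f x + g x)"
  using assms(2,3)
proof (induction n arbitrary: f g)
  case 0 then show ?case by (auto intro: continuous_on_add)
next
  case (Suc n)
  show ?case
    by (rule Ck_on_SucI[OF assms(1) has_derivative_add[OF Ck_on_has_derivative Ck_on_has_derivative]])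
      (use Suc in auto)
qed

lemma Ck_on_sum:
  assumes "open S" "\<And>i. i \<in> I \<Longrightarrow> Ck_on n S (f i)"
  shows "Ck_on n S (\<lambda>x. \<Sum>i\<in>I. f i x)"
  using assms(2)
  by (induction I rule: infinite_finite_induct) (auto intro: Ck_on_add assms(1) Ck_on_const)

lemma Ck_on_linear:
  assumes "open S" "bounded_linear L" "Ck_on n S f"
  shows "Ck_on n S (\<lambda>x. L (f x))"
  using assms(3)
proof (induction n arbitrary: f)
  case 0 then show ?case by (auto intro: bounded_linear.continuous_on[OF assms(2)])
next
  case (Suc n)
  show ?case
    by (rule Ck_on_SucI[OF assms(1) bounded_linear.has_derivative[OF assms(2) Ck_on_has_derivative]])
      (use Suc in auto)
qed

lemma Ck_on_bilinear:
  assumes "open S" "bounded_bilinear B" "Ck_on n S f" "Ck_on n S g"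
  shows "Ck_on n S (\<lambda>x. B (f x) (g x))"
  using assms(3,4)
proof (induction n arbitrary: f g)
  case 0 then show ?case by (auto intro: bounded_bilinear.continuous_on[OF assms(2)])
next
  case (Suc n)
  have "Ck_on n S f" "Ck_on n S g" using Suc.prems Ck_on_Suc_imp by blast+
  then show ?case
    by (intro Ck_on_SucI[OF assms(1) bounded_bilinear.FDERIV[OF assms(2) Ck_on_has_derivative Ck_on_has_derivative]]
          Ck_on_add[OF assms(1)] Suc.IH)
      (use Suc.prems in auto)
qed

lemma Ck_on_Pair:
  assumes "open S" "Ck_on n S f" "Ck_on n S g"
  shows "Ck_on n S (\<lambda>x. (f x, g x))"
  using assms(2,3)
proof (induction n arbitrary: f g)
  case 0 then show ?case by (auto intro: continuous_on_Pair)
next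
  case (Suc n)
  show ?case
    by (rule Ck_on_SucI[OF assms(1) has_derivative_Pair[OF Ck_on_has_derivative Ck_on_has_derivative]])
      (use Suc in auto)
qed

lemma Ck_on_id: "Ck_on n S (\<lambda>x. x)"
proof (cases n)
  case (Suc m)
  have "Ck_on (Suc m) UNIV (\<lambda>x. x)"
    by (rule Ck_on_SucI[OF _ has_derivative_ident]) (auto intro: Ck_on_const)
  then show ?thesis using Suc Ck_on_subset by blast
qed auto

text \<open>In the chain rule \<open>f' (g x) (g' x v)\<close> the direction moves with
  \<open>x\<close>. Expanding it in the Euclidean basis leaves a finite sum of scalar functions
  times derivatives of \<open>f\<close> in fixed directions, to which the induction hypothesis
  applies.\<close>

lemma Ck_on_compose:
  fixes g :: "'a::real_normed_vector \<Rightarrow> 'b::euclidean_space"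
  assumes "open S" "open T" "Ck_on n S g" "Ck_on n T f" "g ` S \<subseteq> T"
  shows "Ck_on n S (\<lambda>x. f (g x))"
  using assms(3-5)
proof (induction n arbitrary: f)
  case 0 then show ?case using continuous_on_compose2[of T f S g] by auto
next
  case (Suc n)
  let ?f' = "\<lambda>y. frechet_derivative f (at y)" and ?g' = "\<lambda>x. frechet_derivative g (at x)"
  have lin: "linear (?f' y)" if "y \<in> T" for y
    using Suc.prems that by (auto intro: linear_frechet_derivative)
  have expand: "?f' (g x) (?g' x v) = (\<Sum>b\<in>Basis. (?g' x v \<bullet> b) *\<^sub>R ?f' (g x) b)" if "x \<in> S" for x v
  proof -
    have "?f' (g x) (?g' x v) = ?f' (g x) (\<Sum>b\<in>Basis. (?g' x v \<bullet> b) *\<^sub>R b)"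
      by (simp add: euclidean_representation)
    also have "\<dots> = (\<Sum>b\<in>Basis. (?g' x v \<bullet> b) *\<^sub>R ?f' (g x) b)"
      using lin[of "g x"] Suc.prems(3) that by (subst linear_sum) (auto simp: linear_cmul)
    finally show ?thesis .
  qed
  show ?case
  proof (rule Ck_on_SucI[OF assms(1)])
    show "((\<lambda>x. f (g x)) has_derivative (\<lambda>v. ?f' (g x) (?g' x v))) (at x)" if "x \<in> S" for x
      using diff_chain_at[OF Ck_on_has_derivative[OF Suc.prems(1) that]
          Ck_on_has_derivative[OF Suc.prems(2), of "g x"]] Suc.prems(3) that
      by (auto simp: o_def)
    fix v
    have "Ck_on n S (\<lambda>x. \<Sum>b\<in>Basis. (?g' x v \<bullet> b) *\<^sub>R ?f' (g x) b)"
    proof (intro Ck_on_sum assms(1) Ck_on_bilinear[OF assms(1) bounded_bilinear_scaleR])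
      fix b :: 'b
      show "Ck_on n S (\<lambda>x. ?g' x v \<bullet> b)"
        by (rule Ck_on_linear[OF assms(1) bounded_linear_inner_left]) (use Suc.prems in auto)
      show "Ck_on n S (\<lambda>x. ?f' (g x) b)"
        using Suc.IH[of "\<lambda>y. ?f' y b"] Suc.prems Ck_on_Suc_imp[OF Suc.prems(1)] by auto
    qed
    then show "Ck_on n S (\<lambda>x. ?f' (g x) (?g' x v))"
      by (rule Ck_on_cong[OF assms(1), rotated]) (simp add: expand)
  qed
qed

section \<open>Mixed partial derivatives\<close>

text \<open>Two mean value theorems: one in \<open>x\<close> for the difference
  \<open>f (x, b+h) - f (x, b)\<close>, then one in \<open>y\<close> for \<open>f1\<close> at the
  point found.\<close>

lemma double_difference_mvt:
  fixes f :: "real \<times> real \<Rightarrow> real"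
  assumes h: "h > 0"
    and f1: "\<And>x y. x \<in> {a..a+h} \<Longrightarrow> y \<in> {b..b+h} \<Longrightarrow> ((\<lambda>x. f (x, y)) has_real_derivative f1 (x, y)) (at x)"
    and f12: "\<And>x y. x \<in> {a..a+h} \<Longrightarrow> y \<in> {b..b+h} \<Longrightarrow> ((\<lambda>y. f1 (x, y)) has_real_derivative f12 (x, y)) (at y)"
  shows "\<exists>x\<in>{a..a+h}. \<exists>y\<in>{b..b+h}.
    f (a+h, b+h) - f (a+h, b) - f (a, b+h) + f (a, b) = h * h * f12 (x, y)"
proof -
  have "\<exists>z>a. z < a + h \<and> (f (a+h, b+h) - f (a+h, b)) - (f (a, b+h) - f (a, b))
      = (a + h - a) * (f1 (z, b+h) - f1 (z, b))"
    by (rule MVT2[where f="\<lambda>x. f (x, b+h) - f (x, b)"])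
      (use h in \<open>auto intro!: derivative_intros f1\<close>)
  then obtain z where z: "a < z" "z < a + h" and 1:
    "(f (a+h, b+h) - f (a+h, b)) - (f (a, b+h) - f (a, b)) = h * (f1 (z, b+h) - f1 (z, b))" by auto
  have "\<exists>y>b. y < b + h \<and> f1 (z, b+h) - f1 (z, b) = (b + h - b) * f12 (z, y)"
    by (rule MVT2[where f="\<lambda>y. f1 (z, y)"]) (use h z in \<open>auto intro!: f12\<close>)
  then obtain y where "b < y" "y < b + h" "f1 (z, b+h) - f1 (z, b) = h * f12 (z, y)" by auto
  then show ?thesis using 1 z by (intro bexI[of _ z] bexI[of _ y]) auto
qed

text \<open>The second difference over a square is symmetric in the two variables. Hence both mixed
  partials share a value, at possibly different points, in every small square at \<open>p\<close>,
  and continuity rules out distinct values at \<open>p\<close>.\<close>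

lemma mixed_partials_real:
  fixes f :: "real \<times> real \<Rightarrow> real"
  assumes "open S" "p \<in> S" "Ck_on 2 S f"
  defines "D \<equiv> \<lambda>v g q. frechet_derivative g (at q) v"
  shows "D (0, 1) (D (1, 0) f) p = D (1, 0) (D (0, 1) f) p"
proof (rule ccontr)
  assume neq: "\<not> ?thesis"
  obtain a b where p: "p = (a, b)" by (cases p)
  have Dx: "((\<lambda>x. g (x, y)) has_real_derivative D (1, 0) g (x, y)) (at x)"
    and Dy: "((\<lambda>y. g (x, y)) has_real_derivative D (0, 1) g (x, y)) (at y)"
    if "Ck_on (Suc n) S g" "(x, y) \<in> S" for g :: "real \<times> real \<Rightarrow> real" and n x y
  proof -
    have d: "(g has_derivative frechet_derivative g (at (x, y))) (at (x, y))"
      using that Ck_on_has_derivative by blast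
    have lin: "linear (frechet_derivative g (at (x, y)))"
      using d by (rule has_derivative_linear)
    have "((\<lambda>x. g (x, y)) has_derivative (\<lambda>h. frechet_derivative g (at (x, y)) (h, 0))) (at x)"
      using diff_chain_at[of "\<lambda>x. (x, y)" "\<lambda>h. (h, 0)" x g, OF _ d]
      by (simp add: o_def has_derivative_Pair)
    moreover have "((\<lambda>y. g (x, y)) has_derivative (\<lambda>h. frechet_derivative g (at (x, y)) (0, h))) (at y)"
      using diff_chain_at[of "\<lambda>y. (x, y)" "\<lambda>h. (0, h)" y g, OF _ d]
      by (simp add: o_def has_derivative_Pair)
    moreover have "frechet_derivative g (at (x, y)) (h, 0) = D (1, 0) g (x, y) * h"
      "frechet_derivative g (at (x, y)) (0, h) = D (0, 1) g (x, y) * h" for h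
      using linear_cmul[OF lin, of h "(1, 0)"] linear_cmul[OF lin, of h "(0, 1)"] by (auto simp: D_def)
    ultimately show "((\<lambda>x. g (x, y)) has_real_derivative D (1, 0) g (x, y)) (at x)"
      "((\<lambda>y. g (x, y)) has_real_derivative D (0, 1) g (x, y)) (at y)"
      by (auto simp: has_field_derivative_def)
  qed
  have C2: "Ck_on (Suc (Suc 0)) S f" using assms(3) by (simp add: numeral_2_eq_2)
  have C1: "Ck_on (Suc 0) S (D v f)" for v using C2 unfolding D_def Ck_on.simps by blast
  have C0: "continuous_on S (D w (D v f))" for v w using C1[of v, unfolded Ck_on.simps, THEN conjunct2, THEN spec, of w] by (simp only: D_def)
  let ?A = "D (0, 1) (D (1, 0) f)" and ?B = "D (1, 0) (D (0, 1) f)"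
  define e where "e = dist (?A p) (?B p) / 2"
  have "e > 0" using neq by (simp add: e_def)
  obtain r1 where r1: "r1 > 0" "\<And>q. q \<in> S \<Longrightarrow> dist q p < r1 \<Longrightarrow> dist (?A q) (?A p) < e"
    using C0 assms(2) \<open>e > 0\<close> unfolding continuous_on_iff by blast
  obtain r2 where r2: "r2 > 0" "\<And>q. q \<in> S \<Longrightarrow> dist q p < r2 \<Longrightarrow> dist (?B q) (?B p) < e"
    using C0 assms(2) \<open>e > 0\<close> unfolding continuous_on_iff by blast
  obtain r3 where r3: "r3 > 0" "ball p r3 \<subseteq> S" using assms(1,2) open_contains_ball by blast
  \<comment> \<open>Divided by 3 because points of the square are within \<open>2 * h\<close> of the
    corner \<open>p\<close>, strictly below the smallest radius.\<close>
  define h where "h = min r1 (min r2 r3) / 3"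
  have h: "h > 0" using r1 r2 r3 by (simp add: h_def)
  have box: "dist (x, y) p < min r1 (min r2 r3)" if "x \<in> {a..a+h}" "y \<in> {b..b+h}" for x y
  proof -
    have "dist (x, y) p \<le> \<bar>x - a\<bar> + \<bar>y - b\<bar>"
      using sqrt_sum_squares_le_sum_abs[of "x - a" "y - b"] by (simp add: p dist_Pair_Pair dist_real_def)
    also have "\<dots> \<le> 2 * h" using that by auto
    also have "\<dots> < 3 * h" using h by simp
    finally show ?thesis by (simp add: h_def)
  qed
  have S: "(x, y) \<in> S" if "x \<in> {a..a+h}" "y \<in> {b..b+h}" for x y
    using box[OF that] r3 by (auto simp: subset_iff dist_commute)
  obtain x1 y1 where 1: "x1 \<in> {a..a+h}" "y1 \<in> {b..b+h}"
    "f (a+h, b+h) - f (a+h, b) - f (a, b+h) + f (a, b) = h * h * ?A (x1, y1)"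
    using double_difference_mvt[OF h, of a b f "D (1,0) f" ?A] Dx[OF C2] Dy[OF C1] S by blast
  have "\<exists>x\<in>{b..b+h}. \<exists>y\<in>{a..a+h}.
    f (a+h, b+h) - f (a, b+h) - f (a+h, b) + f (a, b) = h * h * ?B (y, x)"
    using double_difference_mvt[OF h, of b a "\<lambda>(x, y). f (y, x)" "\<lambda>(x, y). D (0,1) f (y, x)" "\<lambda>(x, y). ?B (y, x)"]
      Dy[OF C2] Dx[OF C1] S by simp
  then obtain x2 y2 where 2: "x2 \<in> {a..a+h}" "y2 \<in> {b..b+h}"
    "f (a+h, b+h) - f (a, b+h) - f (a+h, b) + f (a, b) = h * h * ?B (x2, y2)" by blast
  have "h * h * ?A (x1, y1) = h * h * ?B (x2, y2)" using 1 2 by linarith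
  then have "?A (x1, y1) = ?B (x2, y2)" using h by simp
  then have "dist (?A (x1, y1)) (?A p) < e" "dist (?A (x1, y1)) (?B p) < e"
    using r1(2)[OF S[OF 1(1,2)]] r2(2)[OF S[OF 2(1,2)]] box[OF 1(1,2)] box[OF 2(1,2)] by auto
  then have "dist (?A p) (?B p) < 2 * e"
    using dist_triangle[of "?A p" "?B p" "?A (x1, y1)"] dist_commute[of "?A p" "?A (x1, y1)"]
    by linarith
  then show False by (simp add: e_def)
qed

lemma mixed_partials:
  fixes f :: "real \<times> real \<Rightarrow> 'b::euclidean_space"
  assumes "open S" "p \<in> S" "Ck_on 2 S f"
  defines "D \<equiv> \<lambda>v g q. frechet_derivative g (at q) v"
  shows "D (0, 1) (D (1, 0) f) p = D (1, 0) (D (0, 1) f) p"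
proof (rule euclidean_eqI)
  fix b :: 'b
  have comm: "frechet_derivative (\<lambda>q. g q \<bullet> b) (at q) v = frechet_derivative g (at q) v \<bullet> b"
    if "g differentiable (at q)" for g :: "real \<times> real \<Rightarrow> 'b" and q v
    using frechet_derivative_at[OF bounded_linear.has_derivative[OF bounded_linear_inner_left
          that[unfolded frechet_derivative_works]], of b, symmetric] by simp
  have C2: "Ck_on (Suc (Suc 0)) S f" using assms(3) by (simp add: numeral_2_eq_2)
  have twice: "frechet_derivative (\<lambda>q. frechet_derivative (\<lambda>q. f q \<bullet> b) (at q) v) (at p) w
      = frechet_derivative (\<lambda>q. frechet_derivative f (at q) v) (at p) w \<bullet> b" for v w
  proof -
    let ?f' = "\<lambda>q. frechet_derivative f (at q) v"
    have d: "?f' differentiable (at p)" using C2 assms(2) unfolding Ck_on.simps by blast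
    have "frechet_derivative (\<lambda>q. ?f' q \<bullet> b) (at p)
        = frechet_derivative (\<lambda>q. frechet_derivative (\<lambda>q. f q \<bullet> b) (at q) v) (at p)"
      by (rule frechet_derivative_transform_within_open[OF _ assms(1,2)])
        (use d C2 in \<open>auto simp: comm simp del: split_paired_All\<close>)
    then show ?thesis using comm[OF d] by simp
  qed
  have "Ck_on 2 S (\<lambda>q. f q \<bullet> b)"
    using Ck_on_linear[OF assms(1) bounded_linear_inner_left assms(3)] .
  from mixed_partials_real[OF assms(1,2) this] show "D (0, 1) (D (1, 0) f) p \<bullet> b = D (1, 0) (D (0, 1) f) p \<bullet> b"
    by (simp add: D_def twice)
qed

section \<open>Solutions of linear systems\<close>

lemma differentiable_linear_solve:
  fixes A :: "'a::real_normed_vector \<Rightarrow> 'b::euclidean_space \<Rightarrow> 'b"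
  assumes "open N" "u0 \<in> N"
    and lin: "\<And>u. u \<in> N \<Longrightarrow> linear (A u)"
    and dA: "\<And>x. (\<lambda>u. A u x) differentiable (at u0)"
    and inj: "\<And>x. A u0 x = 0 \<Longrightarrow> x = 0"
    and df: "f differentiable (at u0)"
    and sol: "\<And>u. u \<in> N \<Longrightarrow> A u (y u) = f u"
  shows "y differentiable (at u0)"
proof -
  have lin0: "linear (A u0)" using lin assms(2) .
  have "inj (A u0)" using inj by (simp add: linear_injective_0[OF lin0])
  then obtain B where B0: "linear B" "B \<circ> A u0 = id"
    using linear_injective_left_inverse[OF lin0] by blast
  have B: "linear B" "\<And>x. B (A u0 x) = x" using B0 by (auto simp: fun_eq_iff)
  obtain K where K: "K > 0" "\<And>x. norm (B x) \<le> K * norm x"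
    using linear_bounded_pos[OF B(1)] by blast
  define r where "r u = f u - A u (y u0)" for u
  define \<delta> where "\<delta> u = (\<Sum>b\<in>Basis. norm (A u b - A u0 b))" for u
  have r0: "r u0 = 0" using sol[OF assms(2)] by (simp add: r_def)
  have dr: "r differentiable (at u0)" unfolding r_def by (intro differentiable_diff df dA)
  then obtain r' where r': "(r has_derivative r') (at u0)" by (auto simp: differentiable_def)
  have \<delta>b: "norm (A u x - A u0 x) \<le> \<delta> u * norm x" if "u \<in> N" for u x
  proof -
    define g where "g x = A u x - A u0 x" for x
    have g: "linear g" unfolding g_def by (rule linear_compose_sub[OF lin[OF that] lin0])
    have "g x = g (\<Sum>b\<in>Basis. (x \<bullet> b) *\<^sub>R b)" by (simp only: euclidean_representation)
    also have "\<dots> = (\<Sum>b\<in>Basis. (x \<bullet> b) *\<^sub>R g b)"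
      by (simp only: linear_sum[OF g] linear_cmul[OF g])
    also have "norm \<dots> \<le> (\<Sum>b\<in>Basis. norm (g b) * norm x)"
    proof (rule sum_norm_le)
      fix b :: 'b assume "b \<in> Basis"
      then have "\<bar>x \<bullet> b\<bar> \<le> norm x" by (rule Basis_le_norm)
      from mult_left_mono[OF this norm_ge_zero[of "g b"]] show "norm ((x \<bullet> b) *\<^sub>R g b) \<le> norm (g b) * norm x"
        by (simp add: mult.commute)
    qed
    finally show ?thesis unfolding \<delta>_def sum_distrib_right g_def .
  qed
  have "isCont (\<lambda>u. A u b) u0" for b
    by (rule differentiable_imp_continuous_within[OF dA])
  then have "isCont \<delta> u0" unfolding \<delta>_def by (intro continuous_intros)
  then have \<delta>0: "(\<delta> \<longlongrightarrow> 0) (at u0)" by (simp add: isCont_def \<delta>_def)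
  have N: "eventually (\<lambda>u. u \<in> N) (at u0)" using eventually_at_in_open'[OF assms(1,2)] .
  \<comment> \<open>\<open>r\<close> collects the change seen at the fixed vector
    \<open>y u0\<close>; what remains is a small operator applied to a small vector.\<close>
  have key: "A u0 (y u - y u0) = r u - (A u (y u - y u0) - A u0 (y u - y u0))" if "u \<in> N" for u
    using sol[OF that] lin[OF that] by (simp add: r_def linear_diff)
  \<comment> \<open>This threshold makes \<open>K * \<delta> u\<close> less than 1/2, so the term
    containing \<open>y u - y u0\<close> on the right can be absorbed on the left.\<close>
  have small: "eventually (\<lambda>u. \<delta> u < 1 / (2 * K)) (at u0)"
    by (rule order_tendstoD(2)[OF \<delta>0]) (use K(1) in simp)
  have bound: "eventually (\<lambda>u. norm (y u - y u0) \<le> 2 * K * norm (r u)) (at u0)"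
    using N small
  proof eventually_elim
    case (elim u)
    have "norm (y u - y u0) \<le> K * norm (A u0 (y u - y u0))" using K(2)[of "A u0 (y u - y u0)"] by (simp add: B)
    also have "norm (A u0 (y u - y u0)) \<le> norm (r u) + \<delta> u * norm (y u - y u0)"
      using \<delta>b[OF elim(1), of "y u - y u0"] arg_cong[OF key[OF elim(1)], of norm]
        norm_triangle_ineq4[of "r u" "A u (y u - y u0) - A u0 (y u - y u0)"] by linarith
    also have "\<delta> u * norm (y u - y u0) \<le> 1 / (2 * K) * norm (y u - y u0)"
      using elim by (intro mult_right_mono) auto
    finally have "norm (y u - y u0) \<le> K * (norm (r u) + 1 / (2 * K) * norm (y u - y u0))"
      using K(1) by simp
    also have "\<dots> = K * norm (r u) + norm (y u - y u0) / 2" using K(1) by (simp add: distrib_left)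
    finally show ?case by linarith
  qed
  \<comment> \<open>\<open>B\<close> inverts \<open>A u0\<close>, so solving \<open>key\<close> to
    first order gives this candidate.\<close>
  let ?y' = "\<lambda>h. B (r' h)"
  have "(y has_derivative ?y') (at u0)"
  proof (rule has_derivativeI)
    show "bounded_linear ?y'"
      using bounded_linear_compose[OF linear_conv_bounded_linear[THEN iffD1, OF B(1)] has_derivative_bounded_linear[OF r']] .
    let ?R = "\<lambda>u. norm (r u - r' (u - u0)) / norm (u - u0)"
    have R0: "(?R \<longlongrightarrow> 0) (at u0)"
      using r' r0 unfolding has_derivative_iff_norm by simp
    obtain M where M: "M > 0" "\<And>h. norm (r' h) \<le> norm h * M"
      using bounded_linear.pos_bounded[OF has_derivative_bounded_linear[OF r']] by blast
    have "((\<lambda>u. K * (?R u + \<delta> u * (2 * K * (?R u + M)))) \<longlongrightarrow> K * (0 + 0 * (2 * K * (0 + M)))) (at u0)"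
      by (intro tendsto_intros R0 \<delta>0)
    then have lim: "((\<lambda>u. K * (?R u + \<delta> u * (2 * K * (?R u + M)))) \<longlongrightarrow> 0) (at u0)" by simp
    have "eventually (\<lambda>u. norm ((y u - y u0 - ?y' (u - u0)) /\<^sub>R norm (u - u0))
        \<le> K * (?R u + \<delta> u * (2 * K * (?R u + M)))) (at u0)"
      using N bound eventually_neq_at_within[of u0]
    proof eventually_elim
      case (elim u)
      let ?d = "norm (u - u0)"
      have d: "?d > 0" using elim by simp
      have \<delta>pos: "\<delta> u \<ge> 0" by (simp add: \<delta>_def sum_nonneg)
      have rb: "norm (r u) \<le> ?d * (?R u + M)"
      proof -
        have "norm (r u) \<le> norm (r u - r' (u - u0)) + norm (r' (u - u0))"
          using norm_triangle_ineq[of "r u - r' (u - u0)" "r' (u - u0)"] by simp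
        also have "\<dots> \<le> norm (r u - r' (u - u0)) + ?d * M" using M by simp
        finally show ?thesis using d by (simp add: distrib_left)
      qed
      have "y u - y u0 - ?y' (u - u0) = B (A u0 (y u - y u0) - r' (u - u0))"
        using B by (simp add: linear_diff)
      also have "norm \<dots> \<le> K * norm (A u0 (y u - y u0) - r' (u - u0))" by (rule K(2))
      also have "norm (A u0 (y u - y u0) - r' (u - u0))
          \<le> norm (r u - r' (u - u0)) + \<delta> u * norm (y u - y u0)"
      proof -
        have e: "A u0 (y u - y u0) - r' (u - u0)
            = (r u - r' (u - u0)) - (A u (y u - y u0) - A u0 (y u - y u0))"
          by (subst key[OF elim(1)]) (simp add: algebra_simps)
        show ?thesis
          using arg_cong[OF e, of norm] \<delta>b[OF elim(1), of "y u - y u0"]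
            norm_triangle_ineq4[of "r u - r' (u - u0)" "A u (y u - y u0) - A u0 (y u - y u0)"]
          by linarith
      qed
      also have "norm (y u - y u0) \<le> 2 * K * (?d * (?R u + M))"
        by (rule order_trans[OF elim(2) mult_left_mono[OF rb]]) (use K(1) in simp)
      finally have "norm (y u - y u0 - ?y' (u - u0))
          \<le> K * (norm (r u - r' (u - u0)) + \<delta> u * (2 * K * (?d * (?R u + M))))"
        using K(1) \<delta>pos by (simp add: mult_left_mono)
      moreover have "norm (r u - r' (u - u0)) = ?R u * ?d" using d by simp
      then have "K * (norm (r u - r' (u - u0)) + \<delta> u * (2 * K * (?d * (?R u + M))))
          = K * (?R u + \<delta> u * (2 * K * (?R u + M))) * ?d" by (simp only: algebra_simps)
      ultimately have "norm (y u - y u0 - ?y' (u - u0)) \<le> K * (?R u + \<delta> u * (2 * K * (?R u + M))) * ?d"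
        by linarith
      then have "norm (y u - y u0 - ?y' (u - u0)) / ?d \<le> K * (?R u + \<delta> u * (2 * K * (?R u + M)))"
        using d by (simp only: pos_divide_le_eq)
      then show ?case by (simp only: norm_scaleR abs_inverse abs_norm_cancel divide_inverse_commute)
    qed
    then have "((\<lambda>u. (y u - y u0 - ?y' (u - u0)) /\<^sub>R norm (u - u0)) \<longlongrightarrow> 0) (at u0)"
      using lim by (rule Lim_null_comparison)
    then show "((\<lambda>u. (y u - y u0 - ?y' (u - u0)) /\<^sub>R norm (u - u0)) \<longlongrightarrow> 0) (at u0 within UNIV)" by simp
  qed
  then show ?thesis by (auto simp: differentiable_def)
qed

section \<open>Matrix algebra\<close>

lemma matrix_mult_minus: "A ** (- B) = - (A ** B :: complex^'k^'m)"
  by (simp add: matrix_matrix_mult_def vec_eq_iff sum_negf)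

lemma matrix_add_rdistrib': "(A + B) ** C = A ** C + B ** (C :: complex^'k^'m)"
  by (simp add: matrix_matrix_mult_def vec_eq_iff sum.distrib distrib_right)

lemma hconj_minus: "(- A)\<^sup>H = - (A\<^sup>H)"
  by (simp add: hconj_def vec_eq_iff)

lemma hconj_0: "0\<^sup>H = 0"
  by (simp add: hconj_def vec_eq_iff)

lemmas hconj_simps = hconj_mult hconj_hconj hconj_add hconj_diff hconj_minus hconj_scaleR
  hconj_mat_1 hconj_0

lemmas mat_simps = matrix_mul_assoc matrix_add_ldistrib matrix_add_rdistrib' matrix_sub_ldistrib
  matrix_sub_rdistrib minus_matrix_mult matrix_mult_minus scaleR_matrix_mult matrix_mult_scaleR

lemma bounded_bilinear_matrix_mult:
  "bounded_bilinear (\<lambda>(A :: complex^'n^'m) (B :: complex^'k^'n). A ** B)"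
  unfolding bilinear_conv_bounded_bilinear[symmetric] bilinear_def
  by (auto intro!: linearI simp: mat_simps)

lemmas has_vector_derivative_matrix_mult [derivative_intros] =
  bounded_bilinear.has_vector_derivative[OF bounded_bilinear_matrix_mult]

lemmas bounded_linear_matrix_mult_left = bounded_bilinear.bounded_linear_left[OF bounded_bilinear_matrix_mult]
lemmas bounded_linear_matrix_mult_right = bounded_bilinear.bounded_linear_right[OF bounded_bilinear_matrix_mult]

lemma bounded_linear_hconj: "bounded_linear (hconj :: complex^'n^'m \<Rightarrow> complex^'m^'n)"
  unfolding linear_conv_bounded_linear[symmetric]
  by (auto intro!: linearI simp: hconj_simps)

lemma bounded_linear_Re_trace: "bounded_linear (\<lambda>A :: complex^'n^'n. Re (trace A))"
  unfolding linear_conv_bounded_linear[symmetric]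
  by (auto intro!: linearI simp: trace_add trace_scaleR)

lemma inner_eq_trace: "A \<bullet> B = Re (trace (A\<^sup>H ** (B :: complex^'k^'m)))"
proof -
  have "A \<bullet> B = (\<Sum>i\<in>UNIV. \<Sum>j\<in>UNIV. Re (cnj (A $ i $ j) * B $ i $ j))"
    by (simp add: inner_vec_def inner_complex_def)
  also have "\<dots> = (\<Sum>j\<in>UNIV. \<Sum>i\<in>UNIV. Re (cnj (A $ i $ j) * B $ i $ j))"
    by (rule sum.swap)
  also have "\<dots> = Re (trace (A\<^sup>H ** B))"
    by (simp add: trace_def matrix_matrix_mult_def hconj_def)
  finally show ?thesis .
qed

lemma trace_hconj: "trace (A\<^sup>H) = cnj (trace (A :: complex^'n^'n))"
  by (simp add: trace_def hconj_def)

lemma hermitianD: "A \<in> hermitian \<Longrightarrow> A\<^sup>H = A"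
  by (simp add: hermitian_def)

lemma has_vector_derivative_vecI:
  fixes f :: "real \<Rightarrow> ('a::euclidean_space)^'n"
  assumes "\<And>i. ((\<lambda>t. f t $ i) has_vector_derivative d $ i) (at x)"
  shows "(f has_vector_derivative d) (at x)"
  unfolding has_vector_derivative_def
proof (rule has_derivativeI)
  show "bounded_linear (\<lambda>h. h *\<^sub>R d)" by (rule bounded_linear_scaleR_left)
  show "((\<lambda>y. (f y - f x - (y - x) *\<^sub>R d) /\<^sub>R norm (y - x)) \<longlongrightarrow> 0) (at x within UNIV)"
  proof (rule vec_tendstoI)
    fix i
    have "((\<lambda>y. (f y $ i - f x $ i - (y - x) *\<^sub>R d $ i) /\<^sub>R norm (y - x)) \<longlongrightarrow> 0) (at x within UNIV)"
      using assms[of i] unfolding has_vector_derivative_def has_derivative_def by (simp add: netlimit_at)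
    then show "((\<lambda>y. ((f y - f x - (y - x) *\<^sub>R d) /\<^sub>R norm (y - x)) $ i) \<longlongrightarrow> 0 $ i) (at x within UNIV)"
      by simp
  qed
qed

section \<open>The matrix exponential\<close>

lemma matrix_power_scaleR: "matrix_power (t *\<^sub>R A) n = t ^ n *\<^sub>R matrix_power A n"
  by (induction n) (simp_all add: mat_simps mult.commute)

lemma matrix_power_commute: "matrix_power A n ** A = A ** matrix_power A n"
  by (induction n) (simp_all add: matrix_mul_assoc[symmetric])

lemma summable_matrix_exp: "summable (\<lambda>n. matrix_power A n /\<^sub>R fact n :: complex^'n^'n)"
proof -
  obtain K where K: "K > 0" "\<And>(A :: complex^'n^'n) (B :: complex^'n^'n). norm (A ** B) \<le> norm A * norm B * K"
    using bounded_bilinear.pos_bounded[OF bounded_bilinear_matrix_mult] by blast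
  have bound: "norm (matrix_power A n) \<le> norm (mat 1 :: complex^'n^'n) * (K * norm A) ^ n" for n
  proof (induction n)
    case (Suc n)
    have "norm (matrix_power A (Suc n)) \<le> norm A * norm (matrix_power A n) * K"
      using K(2)[of A "matrix_power A n"] by simp
    also have "\<dots> \<le> norm A * (norm (mat 1 :: complex^'n^'n) * (K * norm A) ^ n) * K"
      by (intro mult_right_mono mult_left_mono Suc) (use K(1) in auto)
    finally show ?case by (simp add: mult_ac)
  qed simp
  have "summable (\<lambda>n. norm (mat 1 :: complex^'n^'n) * (inverse (fact n) * (K * norm A) ^ n))"
    by (intro summable_mult summable_exp)
  then show ?thesis
  proof (rule summable_comparison_test'[where N = 0])
    fix n :: nat
    show "norm (matrix_power A n /\<^sub>R fact n)
      \<le> norm (mat 1 :: complex^'n^'n) * (inverse (fact n) * (K * norm A) ^ n)"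
      using mult_left_mono[OF bound[of n], of "inverse (fact n)"] by (simp add: mult_ac)
  qed
qed

text \<open>Each entry is a complex power series in \<open>t\<close>, so termwise differentiation of
  scalar series applies; the index shift of \<open>diffs\<close> produces the extra factor
  \<open>A\<close>.\<close>

lemma matrix_exp_has_derivative:
  fixes A :: "complex^'n^'n"
  shows "((\<lambda>t. matrix_exp (t *\<^sub>R A)) has_vector_derivative A ** matrix_exp (t *\<^sub>R A)) (at t)"
proof (intro has_vector_derivative_vecI)
  fix i j
  define c where "c n = matrix_power A n $ i $ j /\<^sub>R fact n" for n
  have entry: "bounded_linear (\<lambda>X :: complex^'n^'n. X $ i $ j)"
    by (intro bounded_linear_compose[OF bounded_linear_vec_nth] bounded_linear_vec_nth)
  have entryA: "bounded_linear (\<lambda>X :: complex^'n^'n. (A ** X) $ i $ j)"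
    by (rule bounded_linear_compose[OF entry bounded_linear_matrix_mult_right])
  have series: "(\<lambda>n. c n * of_real x ^ n) sums (matrix_exp (x *\<^sub>R A) $ i $ j)" for x
  proof -
    have "(\<lambda>n. (matrix_power (x *\<^sub>R A) n /\<^sub>R fact n) $ i $ j) sums (matrix_exp (x *\<^sub>R A) $ i $ j)"
      unfolding matrix_exp_def by (rule bounded_linear.sums[OF entry summable_sums[OF summable_matrix_exp]])
    then show ?thesis by (simp add: matrix_power_scaleR c_def scaleR_conv_of_real[where 'a = complex] mult_ac)
  qed
  have "(\<lambda>n. (A ** (matrix_power (t *\<^sub>R A) n /\<^sub>R fact n)) $ i $ j) sums ((A ** matrix_exp (t *\<^sub>R A)) $ i $ j)"
    unfolding matrix_exp_def by (rule bounded_linear.sums[OF entryA summable_sums[OF summable_matrix_exp]])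
  moreover have "(A ** (matrix_power (t *\<^sub>R A) n /\<^sub>R fact n)) $ i $ j = diffs c n * of_real t ^ n" for n
  proof -
    have "of_nat (Suc n) * (z /\<^sub>R fact (Suc n)) = z /\<^sub>R fact n" for z :: complex
      by (simp add: scaleR_conv_of_real[where 'a = complex] del: of_nat_Suc)
    then show ?thesis
      by (simp add: diffs_def c_def matrix_power_scaleR mat_simps del: of_nat_Suc fact_Suc)
        (simp add: scaleR_conv_of_real[where 'a = complex])
  qed
  ultimately have derived: "(\<Sum>n. diffs c n * of_real t ^ n) = (A ** matrix_exp (t *\<^sub>R A)) $ i $ j"
    by (simp add: sums_iff)
  \<comment> \<open>Convergence is known at real points; the real point \<open>norm y + 1\<close>
    has larger modulus than \<open>y\<close>.\<close>
  have "summable (\<lambda>n. c n * y ^ n)" for y :: complex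
    using powser_inside[OF sums_summable[OF series[of "norm y + 1"]], of y] by simp
  then have "((\<lambda>x. \<Sum>n. c n * x ^ n) has_field_derivative (\<Sum>n. diffs c n * of_real t ^ n)) (at (of_real t))"
    by (rule termdiffs_strong_converges_everywhere)
  then have "((\<lambda>x. \<Sum>n. c n * of_real x ^ n) has_vector_derivative (\<Sum>n. diffs c n * of_real t ^ n)) (at t)"
    by (rule has_vector_derivative_real_field)
  then show "((\<lambda>x. matrix_exp (x *\<^sub>R A) $ i $ j) has_vector_derivative (A ** matrix_exp (t *\<^sub>R A)) $ i $ j) (at t)"
    unfolding derived using series by (simp add: sums_iff)
qed

lemma matrix_exp_0: "matrix_exp (0 :: complex^'n^'n) = mat 1"
proof -
  have "matrix_power (0 :: complex^'n^'n) n /\<^sub>R fact n = (if n = 0 then mat 1 else 0)" for n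
    by (cases n) auto
  then have "(\<lambda>n. matrix_power (0 :: complex^'n^'n) n /\<^sub>R fact n) sums (mat 1 :: complex^'n^'n)"
    using sums_If_finite[of "\<lambda>n. n = 0" "\<lambda>n. mat 1 :: complex^'n^'n"] by (simp add: sums_def cong: if_cong)
  then show ?thesis unfolding matrix_exp_def by (simp add: sums_iff)
qed

lemma matrix_exp_commute: "matrix_exp A ** A = A ** (matrix_exp A :: complex^'n^'n)"
proof -
  note s = summable_sums[OF summable_matrix_exp[of A]]
  have "(\<lambda>n. matrix_power A n /\<^sub>R fact n ** A) sums (matrix_exp A ** A)"
    "(\<lambda>n. A ** (matrix_power A n /\<^sub>R fact n)) sums (A ** matrix_exp A)"
    unfolding matrix_exp_def
    by (rule bounded_linear.sums[OF bounded_linear_matrix_mult_left s],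
        rule bounded_linear.sums[OF bounded_linear_matrix_mult_right s])
  then show ?thesis by (simp add: mat_simps matrix_power_commute sums_iff)
qed

lemma matrix_exp_scaleR_commute: "matrix_exp (t *\<^sub>R A) ** A = A ** (matrix_exp (t *\<^sub>R A) :: complex^'n^'n)"
  by (cases "t = 0") (use matrix_exp_commute[of "t *\<^sub>R A"] in \<open>auto simp: matrix_exp_0 mat_simps\<close>)

lemma hconj_matrix_exp: "(matrix_exp A)\<^sup>H = matrix_exp ((A :: complex^'n^'n)\<^sup>H)"
proof -
  have p: "(matrix_power A n)\<^sup>H = matrix_power (A\<^sup>H) n" for n
    by (induction n) (simp_all add: hconj_simps matrix_power_commute)
  have "(\<lambda>n. (matrix_power A n /\<^sub>R fact n)\<^sup>H) sums (matrix_exp A)\<^sup>H"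
    unfolding matrix_exp_def by (rule bounded_linear.sums[OF bounded_linear_hconj summable_sums[OF summable_matrix_exp]])
  then show ?thesis by (simp add: hconj_simps p matrix_exp_def sums_iff)
qed

lemma constant_on_reals:
  fixes f :: "real \<Rightarrow> 'b::real_normed_vector"
  assumes "\<And>t. (f has_vector_derivative 0) (at t)"
  shows "f t = f 0"
proof -
  obtain c where "\<And>t. f t = c"
    using has_vector_derivative_zero_constant[of UNIV f] assms by auto
  then show ?thesis by simp
qed

lemma matrix_exp_has_derivative_minus:
  "((\<lambda>t. matrix_exp (- t *\<^sub>R A)) has_vector_derivative - (A ** matrix_exp (- t *\<^sub>R A) :: complex^'n^'n)) (at t)"
  using matrix_exp_has_derivative[of "- A" t] by (simp add: mat_simps)

text \<open>The product is constant in \<open>t\<close> because \<open>A\<close> commutes with its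
  exponential. The inverse and the addition rule are both read off from this.\<close>

lemma matrix_exp_shift:
  "matrix_exp (- t *\<^sub>R A) ** matrix_exp ((t + s) *\<^sub>R A) = (matrix_exp (s *\<^sub>R A) :: complex^'n^'n)"
proof -
  let ?f = "\<lambda>t. matrix_exp (- t *\<^sub>R A) ** matrix_exp ((t + s) *\<^sub>R A)"
  have "(?f has_vector_derivative 0) (at t)" for t
  proof -
    have "((\<lambda>t. t + s) has_vector_derivative 1) (at t)"
      unfolding has_real_derivative_iff_has_vector_derivative[symmetric]
      by (auto intro!: derivative_eq_intros)
    then have "((\<lambda>t. matrix_exp ((t + s) *\<^sub>R A)) has_vector_derivative A ** matrix_exp ((t + s) *\<^sub>R A)) (at t)"
      using vector_diff_chain_at[of "\<lambda>t. t + s" 1 t "\<lambda>t. matrix_exp (t *\<^sub>R A)"] matrix_exp_has_derivative[of A "t + s"]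
      by (simp add: o_def)
    from has_vector_derivative_matrix_mult[OF matrix_exp_has_derivative_minus this]
    have "(?f has_vector_derivative matrix_exp (- t *\<^sub>R A) ** (A ** matrix_exp ((t + s) *\<^sub>R A))
        + - (A ** matrix_exp (- t *\<^sub>R A)) ** matrix_exp ((t + s) *\<^sub>R A)) (at t)" .
    then show ?thesis
      using matrix_exp_scaleR_commute[of "- t" A] by (simp add: mat_simps)
  qed
  from constant_on_reals[of ?f, OF this, of t] show ?thesis by (simp add: matrix_exp_0)
qed

lemma matrix_exp_minus: "matrix_exp (- A) ** matrix_exp A = (mat 1 :: complex^'n^'n)"
  using matrix_exp_shift[of 1 A 0] by (simp add: matrix_exp_0)

lemma matrix_exp_minus': "matrix_exp A ** matrix_exp (- A) = (mat 1 :: complex^'n^'n)"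
  using matrix_exp_minus[of "- A"] by simp

lemma matrix_exp_add:
  "matrix_exp ((t + s) *\<^sub>R A) = matrix_exp (t *\<^sub>R A) ** (matrix_exp (s *\<^sub>R A) :: complex^'n^'n)"
proof -
  have "matrix_exp (t *\<^sub>R A) ** matrix_exp (s *\<^sub>R A)
      = (matrix_exp (t *\<^sub>R A) ** matrix_exp (- t *\<^sub>R A)) ** matrix_exp ((t + s) *\<^sub>R A)"
    unfolding matrix_exp_shift[of t A s, symmetric] by (simp add: matrix_mul_assoc)
  then show ?thesis using matrix_exp_minus'[of "t *\<^sub>R A"] by simp
qed

lemma matrix_exp_skew_unitary:
  assumes "\<Omega>\<^sup>H = - \<Omega>"
  shows "matrix_exp (t *\<^sub>R \<Omega>) \<in> (unitary :: (complex^'n^'n) set)"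
  using matrix_exp_minus[of "t *\<^sub>R \<Omega>"] matrix_exp_minus'[of "t *\<^sub>R \<Omega>"]
  by (simp add: unitary_def hconj_matrix_exp hconj_simps assms)

section \<open>Positive definite matrices and their square roots\<close>

definition qform :: "complex^'k^'k \<Rightarrow> complex^'k \<Rightarrow> complex"
  where "qform A x = (\<Sum>i\<in>UNIV. cnj (x $ i) * (A *v x) $ i)"

lemma hpd_iff_qform: "A \<in> hpd \<longleftrightarrow> A \<in> hermitian \<and> (\<forall>x. x \<noteq> 0 \<longrightarrow> 0 < Re (qform A x))"
  by (simp add: hpd_def qform_def)

lemma qform_congruence:
  fixes A :: "complex^'k^'k" and B :: "complex^'m^'k"
  shows "qform (B\<^sup>H ** A ** B) x = qform A (B *v x)"
proof -
  let ?y = "A *v (B *v x)"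
  have "qform (B\<^sup>H ** A ** B) x = (\<Sum>i\<in>UNIV. cnj (x $ i) * (B\<^sup>H *v ?y) $ i)"
    by (simp add: qform_def matrix_vector_mul_assoc matrix_mul_assoc)
  also have "\<dots> = (\<Sum>i\<in>UNIV. \<Sum>j\<in>UNIV. cnj (x $ i) * (cnj (B $ j $ i) * ?y $ j))"
    by (simp add: matrix_vector_mult_def hconj_def sum_distrib_left)
  also have "\<dots> = (\<Sum>j\<in>UNIV. \<Sum>i\<in>UNIV. cnj (x $ i) * (cnj (B $ j $ i) * ?y $ j))"
    by (rule sum.swap)
  also have "\<dots> = (\<Sum>j\<in>UNIV. cnj ((B *v x) $ j) * ?y $ j)"
    by (simp add: matrix_vector_mult_def sum_distrib_right cnj_sum mult_ac)
  finally show ?thesis by (simp add: qform_def)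
qed

lemma qform_mat_1: "Re (qform (mat 1) x) = (norm x)\<^sup>2"
  by (simp add: qform_def norm_vec_def L2_set_def sum_nonneg cmod_power2)
    (simp add: power2_eq_square)

lemma hpd_congruence:
  fixes B :: "complex^'m^'k"
  assumes "A \<in> hpd" "C ** B = mat 1"
  shows "B\<^sup>H ** A ** B \<in> hpd"
proof -
  have "B *v x \<noteq> 0" if "x \<noteq> 0" for x
  proof
    assume "B *v x = 0"
    then have "(C ** B) *v x = 0" by (simp add: matrix_vector_mul_assoc[symmetric])
    then show False using that assms(2) by simp
  qed
  then show ?thesis
    using assms(1) by (simp add: hpd_iff_qform qform_congruence hermitian_def hconj_simps matrix_mul_assoc)
qed

lemma hpd_mat_1: "mat 1 \<in> hpd"
  by (simp add: hpd_iff_qform qform_mat_1 hermitian_def hconj_simps)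

lemma hpd_gram: "C ** B = mat 1 \<Longrightarrow> B\<^sup>H ** B \<in> hpd"
  using hpd_congruence[OF hpd_mat_1, of C B] by simp

text \<open>Halving the exponent exhibits the exponential as the Gram matrix of an invertible
  matrix.\<close>

lemma hpd_exp:
  assumes "H \<in> hermitian"
  shows "matrix_exp H \<in> hpd"
proof -
  let ?F = "matrix_exp ((1/2) *\<^sub>R H)"
  have "?F\<^sup>H = ?F" using hermitianD[OF assms] by (simp add: hconj_matrix_exp hconj_simps)
  moreover have "?F ** ?F = matrix_exp H" using matrix_exp_add[of "1/2" "1/2" H] by simp
  ultimately show ?thesis using hpd_gram[OF matrix_exp_minus[of "(1/2) *\<^sub>R H"]] by simp
qed

section \<open>Unitary matrices and the spectral theorem for Hermitian matrices\<close>

lemma unitaryD: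
  assumes "V \<in> unitary"
  shows "V\<^sup>H ** V = mat 1" "V ** V\<^sup>H = mat 1"
  using assms by (auto simp: unitary_def)

lemma compact_unitary: "compact (unitary :: (complex^'n^'n) set)"
  unfolding compact_eq_bounded_closed
proof
  have "norm V \<le> sqrt (Re (trace (mat 1 :: complex^'n^'n)))" if "V \<in> unitary" for V :: "complex^'n^'n"
    using unitaryD[OF that] by (simp add: norm_eq_sqrt_inner inner_eq_trace)
  then show "bounded (unitary :: (complex^'n^'n) set)" unfolding bounded_iff by blast
  have c: "continuous_on UNIV (\<lambda>V :: complex^'n^'n. V\<^sup>H)"
    using bounded_linear_hconj by (rule linear_continuous_on)
  have "closed ({V :: complex^'n^'n. V\<^sup>H ** V = mat 1} \<inter> {V. V ** V\<^sup>H = mat 1})"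
    by (intro closed_Int closed_Collect_eq continuous_on_const
        bounded_bilinear.continuous_on[OF bounded_bilinear_matrix_mult] c continuous_on_id)
  then show "closed (unitary :: (complex^'n^'n) set)" unfolding unitary_def Collect_conj_eq .
qed

lemma unitary_mult: "V \<in> unitary \<Longrightarrow> W \<in> unitary \<Longrightarrow> V ** W \<in> unitary"
  unfolding unitary_def
  by (simp add: hconj_simps) (metis (no_types, lifting) matrix_mul_assoc matrix_mul_lid)

definition dmat :: "('n \<Rightarrow> real) \<Rightarrow> complex^'n^'n"
  where "dmat d = (\<chi> i j. if i = j then of_real (d i) else 0)"

lemma dmat_mult: "dmat d ** A = (\<chi> i j. of_real (d i) * A $ i $ j)"
  by (simp add: dmat_def matrix_matrix_mult_def if_distrib[of "\<lambda>x. x * _"] cong: if_cong)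

lemma mult_dmat: "A ** dmat d = (\<chi> i j. A $ i $ j * of_real (d j))"
  by (simp add: dmat_def matrix_matrix_mult_def if_distrib[of "\<lambda>x. _ * x"] cong: if_cong)

lemma dmat_mult_dmat: "dmat d ** dmat e = dmat (\<lambda>i. d i * e i)"
  unfolding dmat_mult by (simp add: dmat_def vec_eq_iff)

lemma hconj_dmat: "(dmat d)\<^sup>H = dmat d"
  by (simp add: hconj_def dmat_def vec_eq_iff)

lemma dmat_1: "dmat (\<lambda>i. 1) = mat 1"
  by (simp add: dmat_def mat_def vec_eq_iff)

text \<open>A maximiser \<open>V\<close> of \<open>Re tr (W V\<^sup>H \<Sigma> V)\<close> over the unitary group, with \<open>W\<close> diagonal with
  distinct entries, is critical along \<open>V exp(t \<Omega>)\<close>; hence \<open>V\<^sup>H \<Sigma> V\<close> commutes with \<open>W\<close>.\<close>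

lemma hermitian_diagonalization:
  fixes \<Sigma> :: "complex^'n^'n"
  assumes "\<Sigma> \<in> hermitian"
  obtains V d where "V \<in> unitary" "V\<^sup>H ** \<Sigma> ** V = dmat d"
proof -
  obtain w :: "'n \<Rightarrow> nat" where w: "inj w"
    using finite_imp_inj_to_nat_seg[of "UNIV :: 'n set"] by auto
  define W where "W = dmat (\<lambda>i. real (w i))"
  define \<phi> where "\<phi> V = Re (trace (W ** (V\<^sup>H ** \<Sigma> ** V)))" for V
  have c: "continuous_on unitary (\<lambda>V :: complex^'n^'n. V\<^sup>H)"
    using bounded_linear_hconj by (rule linear_continuous_on)
  have "continuous_on unitary \<phi>" unfolding \<phi>_def
    by (intro bounded_linear.continuous_on[OF bounded_linear_Re_trace] continuous_on_const
        bounded_bilinear.continuous_on[OF bounded_bilinear_matrix_mult] c continuous_on_id)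
  moreover have "mat 1 \<in> (unitary :: (complex^'n^'n) set)" by (simp add: unitary_def hconj_simps)
  ultimately obtain V where V: "V \<in> unitary" and max: "\<And>Y. Y \<in> unitary \<Longrightarrow> \<phi> Y \<le> \<phi> V"
    using continuous_attains_sup[OF compact_unitary] by blast
  define M where "M = V\<^sup>H ** \<Sigma> ** V"
  have M: "M\<^sup>H = M" using hermitianD[OF assms] by (simp add: M_def hconj_simps matrix_mul_assoc)
  have W: "W\<^sup>H = W" by (simp add: W_def hconj_dmat)
  \<comment> \<open>The derivative along a skew direction is the real trace of the commutator of
    \<open>W\<close> and \<open>M\<close> times that direction. Taking the commutator itself as the
    direction turns criticality into the vanishing of its norm.\<close>
  define \<Omega> where "\<Omega> = W ** M - M ** W"
  have skew: "\<Omega>\<^sup>H = - \<Omega>" by (simp add: \<Omega>_def hconj_simps M W)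
  let ?E = "\<lambda>t. matrix_exp (t *\<^sub>R \<Omega>)" and ?E' = "\<lambda>t. matrix_exp (- t *\<^sub>R \<Omega>)"
  have \<phi>E: "\<phi> (V ** ?E t) = Re (trace (W ** (?E' t ** M ** ?E t)))" for t
    by (simp add: \<phi>_def M_def hconj_simps hconj_matrix_exp skew matrix_mul_assoc)
  have "((\<lambda>t. W ** (?E' t ** M ** ?E t)) has_vector_derivative
      W ** (M ** \<Omega> - \<Omega> ** M)) (at 0)"
    by (rule has_vector_derivative_eq_rhs)
      (rule derivative_intros has_vector_derivative_const matrix_exp_has_derivative matrix_exp_has_derivative_minus
        | simp add: matrix_exp_0 mat_simps)+
  from bounded_linear.has_vector_derivative[OF bounded_linear_Re_trace this]
  have "((\<lambda>t. \<phi> (V ** ?E t)) has_real_derivative Re (trace (W ** (M ** \<Omega> - \<Omega> ** M)))) (at 0)"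
    unfolding \<phi>E has_real_derivative_iff_has_vector_derivative .
  then have "Re (trace (W ** (M ** \<Omega> - \<Omega> ** M))) = 0"
  proof (rule DERIV_local_max[where d = 1])
    show "\<forall>y. \<bar>0 - y\<bar> < 1 \<longrightarrow> \<phi> (V ** ?E y) \<le> \<phi> (V ** ?E 0)"
      using max unitary_mult[OF V matrix_exp_skew_unitary[OF skew]] by (simp add: matrix_exp_0)
  qed simp
  moreover have "trace (W ** \<Omega> ** M) = trace (M ** W ** \<Omega>)"
    using trace_mul_sym[of "W ** \<Omega>" M] by (simp add: matrix_mul_assoc)
  ultimately have "Re (trace (\<Omega> ** \<Omega>)) = 0"
    by (subst (1) \<Omega>_def) (simp add: mat_simps trace_sub)
  then have "Re (trace (\<Omega>\<^sup>H ** \<Omega>)) = 0" by (simp add: skew mat_simps trace_minus)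
  then have "\<Omega> = 0" by (rule trace_hconj_mult_eq_0)
  then have "of_nat (w i) * M $ i $ j = M $ i $ j * of_nat (w j)" for i j
    by (simp add: \<Omega>_def W_def dmat_mult mult_dmat vec_eq_iff)
  then have off: "M $ i $ j = 0" if "i \<noteq> j" for i j
    using that injD[OF w, of i j] by (metis mult.commute mult_right_cancel of_nat_eq_iff)
  have "M $ i $ i = of_real (Re (M $ i $ i))" for i
    using arg_cong[OF M, of "\<lambda>X. X $ i $ i"] by (simp add: hconj_def complex_eq_iff)
  then have "M = dmat (\<lambda>i. Re (M $ i $ i))"
    using off by (simp add: dmat_def vec_eq_iff)
  then show thesis using that[OF V] M_def by blast
qed

lemma hpd_dmat_pos:
  assumes "dmat d \<in> hpd"
  shows "d i > 0"
proof -
  have "qform (dmat d) (axis i 1) = of_real (d i)"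
    by (simp add: qform_def axis_def matrix_vector_mult_def dmat_def if_distrib[of "\<lambda>x. x * _"]
        if_distrib[of "\<lambda>x. _ * x"] if_distrib[of cnj] cong: if_cong)
  then show ?thesis using assms by (auto simp: hpd_iff_qform dest!: spec[of _ "axis i 1"])
qed

section \<open>Existence and uniqueness of the positive definite square root\<close>

lemma hpd_sqrt_exists:
  assumes "\<Sigma> \<in> hpd"
  shows "\<exists>S. S \<in> hpd \<and> S ** S = \<Sigma>"
proof -
  obtain V d where V: "V \<in> unitary" and d: "V\<^sup>H ** \<Sigma> ** V = dmat d"
    using hermitian_diagonalization assms by (auto simp: hpd_def)
  note u = unitaryD[OF V]
  have pos: "d i > 0" for i
    using hpd_dmat_pos hpd_congruence[OF assms u(1)] unfolding d by blast
  \<comment> \<open>Fourth roots of the eigenvalues: the square root is then the Gram matrix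
    \<open>B\<^sup>H ** B\<close>, whose positivity is immediate.\<close>
  define e where "e i = sqrt (sqrt (d i))" for i
  have e: "e i > 0" "e i * e i * (e i * e i) = d i" for i
    using pos[of i] by (auto simp: e_def)
  define B where "B = dmat e ** V\<^sup>H"
  have "(V ** dmat (\<lambda>i. inverse (e i))) ** B = V ** (dmat (\<lambda>i. inverse (e i)) ** dmat e) ** V\<^sup>H"
    by (simp add: B_def matrix_mul_assoc)
  also have "\<dots> = mat 1" using e(1) by (simp add: dmat_mult_dmat dmat_1 less_imp_neq[symmetric] u)
  finally have S: "B\<^sup>H ** B \<in> hpd" by (rule hpd_gram)
  have "B\<^sup>H ** B = V ** (dmat e ** dmat e) ** V\<^sup>H"
    by (simp add: B_def hconj_simps hconj_dmat matrix_mul_assoc)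
  then have "(B\<^sup>H ** B) ** (B\<^sup>H ** B)
      = V ** (dmat e ** dmat e) ** (V\<^sup>H ** V) ** (dmat e ** dmat e) ** V\<^sup>H"
    by (simp add: matrix_mul_assoc)
  also have "\<dots> = V ** ((dmat e ** dmat e) ** (dmat e ** dmat e)) ** V\<^sup>H"
    by (simp add: u matrix_mul_assoc)
  also have "\<dots> = (V ** V\<^sup>H) ** \<Sigma> ** (V ** V\<^sup>H)"
    unfolding dmat_mult_dmat e(2) d[symmetric] by (simp add: matrix_mul_assoc)
  finally show ?thesis using S u by auto
qed

lemma hpd_hconj: "A \<in> hpd \<Longrightarrow> A\<^sup>H = A"
  by (simp add: hpd_def hermitian_def)

text \<open>With \<open>D = B - C\<close> the equality of squares gives
  \<open>B ** D + D ** C = 0\<close>. Multiplied by \<open>D\<close> and traced, this is a sum of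
  the squared norms of \<open>F ** D\<close> and \<open>D ** G\<close>, where \<open>F\<close> and
  \<open>G\<close> are square roots of \<open>B\<close> and \<open>C\<close>.\<close>

lemma hpd_sqrt_unique:
  fixes B C :: "complex^'k^'k"
  assumes "B \<in> hpd" "C \<in> hpd" "B ** B = C ** C"
  shows "B = C"
proof -
  obtain F G where F: "F \<in> hpd" "F ** F = B" and G: "G \<in> hpd" "G ** G = C"
    using hpd_sqrt_exists assms by metis
  define D where "D = B - C"
  have D: "D\<^sup>H = D" using assms by (simp add: D_def hconj_simps hpd_hconj)
  have "(F ** D)\<^sup>H ** (F ** D) = D ** B ** D"
    by (simp add: hconj_simps hpd_hconj F(1) D F(2)[symmetric] matrix_mul_assoc)
  moreover have "trace ((D ** G)\<^sup>H ** (D ** G)) = trace (D ** D ** C)"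
    using trace_mul_sym[of G "D ** D ** G"]
    by (simp add: hconj_simps hpd_hconj G(1) D G(2)[symmetric] matrix_mul_assoc)
  moreover have "trace (D ** B ** D) + trace (D ** D ** C) = trace (D ** (B ** D + D ** C))"
    by (simp add: mat_simps trace_add)
  moreover have "B ** D + D ** C = 0" by (simp add: D_def mat_simps assms(3))
  ultimately have "(F ** D) \<bullet> (F ** D) + (D ** G) \<bullet> (D ** G) = 0"
    unfolding inner_eq_trace plus_complex.sel[symmetric] by (simp add: trace_def)
  then have "F ** D = 0" by (simp add: add_nonneg_eq_0_iff)
  then have "matrix_inv F ** F ** D = 0" by (simp add: matrix_mul_assoc[symmetric])
  then show ?thesis using hpd_inverse[OF F(1)] by (simp add: D_def)
qed

lemma hpd_sqrt:
  assumes "\<Sigma> \<in> hpd"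
  shows "hpd_sqrt \<Sigma> \<in> hpd" "hpd_sqrt \<Sigma> ** hpd_sqrt \<Sigma> = \<Sigma>"
proof -
  have "\<exists>!S. S \<in> hpd \<and> S ** S = \<Sigma>"
    using hpd_sqrt_exists[OF assms] hpd_sqrt_unique by metis
  from theI'[OF this] show "hpd_sqrt \<Sigma> \<in> hpd" "hpd_sqrt \<Sigma> ** hpd_sqrt \<Sigma> = \<Sigma>"
    unfolding hpd_sqrt_def by auto
qed

section \<open>Block matrices\<close>

lemma beside_above:
  fixes A :: "complex^'k^'p" and B :: "complex^'q^'p"
  shows "beside A B ** above C D = A ** C + B ** D"
proof -
  have "(\<Sum>j\<in>UNIV. f j) = (\<Sum>l\<in>UNIV. f (Inl l)) + (\<Sum>l\<in>UNIV. f (Inr l))" for f :: "'k + 'q \<Rightarrow> complex"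
    unfolding UNIV_Plus_UNIV[symmetric] Plus_def
    by (subst sum.union_disjoint) (auto simp: sum.reindex)
  then show ?thesis by (simp add: beside_def above_def matrix_matrix_mult_def vec_eq_iff)
qed

lemma above_mult: "above A B ** C = above (A ** C) (B ** C)"
  by (auto simp: above_def matrix_matrix_mult_def vec_eq_iff split: sum.split)

lemma mult_beside: "C ** beside A B = beside (C ** A) (C ** B)"
  by (auto simp: beside_def matrix_matrix_mult_def vec_eq_iff split: sum.split)

lemma hconj_beside: "(beside A B)\<^sup>H = above (A\<^sup>H) (B\<^sup>H)"
  by (auto simp: above_def beside_def hconj_def vec_eq_iff split: sum.split)

lemma hconj_above: "(above A B)\<^sup>H = beside (A\<^sup>H) (B\<^sup>H)"
  by (auto simp: above_def beside_def hconj_def vec_eq_iff split: sum.split)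

lemma beside_of_above: "beside (above A C) (above B D) = above (beside A B) (beside C D)"
  by (auto simp: above_def beside_def vec_eq_iff split: sum.split)

lemma above_add: "above A B + above C D = above (A + C) (B + D)"
  by (auto simp: above_def vec_eq_iff split: sum.split)

lemma above_diff: "above A B - above C D = above (A - C) (B - D)"
  by (auto simp: above_def vec_eq_iff split: sum.split)

lemma above_minus: "- above A B = above (- A) (- B)"
  by (auto simp: above_def vec_eq_iff split: sum.split)

lemma beside_add: "beside A B + beside C D = beside (A + C) (B + D)"
  by (auto simp: beside_def vec_eq_iff split: sum.split)

lemma beside_minus: "- beside A B = beside (- A) (- B)"
  by (auto simp: beside_def vec_eq_iff split: sum.split)

lemma above_beside_mat_1: "above (beside (mat 1) 0) (beside 0 (mat 1)) = mat 1"
  by (auto simp: above_def beside_def mat_def vec_eq_iff split: sum.split)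

lemma beside_0: "beside 0 0 = 0"
  by (auto simp: beside_def vec_eq_iff split: sum.split)

text \<open>With \<open>B\<close> a \<open>p \<times> p\<close> matrix up to reindexing its columns, a left inverse is a right inverse.\<close>

lemma isometry_of_full_dim:
  fixes B :: "complex^'m^'p"
  assumes "CARD('m) = CARD('p)" "B\<^sup>H ** B = mat 1"
  shows "B ** B\<^sup>H = mat 1"
proof -
  obtain f :: "'p \<Rightarrow> 'm" where f: "bij f"
    using assms(1) finite_same_card_bij[of "UNIV :: 'p set" "UNIV :: 'm set"] by auto
  define C where "C = (\<chi> i j. B $ i $ f j)"
  have "(B\<^sup>H ** B) $ f i $ f j = (C\<^sup>H ** C) $ i $ j" for i j
    by (simp add: C_def hconj_def matrix_matrix_mult_def)
  then have "C\<^sup>H ** C = mat 1"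
    using f by (auto simp: assms(2) vec_eq_iff mat_def bij_def inj_eq)
  then have "C ** C\<^sup>H = mat 1" using matrix_left_right_inverse by blast
  moreover have "(C ** C\<^sup>H) $ i $ j = (B ** B\<^sup>H) $ i $ j" for i j
    using sum.reindex_bij_betw[OF f, of "\<lambda>l. B $ i $ l * cnj (B $ j $ l)"]
    by (simp add: C_def hconj_def matrix_matrix_mult_def)
  ultimately show ?thesis by (metis vec_eq_iff)
qed

section \<open>Smoothness of exponential curves\<close>

lemma matrix_exp_curve_has_derivative:
  "((\<lambda>t. B ** matrix_exp (t *\<^sub>R M) ** C) has_vector_derivative B ** (M ** matrix_exp (t *\<^sub>R M)) ** C) (at t)"
  by (rule bounded_linear.has_vector_derivative[OF bounded_linear_matrix_mult_left]
      bounded_linear.has_vector_derivative[OF bounded_linear_matrix_mult_right] matrix_exp_has_derivative)+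

text \<open>Differentiating replaces \<open>B\<close> by a multiple of \<open>B ** M\<close>, so the
  induction has to range over all left factors.\<close>

lemma Ck_on_matrix_exp_curve:
  "Ck_on n UNIV (\<lambda>t::real. B ** matrix_exp (t *\<^sub>R M) ** C)"
proof (induction n arbitrary: B)
  case 0
  show ?case unfolding Ck_on.simps
    using matrix_exp_curve_has_derivative has_vector_derivative_continuous
    by (intro continuous_at_imp_continuous_on) blast
next
  case (Suc n)
  show ?case
  proof (rule Ck_on_SucI[OF open_UNIV])
    show "((\<lambda>t. B ** matrix_exp (t *\<^sub>R M) ** C) has_derivative
        (\<lambda>h. h *\<^sub>R (B ** (M ** matrix_exp (t *\<^sub>R M)) ** C))) (at t)" for t
      using matrix_exp_curve_has_derivative unfolding has_vector_derivative_def .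
    show "Ck_on n UNIV (\<lambda>t. h *\<^sub>R (B ** (M ** matrix_exp (t *\<^sub>R M)) ** C))" for h
      using Suc[of "h *\<^sub>R (B ** M)"] by (simp add: mat_simps)
  qed
qed

section \<open>The curve on the Stiefel manifold\<close>

definition block_skew :: "complex^'k^'k \<Rightarrow> complex^'k^'q \<Rightarrow> complex^('k + 'q)^('k + 'q)"
  where "block_skew A R = above (beside A (- (R\<^sup>H))) (beside R 0)"

definition stiefel_velocity ::
  "complex^'k^'p \<Rightarrow> complex^'q^'p \<Rightarrow> complex^'k^'k \<Rightarrow> complex^'k^'q \<Rightarrow> real \<Rightarrow> complex^'k^'p"
  where "stiefel_velocity U Q A R t =
    beside U Q ** (block_skew A R ** matrix_exp (t *\<^sub>R block_skew A R)) ** above (mat 1) 0"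

lemma stiefel_curve_eq:
  "stiefel_curve U Q A R t = beside U Q ** matrix_exp (t *\<^sub>R block_skew A R) ** above (mat 1) 0"
  by (simp add: stiefel_curve_def block_skew_def)

lemma hconj_block_skew: "A\<^sup>H = - A \<Longrightarrow> (block_skew A R)\<^sup>H = - block_skew A R"
  by (simp add: block_skew_def hconj_above hconj_beside beside_of_above above_minus beside_minus hconj_simps)

lemma block_skew_mult: "block_skew A R ** above X Y = above (A ** X - R\<^sup>H ** Y) (R ** X)"
  by (simp add: block_skew_def above_mult beside_above mat_simps)

lemma stiefel_curve_0: "stiefel_curve U Q A R 0 = U"
  by (simp add: stiefel_curve_eq matrix_exp_0 beside_above)

lemma stiefel_velocity_0: "stiefel_velocity U Q A R 0 = U ** A + Q ** R"
  by (simp add: stiefel_velocity_def matrix_exp_0 beside_above block_skew_mult matrix_mul_assoc[symmetric])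

lemma stiefel_curve_has_derivative:
  "(stiefel_curve U Q A R has_vector_derivative stiefel_velocity U Q A R t) (at t)"
  using matrix_exp_curve_has_derivative[of "beside U Q" "block_skew A R" "above (mat 1) 0" t]
  by (simp add: stiefel_curve_eq[abs_def] stiefel_velocity_def)

text \<open>The block column \<open>E = [I; 0]\<close> satisfies
  \<open>M ** (M ** E) = M ** E ** A - E ** (R\<^sup>H ** R)\<close>. Moving the exponential past
  \<open>M\<close> turns this recurrence into a second-order equation with constant
  coefficients.\<close>

lemma stiefel_velocity_has_derivative:
  fixes U :: "complex^'k^'p" and Q :: "complex^'q^'p"
  shows "(stiefel_velocity U Q A R has_vector_derivative
     stiefel_velocity U Q A R t ** A - stiefel_curve U Q A R t ** (R\<^sup>H ** R)) (at t)"
proof -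
  let ?M = "block_skew A R" and ?E = "above (mat 1) 0 :: complex^'k^('k + 'q)" and ?W = "beside U Q"
  let ?e = "matrix_exp (t *\<^sub>R ?M)"
  have "?M ** (?M ** ?E) = ?M ** ?E ** A - ?E ** (R\<^sup>H ** R)"
    by (simp add: block_skew_mult above_mult above_diff)
  then have "?W ** ?e ** (?M ** (?M ** ?E)) = ?W ** ?e ** ?M ** ?E ** A - ?W ** ?e ** ?E ** (R\<^sup>H ** R)"
    by (simp add: mat_simps)
  moreover have "X ** ?e ** ?M = X ** ?M ** ?e" for X :: "complex^('k + 'q)^'p"
    using arg_cong[OF matrix_exp_scaleR_commute[of t ?M], of "\<lambda>Z. X ** Z"]
    by (simp add: matrix_mul_assoc)
  ultimately have "?W ** ?M ** (?M ** ?e) ** ?E = ?W ** (?M ** ?e) ** ?E ** A - ?W ** ?e ** ?E ** (R\<^sup>H ** R)"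
    by (simp add: matrix_mul_assoc)
  then show ?thesis
    using matrix_exp_curve_has_derivative[of "?W ** ?M" "?M" ?E t]
    by (simp add: stiefel_velocity_def[abs_def] stiefel_curve_eq matrix_mul_assoc)
qed

text \<open>\<open>Q\<close> need not be orthogonal to \<open>U\<close> (only \<open>Q R\<close> is, when the QR decomposition is rank
  deficient), so \<open>[U Q]\<close> is an isometry only on the kernel of \<open>L = [0  U\<^sup>H Q]\<close>, which contains the
  curve \<open>exp(t M) [I; 0]\<close> and its velocity.\<close>

lemma stiefel_curve_products:
  fixes U :: "complex^'k^'p" and Q :: "complex^'q^'p"
  assumes "U \<in> stiefel" "Q\<^sup>H ** Q = mat 1" "A\<^sup>H = - A" "U\<^sup>H ** Q ** R = 0"
  defines "u \<equiv> stiefel_curve U Q A R" and "v \<equiv> stiefel_velocity U Q A R"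
  shows "(u t)\<^sup>H ** u t = mat 1" "(u t)\<^sup>H ** v t = A" "(v t)\<^sup>H ** v t = A\<^sup>H ** A + R\<^sup>H ** R"
proof -
  define M where "M = block_skew A R"
  define E :: "complex^'k^('k + 'q)" where "E = above (mat 1) 0"
  define W where "W = beside U Q"
  define e where "e t = matrix_exp (t *\<^sub>R M)" for t
  define L :: "complex^('k + 'q)^'k" where "L = beside 0 (U\<^sup>H ** Q)"
  have M: "M\<^sup>H = - M" unfolding M_def by (rule hconj_block_skew[OF assms(3)])
  have eM: "e t ** M = M ** e t" for t unfolding e_def by (rule matrix_exp_scaleR_commute)
  have uni: "(e t)\<^sup>H ** e t = mat 1" for t
    using unitaryD(1)[OF matrix_exp_skew_unitary[OF M]] by (simp add: e_def)
  have ut: "u t = W ** (e t ** E)" and vt: "v t = W ** (M ** (e t ** E))" for t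
    by (simp_all add: u_def v_def stiefel_curve_eq stiefel_velocity_def W_def e_def E_def M_def matrix_mul_assoc)
  have UU: "U\<^sup>H ** U = mat 1" using assms(1) by (simp add: stiefel_def)
  \<comment> \<open>The Gram matrix of \<open>[U Q]\<close> differs from the identity by the blocks
    \<open>U\<^sup>H ** Q\<close> and its adjoint, and both factor through \<open>L\<close>.\<close>
  have W: "W\<^sup>H ** W = mat 1 + E ** L + L\<^sup>H ** E\<^sup>H"
  proof -
    have "W\<^sup>H ** W = above (beside (mat 1) (U\<^sup>H ** Q)) (beside (Q\<^sup>H ** U) (mat 1))"
      unfolding W_def hconj_beside above_mult by (simp add: mult_beside UU assms(2))
    moreover have "E ** L = above (beside 0 (U\<^sup>H ** Q)) 0"
      unfolding E_def L_def above_mult by simp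
    moreover have "L\<^sup>H ** E\<^sup>H = above 0 (beside (Q\<^sup>H ** U) 0)"
      unfolding E_def L_def hconj_beside hconj_above above_mult
      by (simp add: mult_beside hconj_simps beside_0)
    ultimately show ?thesis
      by (simp add: above_beside_mat_1[symmetric] above_add beside_add)
  qed
  \<comment> \<open>The blocks of \<open>L ** M\<close> are \<open>U\<^sup>H ** Q ** R\<close> and
    0.\<close>
  have LM: "L ** (M ** X) = 0" for X :: "complex^'k^('k + 'q)"
  proof -
    have "L ** M = 0"
      by (simp add: L_def M_def block_skew_def beside_above mult_beside assms(4) beside_0)
    then show ?thesis by (simp add: matrix_mul_assoc)
  qed
  \<comment> \<open>Constant in \<open>t\<close> because \<open>L ** M\<close> vanishes, and
    \<open>L ** E = 0\<close> at time 0.\<close>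
  have LE: "L ** (e t ** E) = 0" for t
  proof -
    have "((\<lambda>t. L ** e t ** E) has_vector_derivative 0) (at t)" for t
      using matrix_exp_curve_has_derivative[of L M E t] LM[of "e t ** E"] by (simp add: e_def matrix_mul_assoc)
    from constant_on_reals[of "\<lambda>t. L ** e t ** E", OF this, of t] show ?thesis
      by (simp add: e_def matrix_exp_0 L_def E_def beside_above matrix_mul_assoc[symmetric])
  qed
  have iso: "(W ** X)\<^sup>H ** (W ** Y) = X\<^sup>H ** Y" if "L ** X = 0" "L ** Y = 0"
    for X Y :: "complex^'k^('k + 'q)"
  proof -
    have "(W ** X)\<^sup>H ** (W ** Y) = X\<^sup>H ** (W\<^sup>H ** W) ** Y"
      by (simp add: hconj_simps matrix_mul_assoc)
    also have "\<dots> = X\<^sup>H ** Y + X\<^sup>H ** E ** (L ** Y) + (L ** X)\<^sup>H ** E\<^sup>H ** Y"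
      unfolding W by (simp add: mat_simps hconj_simps)
    finally show ?thesis by (simp add: that hconj_simps)
  qed
  have cancel: "(e t ** X)\<^sup>H ** (e t ** Y) = X\<^sup>H ** Y" for t and X Y :: "complex^'k^('k + 'q)"
    using arg_cong[OF uni, of "\<lambda>Z. X\<^sup>H ** Z ** Y"] by (simp add: hconj_simps matrix_mul_assoc)
  have comm: "M ** (e t ** E) = e t ** (M ** E)" for t
    using arg_cong[OF eM, of "\<lambda>Z. Z ** E"] by (simp add: matrix_mul_assoc)
  have ME: "M ** E = above A R" by (simp add: M_def E_def block_skew_mult)
  show "(u t)\<^sup>H ** u t = mat 1"
    unfolding ut iso[OF LE LE] cancel by (simp add: E_def hconj_above beside_above hconj_simps)
  show "(u t)\<^sup>H ** v t = A"
    unfolding ut vt iso[OF LE LM] unfolding comm cancel ME by (simp add: E_def hconj_above beside_above hconj_simps)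
  show "(v t)\<^sup>H ** v t = A\<^sup>H ** A + R\<^sup>H ** R"
    unfolding vt iso[OF LM LM] unfolding comm cancel ME by (simp add: hconj_above beside_above hconj_simps)
qed

section \<open>The curve of positive definite matrices\<close>

lemma matrix_inv_eqI:
  assumes "A \<in> hpd" "A ** B = mat 1"
  shows "matrix_inv A = B"
  using arg_cong[OF assms(2), of "\<lambda>Z. matrix_inv A ** Z"] hpd_inverse[OF assms(1)]
  by (simp add: matrix_mul_assoc)

text \<open>The derivative of \<open>hpd_curve\<close>, written so that its left logarithmic
  derivative is visibly the constant \<open>matrix_inv \<Sigma> ** \<xi>\<close>.\<close>

definition hpd_velocity :: "complex^'k^'k \<Rightarrow> complex^'k^'k \<Rightarrow> real \<Rightarrow> complex^'k^'k"
  where "hpd_velocity \<Sigma> \<xi> t = hpd_curve \<Sigma> \<xi> t ** (matrix_inv \<Sigma> ** \<xi>)"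

text \<open>In terms of \<open>S = hpd_sqrt \<Sigma>\<close>, its inverse \<open>T\<close> and
  \<open>H = T ** \<xi> ** T\<close>, the curve is \<open>S ** e t ** S\<close>. As \<open>H\<close>
  commutes with \<open>e t\<close>, the exponentials cancel in both logarithmic derivatives and
  leave \<open>T ** H ** S\<close> and \<open>S ** H ** T\<close>.\<close>

lemma hpd_curve:
  fixes \<Sigma> :: "complex^'k^'k"
  assumes "\<Sigma> \<in> hpd" "\<xi> \<in> hermitian"
  defines "c \<equiv> hpd_curve \<Sigma> \<xi>" and "v \<equiv> hpd_velocity \<Sigma> \<xi>"
  shows "c t \<in> hpd" "c 0 = \<Sigma>" "v 0 = \<xi>"
    "(c has_vector_derivative v t) (at t)" "(v has_vector_derivative v t ** matrix_inv (c t) ** v t) (at t)"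
    "matrix_inv (c t) ** v t = matrix_inv \<Sigma> ** \<xi>" "v t ** matrix_inv (c t) = \<xi> ** matrix_inv \<Sigma>"
    "Ck_on n UNIV c"
proof -
  define S where "S = hpd_sqrt \<Sigma>"
  define T where "T = matrix_inv S"
  define H where "H = T ** \<xi> ** T"
  define e where "e t = matrix_exp (t *\<^sub>R H)" for t
  have S: "S \<in> hpd" "S ** S = \<Sigma>" using hpd_sqrt[OF assms(1)] by (auto simp: S_def)
  have TS: "T ** S = mat 1" "S ** T = mat 1" using hpd_inverse[OF S(1)] by (auto simp: T_def)
  have h: "S\<^sup>H = S" "T\<^sup>H = T" using S hpd_hconj hpd_inverse_hermitian by (auto simp: T_def)
  have H: "H \<in> hermitian" using hermitianD[OF assms(2)] by (simp add: hermitian_def H_def h hconj_simps matrix_mul_assoc)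
  then have tH: "t *\<^sub>R H \<in> hermitian" for t by (simp add: hermitian_def hconj_simps)
  have c: "c t = S ** e t ** S" for t by (simp add: c_def hpd_curve_def Let_def S_def T_def H_def e_def)
  have can: "X ** T ** S = X" "X ** S ** T = X" for X :: "complex^'k^'k"
    by (simp_all add: matrix_mul_assoc[symmetric] TS)
  have \<xi>: "\<xi> = S ** H ** S" by (simp add: H_def matrix_mul_assoc can TS)
  have eH: "e t ** H = H ** e t" for t unfolding e_def by (rule matrix_exp_scaleR_commute)
  have ee: "e t ** matrix_exp (- t *\<^sub>R H) = mat 1" for t
    using matrix_exp_minus'[of "t *\<^sub>R H"] by (simp add: e_def)
  show hpd: "c t \<in> hpd" for t
    using hpd_congruence[OF hpd_exp[OF tH] TS(1)] unfolding c e_def h .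
  have inv_\<Sigma>: "matrix_inv \<Sigma> = T ** T"
    by (rule matrix_inv_eqI[OF assms(1)]) (simp add: S(2)[symmetric] matrix_mul_assoc can TS)
  have inv_c: "matrix_inv (c t) = T ** matrix_exp (- t *\<^sub>R H) ** T" for t
  proof (rule matrix_inv_eqI[OF hpd])
    have "c t ** (T ** matrix_exp (- t *\<^sub>R H) ** T) = S ** (e t ** matrix_exp (- t *\<^sub>R H)) ** T"
      by (simp add: c matrix_mul_assoc can)
    then show "c t ** (T ** matrix_exp (- t *\<^sub>R H) ** T) = mat 1" by (simp add: ee[simplified] TS)
  qed
  have THS: "matrix_inv \<Sigma> ** \<xi> = T ** H ** S"
    unfolding inv_\<Sigma> \<xi> by (simp add: matrix_mul_assoc can)
  have v: "v t = S ** (e t ** H) ** S" for t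
    unfolding v_def hpd_velocity_def THS c_def[symmetric] c by (simp add: matrix_mul_assoc can)
  then have v': "v t = S ** (H ** e t) ** S" for t by (simp add: eH)
  show "c 0 = \<Sigma>" "v 0 = \<xi>" by (simp_all add: c v e_def matrix_exp_0 S \<xi>)
  show dc: "(c has_vector_derivative v t) (at t)" for t
    using matrix_exp_curve_has_derivative[of S H S t] unfolding v' c[abs_def] e_def .
  show Jv: "matrix_inv (c t) ** v t = matrix_inv \<Sigma> ** \<xi>"
    using hpd_inverse[OF hpd[of t]] by (simp add: v_def hpd_velocity_def c_def matrix_mul_assoc)
  show "(v has_vector_derivative v t ** matrix_inv (c t) ** v t) (at t)"
  proof -
    have "(v has_vector_derivative v t ** (matrix_inv \<Sigma> ** \<xi>)) (at t)"
      using bounded_linear.has_vector_derivative[OF bounded_linear_matrix_mult_left dc[of t]]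
      by (simp add: v_def hpd_velocity_def[abs_def] c_def)
    then show ?thesis unfolding Jv[symmetric] by (simp add: matrix_mul_assoc)
  qed
  have "v t ** matrix_inv (c t) = S ** H ** (e t ** matrix_exp (- t *\<^sub>R H)) ** T"
    unfolding v' inv_c by (simp add: matrix_mul_assoc can)
  then show "v t ** matrix_inv (c t) = \<xi> ** matrix_inv \<Sigma>"
    unfolding inv_\<Sigma> ee by (simp add: \<xi> matrix_mul_assoc can)
  show "Ck_on n UNIV c"
    using Ck_on_matrix_exp_curve[of n S H S] unfolding c[abs_def] e_def .
qed

section \<open>The geodesic equation in the total space\<close>

text \<open>Derivative of \<open>total_metric\<close> in its base point, in the direction given by
  the second argument, with the last two vectors held fixed. The negative signs come from
  differentiating \<open>mat 1 - (1/2) *\<^sub>R (U ** U\<^sup>H)\<close> and the inverse of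
  \<open>\<Sigma>\<close>.\<close>

definition metric_derivative ::
  "real \<Rightarrow> real \<Rightarrow> ('p::finite, 'k::finite) pt \<Rightarrow> ('p, 'k) pt \<Rightarrow> ('p, 'k) pt \<Rightarrow> ('p, 'k) pt \<Rightarrow> real"
  where "metric_derivative \<alpha> \<beta> = (\<lambda>(U, \<Sigma>) (vU, v) (aU, a) (bU, b). let J = matrix_inv \<Sigma> in
    - (1/2) * Re (trace (aU\<^sup>H ** (vU ** U\<^sup>H + U ** vU\<^sup>H) ** bU))
    - \<alpha> * (Re (trace (J ** v ** J ** a ** J ** b)) + Re (trace (J ** a ** J ** v ** J ** b)))
    - \<beta> * (Re (trace (J ** v ** J ** a)) * Re (trace (J ** b)) + Re (trace (J ** a)) * Re (trace (J ** v ** J ** b))))"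

text \<open>This is the Euler-Lagrange equation of the energy, with \<open>G\<close> in the place of
  \<open>R\<^sup>H ** R\<close>. The Stiefel terms cancel up to the real trace of
  \<open>G ** Y\<close>; the terms in \<open>\<alpha>\<close> and \<open>\<beta>\<close> match by
  cyclicity of the trace.\<close>

lemma total_metric_geodesic_equation:
  fixes U :: "complex^'k::finite^'p::finite"
  assumes U: "U\<^sup>H ** U = mat 1" "U\<^sup>H ** V = A" "V\<^sup>H ** V = A\<^sup>H ** A + G" "A\<^sup>H = - A" "G\<^sup>H = G"
    and z: "U\<^sup>H ** zU + zU\<^sup>H ** U = 0"
  shows "total_metric \<alpha> \<beta> (U, \<Sigma>) (V ** A - U ** G, v ** matrix_inv \<Sigma> ** v) (zU, z)
    + metric_derivative \<alpha> \<beta> (U, \<Sigma>) (V, v) (V, v) (zU, z)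
    = 1/2 * metric_derivative \<alpha> \<beta> (U, \<Sigma>) (zU, z) (V, v) (V, v)"
proof -
  let ?J = "matrix_inv \<Sigma>"
  define X where "X = V\<^sup>H ** zU"
  define Y where "Y = U\<^sup>H ** zU"
  have VU: "V\<^sup>H ** U = - A" using arg_cong[OF U(2), of hconj] by (simp add: hconj_simps U(4))
  have r: "C ** U\<^sup>H ** U = C" "C ** U\<^sup>H ** V = C ** A" "C ** V\<^sup>H ** V = C ** G - C ** A ** A"
    "C ** V\<^sup>H ** U = - (C ** A)" "C ** U\<^sup>H ** zU = C ** Y" "C ** V\<^sup>H ** zU = C ** X" for C :: "complex^'k^'k"
    by (simp_all add: matrix_mul_assoc[symmetric] U VU X_def[symmetric] Y_def[symmetric])
      (simp_all add: mat_simps U)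
  have r1: "V\<^sup>H ** V = G - A ** A" by (simp add: U mat_simps)
  have Yskew: "Y\<^sup>H = - Y" using z by (simp add: Y_def hconj_simps eq_neg_iff_add_eq_0 add.commute)
  \<comment> \<open>Tangency of the test vector enters here: \<open>Y\<close> is skew-Hermitian and
    \<open>G\<close> Hermitian, so the trace of their product is imaginary.\<close>
  have 0: "Re (trace (G ** Y)) = 0"
  proof -
    have "trace ((G ** Y)\<^sup>H) = - trace (G ** Y)"
      using trace_mul_sym[of Y G] by (simp add: hconj_simps Yskew U mat_simps trace_minus)
    then show ?thesis using trace_hconj[of "G ** Y"] by (simp add: complex_eq_iff)
  qed
  have e1: "(V ** A - U ** G)\<^sup>H ** (mat 1 - (1/2) *\<^sub>R (U ** U\<^sup>H)) ** zU
      = - (A ** X) - G ** Y - (1/2) *\<^sub>R (A ** A ** Y - G ** Y)"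
    by (simp add: hconj_simps mat_simps U VU r X_def[symmetric] Y_def[symmetric] algebra_simps)
  have e2: "V\<^sup>H ** (V ** U\<^sup>H + U ** V\<^sup>H) ** zU = G ** Y - A ** A ** Y - A ** X"
    by (simp add: mat_simps r1 VU r)
  have e3: "V\<^sup>H ** (zU ** U\<^sup>H + U ** zU\<^sup>H) ** V = X ** A + (X ** A)\<^sup>H"
  proof -
    have "zU\<^sup>H ** V = X\<^sup>H" by (simp add: X_def hconj_simps)
    then have "C ** zU\<^sup>H ** V = C ** X\<^sup>H" for C :: "complex^'k^'k"
      by (simp add: matrix_mul_assoc[symmetric])
    then show ?thesis by (simp add: mat_simps hconj_simps r VU U(4) X_def[symmetric])
  qed
  have 1: "Re (trace ((V ** A - U ** G)\<^sup>H ** (mat 1 - (1/2) *\<^sub>R (U ** U\<^sup>H)) ** zU))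
     - (1/2) * Re (trace (V\<^sup>H ** (V ** U\<^sup>H + U ** V\<^sup>H) ** zU))
     = - (1/4) * Re (trace (V\<^sup>H ** (zU ** U\<^sup>H + U ** zU\<^sup>H) ** V))"
    unfolding e1 e2 e3 using 0
    by (simp add: trace_add trace_sub trace_minus trace_scaleR trace_hconj trace_mul_sym[of X A]) (simp add: field_simps)
  have a: "trace (?J ** z ** ?J ** v ** ?J ** v) = trace (?J ** v ** ?J ** v ** ?J ** z)"
    "trace (?J ** v ** ?J ** z ** ?J ** v) = trace (?J ** v ** ?J ** v ** ?J ** z)"
    "trace (?J ** z ** ?J ** v) = trace (?J ** v ** ?J ** z)"
    using trace_mul_sym[of "?J ** z" "?J ** v ** ?J ** v"] trace_mul_sym[of "?J ** v ** ?J ** z" "?J ** v"]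
      trace_mul_sym[of "?J ** z" "?J ** v"] by (simp_all add: matrix_mul_assoc)
  show ?thesis
    unfolding total_metric_def metric_derivative_def prod.case Let_def
    using 1 by (simp add: a matrix_mul_assoc algebra_simps)
qed

lemma trace_zero: "trace (0 :: complex^'n^'n) = 0"
  by (simp add: trace_def)

section \<open>The metric of the total space\<close>

lemma total_metric_sym: "total_metric \<alpha> \<beta> x \<xi> \<eta> = total_metric \<alpha> \<beta> x \<eta> \<xi>"
proof -
  obtain U \<Sigma> where x: "x = (U, \<Sigma>)" by (cases x)
  obtain a A where \<xi>: "\<xi> = (a, A)" by (cases \<xi>)
  obtain b B where \<eta>: "\<eta> = (b, B)" by (cases \<eta>)
  have stiefel_part: "Re (trace (a\<^sup>H ** (mat 1 - (1/2) *\<^sub>R (U ** U\<^sup>H)) ** b))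
      = Re (trace (b\<^sup>H ** (mat 1 - (1/2) *\<^sub>R (U ** U\<^sup>H)) ** a))"
  proof -
    have "Re (trace (a\<^sup>H ** (mat 1 - (1/2) *\<^sub>R (U ** U\<^sup>H)) ** b))
        = Re (trace ((a\<^sup>H ** (mat 1 - (1/2) *\<^sub>R (U ** U\<^sup>H)) ** b)\<^sup>H))"
      by (simp add: trace_hconj)
    also have "\<dots> = Re (trace (b\<^sup>H ** (mat 1 - (1/2) *\<^sub>R (U ** U\<^sup>H)) ** a))"
      by (simp add: hconj_simps matrix_mul_assoc)
    finally show ?thesis .
  qed
  have hpd_part: "trace (matrix_inv \<Sigma> ** A ** matrix_inv \<Sigma> ** B) = trace (matrix_inv \<Sigma> ** B ** matrix_inv \<Sigma> ** A)"
    using trace_mul_sym[of "matrix_inv \<Sigma> ** A" "matrix_inv \<Sigma> ** B"] by (simp only: matrix_mul_assoc)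
  show ?thesis
    unfolding total_metric_def x \<xi> \<eta> prod.case stiefel_part hpd_part by (simp only: mult_ac)
qed

lemma linear_total_metric:
  fixes x :: "('b::finite, 'a::finite) pt"
  shows "linear (total_metric \<alpha> \<beta> x \<xi>)"
proof -
  obtain U \<Sigma> where x: "x = (U, \<Sigma>)" by (cases x)
  obtain a A where \<xi>: "\<xi> = (a, A)" by (cases \<xi>)
  have K: "linear (\<lambda>B. Re (trace (K ** B)))" for K :: "complex^'c^'d"
    by (rule bounded_linear.linear[OF bounded_linear_compose[OF bounded_linear_Re_trace bounded_linear_matrix_mult_right]])
  have scale: "linear (\<lambda>x. r * f x)" if "linear f" for r and f :: "('b, 'a) pt \<Rightarrow> real"
    using linear_compose_scale_right[OF that, of r] by simp
  show ?thesis
    unfolding x \<xi> total_metric_def case_prod_beta fst_conv snd_conv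
    by (intro linear_compose_add scale
        linear_compose[unfolded o_def, OF linear_fst K] linear_compose[unfolded o_def, OF linear_snd K])
qed

lemma linear_total_metric_left: "linear (\<lambda>\<xi>. total_metric \<alpha> \<beta> x \<xi> \<eta>)"
proof -
  have "(\<lambda>\<xi>. total_metric \<alpha> \<beta> x \<xi> \<eta>) = total_metric \<alpha> \<beta> x \<eta>"
    by (rule ext) (rule total_metric_sym)
  then show ?thesis using linear_total_metric by simp
qed

text \<open>With \<open>B\<close> the congruence of \<open>\<xi>\<Sigma>\<close> by the inverse
  square root, the second and third terms become \<open>\<alpha>\<close> times the squared norm of
  \<open>B\<close> plus \<open>\<beta>\<close> times its squared trace. Cauchy-Schwarz bounds the
  squared trace by \<open>k\<close> times the squared norm, whence the constant
  \<open>min \<alpha> (\<alpha> + \<beta> * k)\<close>. In the Stiefel term the middle matrix is the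
  mean of the identity and the orthogonal projector \<open>P\<close>.\<close>

lemma total_metric_pos:
  fixes U :: "complex^'k::finite^'p::finite"
  assumes "\<alpha> > 0" "\<beta> > - \<alpha> / real CARD('k)" "(U, \<Sigma>) \<in> total_space"
    and \<xi>: "(\<xi>U, \<xi>\<Sigma>) \<in> tangent (U, \<Sigma>)" "(\<xi>U, \<xi>\<Sigma>) \<noteq> 0"
  shows "total_metric \<alpha> \<beta> (U, \<Sigma>) (\<xi>U, \<xi>\<Sigma>) (\<xi>U, \<xi>\<Sigma>) > 0"
proof -
  have U: "U\<^sup>H ** U = mat 1" and \<Sigma>: "\<Sigma> \<in> hpd" using assms(3) by (auto simp: total_space_def stiefel_def)
  define S where "S = hpd_sqrt \<Sigma>"
  define T where "T = matrix_inv S"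
  define B where "B = T ** \<xi>\<Sigma> ** T"
  have S: "S \<in> hpd" "S ** S = \<Sigma>" using hpd_sqrt[OF \<Sigma>] by (auto simp: S_def)
  have TS: "T ** S = mat 1" "S ** T = mat 1" using hpd_inverse[OF S(1)] by (auto simp: T_def)
  have h: "T\<^sup>H = T" using S hpd_inverse_hermitian by (auto simp: T_def)
  have can: "X ** T ** S = X" "X ** S ** T = X" for X :: "complex^'k^'k"
    by (simp_all add: matrix_mul_assoc[symmetric] TS)
  have inv: "matrix_inv \<Sigma> = T ** T"
    by (rule matrix_inv_eqI[OF \<Sigma>]) (simp add: S(2)[symmetric] matrix_mul_assoc can TS)
  have B: "B\<^sup>H = B" using \<xi>(1) by (simp add: B_def tangent_def hermitian_def hconj_simps h matrix_mul_assoc)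
  have "trace (T ** T ** \<xi>\<Sigma> ** T ** T ** \<xi>\<Sigma>) = trace (B\<^sup>H ** B)"
    using trace_mul_sym[of T "T ** \<xi>\<Sigma> ** T ** T ** \<xi>\<Sigma>"] unfolding B by (simp add: B_def matrix_mul_assoc)
  moreover have "trace (T ** T ** \<xi>\<Sigma>) = trace ((mat 1)\<^sup>H ** B)"
    using trace_mul_sym[of T "T ** \<xi>\<Sigma>"] by (simp add: B_def hconj_simps matrix_mul_assoc)
  ultimately have hpd_part: "\<alpha> * Re (trace (matrix_inv \<Sigma> ** \<xi>\<Sigma> ** matrix_inv \<Sigma> ** \<xi>\<Sigma>))
    + \<beta> * Re (trace (matrix_inv \<Sigma> ** \<xi>\<Sigma>)) * Re (trace (matrix_inv \<Sigma> ** \<xi>\<Sigma>))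
    = \<alpha> * (B \<bullet> B) + \<beta> * (mat 1 \<bullet> B)\<^sup>2"
    unfolding inv inner_eq_trace by (simp add: matrix_mul_assoc power2_eq_square)
  have "(mat 1 \<bullet> (mat 1 :: complex^'k^'k)) = real CARD('k)"
    by (simp add: inner_eq_trace hconj_simps trace_I)
  then have cs: "(mat 1 \<bullet> B)\<^sup>2 \<le> real CARD('k) * (B \<bullet> B)"
    using Cauchy_Schwarz_ineq[of "mat 1" B] by simp
  have k: "real CARD('k) > 0" by simp
  have ab: "\<alpha> + \<beta> * real CARD('k) > 0" using assms(2) k by (simp add: field_simps)
  have B0: "\<alpha> * (B \<bullet> B) + \<beta> * (mat 1 \<bullet> B)\<^sup>2 \<ge> min \<alpha> (\<alpha> + \<beta> * real CARD('k)) * (B \<bullet> B)"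
  proof (cases "\<beta> \<ge> 0")
    case True
    have "min \<alpha> (\<alpha> + \<beta> * real CARD('k)) * (B \<bullet> B) \<le> \<alpha> * (B \<bullet> B)"
      by (intro mult_right_mono) auto
    moreover have "0 \<le> \<beta> * (mat 1 \<bullet> B)\<^sup>2" using True by simp
    ultimately show ?thesis by linarith
  next
    case False
    have "min \<alpha> (\<alpha> + \<beta> * real CARD('k)) * (B \<bullet> B) \<le> (\<alpha> + \<beta> * real CARD('k)) * (B \<bullet> B)"
      by (intro mult_right_mono) auto
    moreover have "\<beta> * (real CARD('k) * (B \<bullet> B)) \<le> \<beta> * (mat 1 \<bullet> B)\<^sup>2"
      using False cs by (intro mult_left_mono_neg) auto
    ultimately show ?thesis by (simp add: algebra_simps)
  qed
  define P where "P = mat 1 - U ** U\<^sup>H"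
  have "P\<^sup>H ** P = P"
  proof -
    have "U ** U\<^sup>H ** U ** U\<^sup>H = U ** U\<^sup>H" using U by (simp add: matrix_mul_assoc[symmetric, of U "U\<^sup>H"])
    then show ?thesis by (simp add: P_def hconj_simps mat_simps)
  qed
  from arg_cong[OF this, of "\<lambda>Z. \<xi>U\<^sup>H ** Z ** \<xi>U"]
  have "(P ** \<xi>U)\<^sup>H ** (P ** \<xi>U) = \<xi>U\<^sup>H ** P ** \<xi>U"
    by (simp add: hconj_simps matrix_mul_assoc)
  then have "\<xi>U\<^sup>H ** (mat 1 - (1/2) *\<^sub>R (U ** U\<^sup>H)) ** \<xi>U
      = (1/2) *\<^sub>R (\<xi>U\<^sup>H ** \<xi>U) + (1/2) *\<^sub>R ((P ** \<xi>U)\<^sup>H ** (P ** \<xi>U))"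
  proof -
    have "mat 1 - (1/2) *\<^sub>R (U ** U\<^sup>H) = (1/2) *\<^sub>R mat 1 + (1/2) *\<^sub>R P"
      by (simp add: P_def scaleR_diff_right scaleR_left_distrib[symmetric])
    then show ?thesis using \<open>(P ** \<xi>U)\<^sup>H ** (P ** \<xi>U) = \<xi>U\<^sup>H ** P ** \<xi>U\<close> by (simp add: mat_simps)
  qed
  then have stiefel_part: "Re (trace (\<xi>U\<^sup>H ** (mat 1 - (1/2) *\<^sub>R (U ** U\<^sup>H)) ** \<xi>U))
      = (1/2) * (\<xi>U \<bullet> \<xi>U) + (1/2) * ((P ** \<xi>U) \<bullet> (P ** \<xi>U))"
    by (simp add: inner_eq_trace trace_add trace_scaleR)
  have "\<xi>U \<bullet> \<xi>U > 0 \<or> B \<bullet> B > 0"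
  proof (rule ccontr)
    assume "\<not> ?thesis"
    then have "\<xi>U = 0" "B = 0" by auto
    moreover have "\<xi>\<Sigma> = S ** B ** S" by (simp add: B_def matrix_mul_assoc can TS)
    ultimately show False using \<xi>(2) by (simp add: zero_prod_def)
  qed
  moreover have "\<xi>U \<bullet> \<xi>U \<ge> 0" "(P ** \<xi>U) \<bullet> (P ** \<xi>U) \<ge> 0" by simp_all
  moreover have "min \<alpha> (\<alpha> + \<beta> * real CARD('k)) > 0" using ab assms(1) by simp
  then have "min \<alpha> (\<alpha> + \<beta> * real CARD('k)) * (B \<bullet> B) \<ge> 0"
    "B \<bullet> B > 0 \<longrightarrow> min \<alpha> (\<alpha> + \<beta> * real CARD('k)) * (B \<bullet> B) > 0"
    using mult_nonneg_nonneg[OF less_imp_le inner_ge_zero] mult_pos_pos by blast+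
  ultimately have "(1/2) * (\<xi>U \<bullet> \<xi>U) + (1/2) * ((P ** \<xi>U) \<bullet> (P ** \<xi>U)) + (\<alpha> * (B \<bullet> B) + \<beta> * (mat 1 \<bullet> B)\<^sup>2) > 0"
    using B0 by linarith
  then show ?thesis
    unfolding total_metric_def prod.case using stiefel_part hpd_part by linarith
qed

section \<open>Differentiating the metric in its base point\<close>

lemma differentiable_matrix_inv:
  fixes f :: "'a::real_normed_vector \<Rightarrow> complex^'k^'k"
  assumes "open N" "u \<in> N" "\<And>u. u \<in> N \<Longrightarrow> f u \<in> hpd" "f differentiable (at u)"
  shows "(\<lambda>u. matrix_inv (f u)) differentiable (at u)"
proof (rule differentiable_linear_solve[where A = "\<lambda>u X. f u ** X" and f = "\<lambda>u. mat 1", OF assms(1,2)])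
  show "linear (\<lambda>X. f u ** X)" for u
    by (rule bounded_linear.linear[OF bounded_linear_matrix_mult_right])
  show "(\<lambda>u. f u ** X) differentiable (at u)" for X
    using bounded_linear.has_derivative[OF bounded_linear_matrix_mult_left] assms(4)
    unfolding differentiable_def by blast
  show "X = 0" if "f u ** X = 0" for X
  proof -
    have "matrix_inv (f u) ** f u ** X = 0" using that by (simp add: matrix_mul_assoc[symmetric])
    then show ?thesis using hpd_inverse[OF assms(3)[OF assms(2)]] by simp
  qed
  show "f u ** matrix_inv (f u) = mat 1" if "u \<in> N" for u
    using hpd_inverse[OF assms(3)[OF that]] by simp
qed simp

lemmas has_derivative_matrix_mult = bounded_bilinear.FDERIV[OF bounded_bilinear_matrix_mult]
lemmas has_derivative_hconj = bounded_linear.has_derivative[OF bounded_linear_hconj]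
lemmas has_derivative_Re_trace = bounded_linear.has_derivative[OF bounded_linear_Re_trace]

text \<open>Once differentiability is known, the formula comes from differentiating
  \<open>f u ** matrix_inv (f u) = mat 1\<close>.\<close>

lemma has_derivative_matrix_inv:
  fixes f :: "'a::real_normed_vector \<Rightarrow> complex^'k^'k"
  assumes "open N" "u \<in> N" "\<And>u. u \<in> N \<Longrightarrow> f u \<in> hpd" "(f has_derivative f') (at u)"
  shows "((\<lambda>u. matrix_inv (f u)) has_derivative (\<lambda>v. - (matrix_inv (f u) ** f' v ** matrix_inv (f u)))) (at u)"
proof -
  let ?J = "\<lambda>u. matrix_inv (f u)"
  obtain J' where J': "(?J has_derivative J') (at u)"
    using differentiable_matrix_inv[of N u f, OF assms(1-3) differentiableI[OF assms(4)]]
    unfolding differentiable_def by blast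
  have 1: "((\<lambda>u. f u ** ?J u) has_derivative (\<lambda>v. f u ** J' v + f' v ** ?J u)) (at u)"
    by (rule has_derivative_matrix_mult[OF assms(4) J'])
  have 2: "((\<lambda>u. f u ** ?J u) has_derivative (\<lambda>v. 0)) (at u)"
    by (rule has_derivative_transform_within_open[OF has_derivative_const[of "mat 1"] assms(1,2)])
      (simp add: hpd_inverse(1)[OF assms(3)])
  have e: "f u ** J' v + f' v ** ?J u = 0" for v
    using fun_cong[OF has_derivative_unique[OF 1 2]] .
  have "J' = (\<lambda>v. - (?J u ** f' v ** ?J u))"
  proof (rule ext)
    show "J' v = - (?J u ** f' v ** ?J u)" for v
      using arg_cong[OF e[of v], of "\<lambda>Z. ?J u ** Z"] hpd_inverse[OF assms(3)[OF assms(2)]]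
      by (simp add: mat_simps eq_neg_iff_add_eq_0)
  qed
  then show ?thesis using J' by simp
qed

lemma total_metric_has_derivative:
  fixes x a b :: "'z::real_normed_vector \<Rightarrow> ('p::finite, 'k::finite) pt"
  assumes "open N" "u \<in> N" "\<And>u. u \<in> N \<Longrightarrow> x u \<in> total_space"
    and x: "(x has_derivative x') (at u)" and a: "(a has_derivative a') (at u)" and b: "(b has_derivative b') (at u)"
  shows "((\<lambda>u. total_metric \<alpha> \<beta> (x u) (a u) (b u)) has_derivative
    (\<lambda>v. total_metric \<alpha> \<beta> (x u) (a' v) (b u) + total_metric \<alpha> \<beta> (x u) (a u) (b' v)
      + metric_derivative \<alpha> \<beta> (x u) (x' v) (a u) (b u))) (at u)"
proof -
  note D = has_derivative_matrix_mult has_derivative_hconj has_derivative_fst[OF x] has_derivative_fst[OF a]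
    has_derivative_fst[OF b] has_derivative_snd[OF a] has_derivative_snd[OF b]
  let ?J = "\<lambda>u. matrix_inv (snd (x u))"
  have hpd: "snd (x u) \<in> hpd" if "u \<in> N" for u using assms(3)[OF that] by (auto simp: total_space_def)
  have J: "(?J has_derivative (\<lambda>v. - (?J u ** snd (x' v) ** ?J u))) (at u)"
    by (rule has_derivative_matrix_inv[OF assms(1,2) hpd has_derivative_snd[OF x]])
  have 1: "((\<lambda>u. Re (trace ((fst (a u))\<^sup>H ** (mat 1 - (1/2) *\<^sub>R (fst (x u) ** (fst (x u))\<^sup>H)) ** fst (b u))))
    has_derivative (\<lambda>v. Re (trace ((fst (a' v))\<^sup>H ** (mat 1 - (1/2) *\<^sub>R (fst (x u) ** (fst (x u))\<^sup>H)) ** fst (b u)))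
      + Re (trace ((fst (a u))\<^sup>H ** (mat 1 - (1/2) *\<^sub>R (fst (x u) ** (fst (x u))\<^sup>H)) ** fst (b' v)))
      - (1/2) * Re (trace ((fst (a u))\<^sup>H ** (fst (x' v) ** (fst (x u))\<^sup>H + fst (x u) ** (fst (x' v))\<^sup>H) ** fst (b u))))) (at u)"
    by (rule has_derivative_eq_rhs, rule has_derivative_Re_trace,
        (rule D has_derivative_diff has_derivative_const has_derivative_scaleR_right)+)
      (simp add: fun_eq_iff mat_simps trace_add trace_sub trace_minus trace_scaleR algebra_simps)
  have 2: "((\<lambda>u. Re (trace (?J u ** snd (a u) ** ?J u ** snd (b u))))
    has_derivative (\<lambda>v. Re (trace (?J u ** snd (a' v) ** ?J u ** snd (b u)))
      + Re (trace (?J u ** snd (a u) ** ?J u ** snd (b' v)))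
      - Re (trace (?J u ** snd (x' v) ** ?J u ** snd (a u) ** ?J u ** snd (b u)))
      - Re (trace (?J u ** snd (a u) ** ?J u ** snd (x' v) ** ?J u ** snd (b u))))) (at u)"
    by (rule has_derivative_eq_rhs, rule has_derivative_Re_trace, (rule D J)+)
      (simp add: fun_eq_iff mat_simps trace_add trace_sub trace_minus algebra_simps)
  have 3: "((\<lambda>u. Re (trace (?J u ** snd (a u)))) has_derivative (\<lambda>v. Re (trace (?J u ** snd (a' v)))
      - Re (trace (?J u ** snd (x' v) ** ?J u ** snd (a u))))) (at u)"
    if a: "(a has_derivative a') (at u)" for a a'
    by (rule has_derivative_eq_rhs, rule has_derivative_Re_trace,
        (rule has_derivative_matrix_mult J has_derivative_snd[OF a])+)
      (simp add: fun_eq_iff mat_simps trace_add trace_sub trace_minus algebra_simps)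
  have "((\<lambda>u. total_metric \<alpha> \<beta> (x u) (a u) (b u)) has_derivative (\<lambda>v.
       (Re (trace ((fst (a' v))\<^sup>H ** (mat 1 - (1/2) *\<^sub>R (fst (x u) ** (fst (x u))\<^sup>H)) ** fst (b u)))
      + Re (trace ((fst (a u))\<^sup>H ** (mat 1 - (1/2) *\<^sub>R (fst (x u) ** (fst (x u))\<^sup>H)) ** fst (b' v)))
      - (1/2) * Re (trace ((fst (a u))\<^sup>H ** (fst (x' v) ** (fst (x u))\<^sup>H + fst (x u) ** (fst (x' v))\<^sup>H) ** fst (b u))))
      + \<alpha> * (Re (trace (?J u ** snd (a' v) ** ?J u ** snd (b u)))
      + Re (trace (?J u ** snd (a u) ** ?J u ** snd (b' v)))
      - Re (trace (?J u ** snd (x' v) ** ?J u ** snd (a u) ** ?J u ** snd (b u)))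
      - Re (trace (?J u ** snd (a u) ** ?J u ** snd (x' v) ** ?J u ** snd (b u))))
      + (\<beta> * Re (trace (?J u ** snd (a u))) * (Re (trace (?J u ** snd (b' v)))
           - Re (trace (?J u ** snd (x' v) ** ?J u ** snd (b u))))
         + \<beta> * (Re (trace (?J u ** snd (a' v)))
           - Re (trace (?J u ** snd (x' v) ** ?J u ** snd (a u)))) * Re (trace (?J u ** snd (b u)))))) (at u)"
    unfolding total_metric_def case_prod_beta
    by (intro has_derivative_add has_derivative_mult has_derivative_mult_right 1 2 3[OF a] 3[OF b])
  then show ?thesis
    by (rule has_derivative_eq_rhs)
      (simp add: fun_eq_iff total_metric_def metric_derivative_def case_prod_beta Let_def algebra_simps)
qed

section \<open>The action of the unitary group\<close>

text \<open>For fixed \<open>V\<close> the action is linear on the ambient space, hence equal to its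
  own differential: the same map moves points and tangent vectors.\<close>

definition act :: "complex^'k::finite^'k \<Rightarrow> ('p::finite, 'k) pt \<Rightarrow> ('p, 'k) pt"
  where "act V = (\<lambda>(U, \<Sigma>). (U ** V, V\<^sup>H ** \<Sigma> ** V))"

lemma act_simp: "act V (U, \<Sigma>) = (U ** V, V\<^sup>H ** \<Sigma> ** V)"
  by (simp add: act_def)

lemma act_eq: "act V x = (fst x ** V, V\<^sup>H ** snd x ** V)"
  by (simp add: act_def case_prod_beta)

lemma orbit_eq: "orbit x = {act V x | V. V \<in> unitary}"
  by (simp add: orbit_def act_eq case_prod_beta)

lemma bounded_linear_act: "bounded_linear (act V)"
  unfolding act_eq[abs_def]
  by (intro bounded_linear_Pair bounded_linear_compose[OF bounded_linear_matrix_mult_left]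
      bounded_linear_compose[OF bounded_linear_matrix_mult_right] bounded_linear_fst bounded_linear_snd)

lemma act_mat_1 [simp]: "act (mat 1) x = x"
  by (simp add: act_eq hconj_simps)

lemma act_act: "act V (act W x) = act (W ** V) x"
  by (simp add: act_eq hconj_simps matrix_mul_assoc)

lemma unitary_hconj: "V \<in> unitary \<Longrightarrow> V\<^sup>H \<in> unitary"
  by (simp add: unitary_def hconj_simps)

lemma mat_1_unitary: "mat 1 \<in> unitary"
  by (simp add: unitary_def hconj_simps)

lemma act_total_space:
  assumes "V \<in> unitary" "x \<in> total_space"
  shows "act V x \<in> total_space"
proof -
  obtain U \<Sigma> where x: "x = (U, \<Sigma>)" by (cases x)
  have U: "U\<^sup>H ** U = mat 1" and \<Sigma>: "\<Sigma> \<in> hpd" using assms(2) by (auto simp: x total_space_def stiefel_def)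
  have "(U ** V)\<^sup>H ** (U ** V) = V\<^sup>H ** (U\<^sup>H ** U) ** V"
    by (simp add: hconj_simps matrix_mul_assoc)
  then have "U ** V \<in> stiefel" using U unitaryD[OF assms(1)] by (simp add: stiefel_def)
  moreover have "V\<^sup>H ** \<Sigma> ** V \<in> hpd" by (rule hpd_congruence[OF \<Sigma> unitaryD(1)[OF assms(1)]])
  ultimately show ?thesis by (simp add: x act_simp total_space_def)
qed

lemma orbit_refl: "x \<in> orbit x"
  unfolding orbit_eq using mat_1_unitary act_mat_1[of x] by (metis (mono_tags, lifting) mem_Collect_eq)

lemma orbit_act:
  assumes "V \<in> unitary"
  shows "orbit (act V x) = orbit x"
proof -
  have "\<exists>W'. act W (act V x) = act W' x \<and> W' \<in> unitary" if "W \<in> unitary" for W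
    using unitary_mult[OF assms that] by (auto simp: act_act)
  moreover have "\<exists>W'. act W x = act W' (act V x) \<and> W' \<in> unitary" if "W \<in> unitary" for W
    using unitary_mult[OF unitary_hconj[OF assms] that]
    by (auto simp: act_act matrix_mul_assoc unitaryD[OF assms] intro!: exI[of _ "V\<^sup>H ** W"])
  ultimately show ?thesis unfolding orbit_eq by blast
qed

lemma orbit_eqD:
  assumes "orbit x = orbit y"
  obtains V where "V \<in> unitary" "y = act V x"
  using orbit_refl[of y] assms unfolding orbit_eq by blast

text \<open>The explicit group element makes its smooth dependence on the two points visible.\<close>

lemma orbit_eq_unitary:
  assumes "orbit x = orbit y" "x \<in> total_space"
  shows "(fst x)\<^sup>H ** fst y \<in> unitary" "y = act ((fst x)\<^sup>H ** fst y) x"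
proof -
  obtain V where V: "V \<in> unitary" "y = act V x" by (rule orbit_eqD[OF assms(1)])
  have "(fst x)\<^sup>H ** fst x = mat 1" using assms(2) by (auto simp: total_space_def stiefel_def)
  then have "(fst x)\<^sup>H ** fst y = V" by (simp add: V act_eq matrix_mul_assoc)
  then show "(fst x)\<^sup>H ** fst y \<in> unitary" "y = act ((fst x)\<^sup>H ** fst y) x" using V by auto
qed

lemma subspace_tangent: "subspace (tangent x)"
proof -
  let ?f = "\<lambda>\<xi>. ((snd \<xi>)\<^sup>H - snd \<xi>, (fst x)\<^sup>H ** fst \<xi> + (fst \<xi>)\<^sup>H ** fst x)"
  have lin: "linear ?f"
    by (rule linearI) (simp_all add: hconj_simps mat_simps scaleR_diff_right scaleR_right_distrib)
  have "tangent x = {\<xi>. ?f \<xi> = 0}"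
    by (auto simp: tangent_def case_prod_beta hermitian_def zero_prod_def)
  then show ?thesis using linear_subspace_kernel[OF lin] by simp
qed

lemma act_tangent:
  assumes "V \<in> unitary" "\<xi> \<in> tangent x"
  shows "act V \<xi> \<in> tangent (act V x)"
proof -
  obtain U \<Sigma> where x: "x = (U, \<Sigma>)" by (cases x)
  obtain a A where \<xi>: "\<xi> = (a, A)" by (cases \<xi>)
  have A: "A\<^sup>H = A" and a: "U\<^sup>H ** a + a\<^sup>H ** U = 0" using assms(2) by (auto simp: x \<xi> tangent_def hermitian_def)
  have "(U ** V)\<^sup>H ** (a ** V) + (a ** V)\<^sup>H ** (U ** V) = V\<^sup>H ** (U\<^sup>H ** a + a\<^sup>H ** U) ** V"
    by (simp add: hconj_simps mat_simps)
  then show ?thesis by (simp add: x \<xi> act_simp tangent_def hermitian_def hconj_simps A a matrix_mul_assoc)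
qed

lemma matrix_inv_act:
  assumes "V \<in> unitary" "\<Sigma> \<in> hpd"
  shows "matrix_inv (V\<^sup>H ** \<Sigma> ** V) = V\<^sup>H ** matrix_inv \<Sigma> ** V"
proof (rule matrix_inv_eqI)
  show "V\<^sup>H ** \<Sigma> ** V \<in> hpd" by (rule hpd_congruence[OF assms(2) unitaryD(1)[OF assms(1)]])
  have "V\<^sup>H ** \<Sigma> ** V ** (V\<^sup>H ** matrix_inv \<Sigma> ** V) = V\<^sup>H ** (\<Sigma> ** (V ** V\<^sup>H) ** matrix_inv \<Sigma>) ** V"
    by (simp add: matrix_mul_assoc)
  then show "V\<^sup>H ** \<Sigma> ** V ** (V\<^sup>H ** matrix_inv \<Sigma> ** V) = mat 1"
    by (simp add: unitaryD[OF assms(1)] hpd_inverse[OF assms(2)])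
qed

lemma unitary_cancel:
  fixes C :: "complex^'n^'m"
  assumes "V \<in> unitary"
  shows "C ** V ** V\<^sup>H = C" "C ** V\<^sup>H ** V = C"
  using unitaryD[OF assms] by (simp_all add: matrix_mul_assoc[symmetric])

lemma total_metric_act:
  assumes "V \<in> unitary" "x \<in> total_space"
  shows "total_metric \<alpha> \<beta> (act V x) (act V \<xi>) (act V \<eta>) = total_metric \<alpha> \<beta> x \<xi> \<eta>"
proof -
  obtain U \<Sigma> where x: "x = (U, \<Sigma>)" by (cases x)
  obtain a A where \<xi>: "\<xi> = (a, A)" by (cases \<xi>)
  obtain b B where \<eta>: "\<eta> = (b, B)" by (cases \<eta>)
  have \<Sigma>: "\<Sigma> \<in> hpd" using assms(2) by (auto simp: x total_space_def)
  have conj: "trace (V\<^sup>H ** X ** V) = trace X" for X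
    using trace_mul_sym[of "V\<^sup>H ** X" V] by (simp add: matrix_mul_assoc unitaryD[OF assms(1)])
  let ?J = "matrix_inv \<Sigma>"
  have 1: "(a ** V)\<^sup>H ** (mat 1 - (1/2) *\<^sub>R (U ** V ** (U ** V)\<^sup>H)) ** (b ** V)
      = V\<^sup>H ** (a\<^sup>H ** (mat 1 - (1/2) *\<^sub>R (U ** U\<^sup>H)) ** b) ** V"
    by (simp add: hconj_simps mat_simps unitary_cancel[OF assms(1)])
  have 2: "V\<^sup>H ** ?J ** V ** (V\<^sup>H ** X ** V) = V\<^sup>H ** (?J ** X) ** V" for X
    by (simp add: matrix_mul_assoc unitary_cancel[OF assms(1)])
  have 3: "V\<^sup>H ** ?J ** V ** (V\<^sup>H ** A ** V) ** (V\<^sup>H ** ?J ** V) ** (V\<^sup>H ** B ** V)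
      = V\<^sup>H ** (?J ** A ** ?J ** B) ** V"
    by (simp add: matrix_mul_assoc unitary_cancel[OF assms(1)])
  show ?thesis
    unfolding x \<xi> \<eta> act_simp total_metric_def prod.case matrix_inv_act[OF assms(1) \<Sigma>] 1
    by (simp only: 3 conj) (simp only: 2 conj)
qed

section \<open>Vertical vectors and the horizontal projection\<close>

definition vert :: "complex^'k::finite^'k \<Rightarrow> ('p::finite, 'k) pt \<Rightarrow> ('p, 'k) pt"
  where "vert \<Omega> x = (fst x ** \<Omega>, snd x ** \<Omega> - \<Omega> ** snd x)"

lemma vertical_eq: "vertical x = {vert \<Omega> x | \<Omega>. \<Omega>\<^sup>H = - \<Omega>}"
  by (simp add: vertical_def vert_def case_prod_beta)

lemma vertical_tangent:
  assumes "x \<in> total_space" "\<zeta> \<in> vertical x"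
  shows "\<zeta> \<in> tangent x"
proof -
  obtain U \<Sigma> where x: "x = (U, \<Sigma>)" by (cases x)
  have U: "U\<^sup>H ** U = mat 1" and \<Sigma>: "\<Sigma>\<^sup>H = \<Sigma>"
    using assms(1) by (auto simp: x total_space_def stiefel_def hpd_hconj)
  obtain \<Omega> where \<Omega>: "\<Omega>\<^sup>H = - \<Omega>" "\<zeta> = vert \<Omega> x" using assms(2) by (auto simp: vertical_eq)
  show ?thesis
    by (simp add: \<Omega> x vert_def tangent_def hermitian_def hconj_simps \<Sigma> mat_simps U
        matrix_mul_assoc[symmetric, of "\<Omega>" "U\<^sup>H" U])
qed

definition defect :: "real \<Rightarrow> ('p::finite, 'k::finite) pt \<Rightarrow> ('p, 'k) pt \<Rightarrow> complex^'k^'k"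
  where "defect \<alpha> x \<xi> = (fst x)\<^sup>H ** fst \<xi>
    - (2 * \<alpha>) *\<^sub>R (matrix_inv (snd x) ** snd \<xi> - snd \<xi> ** matrix_inv (snd x))"

text \<open>Sends \<open>\<Omega>\<close> to the defect of the vertical vector that it generates.
  Removing the vertical part of a tangent vector therefore means solving one linear equation with
  this operator.\<close>

definition vertical_operator :: "real \<Rightarrow> complex^'k^'k \<Rightarrow> complex^'k^'k \<Rightarrow> complex^'k^'k"
  where "vertical_operator \<alpha> \<Sigma> \<Omega> = \<Omega>
    - (2 * \<alpha>) *\<^sub>R (2 *\<^sub>R \<Omega> - matrix_inv \<Sigma> ** \<Omega> ** \<Sigma> - \<Sigma> ** \<Omega> ** matrix_inv \<Sigma>)"

lemma horizontal_iff:
  assumes "x \<in> total_space"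
  shows "\<xi> \<in> horizontal \<alpha> \<beta> x \<longleftrightarrow> \<xi> \<in> tangent x \<and> defect \<alpha> x \<xi> = 0"
proof -
  obtain U \<Sigma> where x: "x = (U, \<Sigma>)" by (cases x)
  show ?thesis using horizontal_explicit[of U \<Sigma> \<alpha> \<beta>] assms
    by (cases \<xi>) (simp add: x defect_def)
qed

lemma horizontal_act:
  assumes "V \<in> unitary" "x \<in> total_space" "\<xi> \<in> horizontal \<alpha> \<beta> x"
  shows "act V \<xi> \<in> horizontal \<alpha> \<beta> (act V x)"
proof -
  have \<Sigma>: "snd x \<in> hpd" using assms(2) by (auto simp: total_space_def)
  have "defect \<alpha> (act V x) (act V \<xi>) = V\<^sup>H ** defect \<alpha> x \<xi> ** V"
    by (simp add: defect_def act_eq matrix_inv_act[OF assms(1) \<Sigma>] hconj_simps mat_simps unitary_cancel[OF assms(1)])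
  then show ?thesis
    using assms act_total_space[OF assms(1,2)] act_tangent[OF assms(1), of \<xi> x] by (simp add: horizontal_iff)
qed

lemma defect_vert:
  fixes x :: "('p::finite, 'k::finite) pt"
  assumes "x \<in> total_space"
  shows "defect \<alpha> x (vert \<Omega> x) = vertical_operator \<alpha> (snd x) \<Omega>"
proof -
  have U: "(fst x)\<^sup>H ** fst x = mat 1" and \<Sigma>: "snd x \<in> hpd"
    using assms by (auto simp: total_space_def stiefel_def)
  have "C ** snd x ** matrix_inv (snd x) = C" "C ** matrix_inv (snd x) ** snd x = C" for C :: "complex^'k^'k"
    using hpd_inverse[OF \<Sigma>] by (simp_all add: matrix_mul_assoc[symmetric])
  then show ?thesis
    by (simp add: defect_def vert_def vertical_operator_def mat_simps U hpd_inverse[OF \<Sigma>] scaleR_2 algebra_simps)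
qed

lemma linear_vertical_operator: "linear (vertical_operator \<alpha> \<Sigma>)"
  unfolding vertical_operator_def[abs_def]
  by (rule linearI) (simp_all add: mat_simps scaleR_right_distrib scaleR_diff_right mult.commute)

text \<open>\<open>Re tr (\<Omega>\<^sup>H L \<Omega>) = |\<Omega>|\<^sup>2 + 2\<alpha> |\<Sigma>\<^sup>-\<^sup>1\<^sup>/\<^sup>2 \<Omega> \<Sigma>\<^sup>1\<^sup>/\<^sup>2 - \<Sigma>\<^sup>1\<^sup>/\<^sup>2 \<Omega> \<Sigma>\<^sup>-\<^sup>1\<^sup>/\<^sup>2|\<^sup>2\<close> for the operator \<open>L\<close>.\<close>

lemma vertical_operator_injective:
  fixes \<Sigma> :: "complex^'k^'k"
  assumes "\<alpha> > 0" "\<Sigma> \<in> hpd" "vertical_operator \<alpha> \<Sigma> \<Omega> = 0"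
  shows "\<Omega> = 0"
proof -
  define S where "S = hpd_sqrt \<Sigma>"
  define T where "T = matrix_inv S"
  have S: "S \<in> hpd" "S ** S = \<Sigma>" using hpd_sqrt[OF assms(2)] by (auto simp: S_def)
  have TS: "T ** S = mat 1" "S ** T = mat 1" using hpd_inverse[OF S(1)] by (auto simp: T_def)
  have h: "S\<^sup>H = S" "T\<^sup>H = T" using S hpd_hconj hpd_inverse_hermitian by (auto simp: T_def)
  have can: "X ** T ** S = X" "X ** S ** T = X" for X :: "complex^'k^'k"
    by (simp_all add: matrix_mul_assoc[symmetric] TS)
  have inv: "matrix_inv \<Sigma> = T ** T"
    by (rule matrix_inv_eqI[OF assms(2)]) (simp add: S(2)[symmetric] matrix_mul_assoc can TS)
  define p where "p = T ** \<Omega> ** S - S ** \<Omega> ** T"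
  have "p\<^sup>H ** p = S ** (\<Omega>\<^sup>H ** T ** T ** \<Omega> ** S) - S ** (\<Omega>\<^sup>H ** \<Omega> ** T)
      - T ** (\<Omega>\<^sup>H ** \<Omega> ** S) + T ** (\<Omega>\<^sup>H ** S ** S ** \<Omega> ** T)"
    by (simp add: p_def hconj_simps h mat_simps can)
  then have "trace (p\<^sup>H ** p) = trace (S ** (\<Omega>\<^sup>H ** T ** T ** \<Omega> ** S)) - trace (S ** (\<Omega>\<^sup>H ** \<Omega> ** T))
      - trace (T ** (\<Omega>\<^sup>H ** \<Omega> ** S)) + trace (T ** (\<Omega>\<^sup>H ** S ** S ** \<Omega> ** T))"
    by (simp add: trace_add trace_sub)
  also have "\<dots> = trace (\<Omega>\<^sup>H ** T ** T ** \<Omega> ** S ** S) - 2 * trace (\<Omega>\<^sup>H ** \<Omega>)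
      + trace (\<Omega>\<^sup>H ** S ** S ** \<Omega> ** T ** T)"
    unfolding trace_mul_sym[of S] trace_mul_sym[of T] by (simp add: can)
  finally have pp: "trace (p\<^sup>H ** p) = trace (\<Omega>\<^sup>H ** T ** T ** \<Omega> ** S ** S) - 2 * trace (\<Omega>\<^sup>H ** \<Omega>)
      + trace (\<Omega>\<^sup>H ** S ** S ** \<Omega> ** T ** T)" .
  have "0 = \<Omega>\<^sup>H ** vertical_operator \<alpha> \<Sigma> \<Omega>" using assms(3) by simp
  also have "\<dots> = \<Omega>\<^sup>H ** \<Omega> - (2 * \<alpha>) *\<^sub>R (2 *\<^sub>R (\<Omega>\<^sup>H ** \<Omega>)
      - \<Omega>\<^sup>H ** T ** T ** \<Omega> ** S ** S - \<Omega>\<^sup>H ** S ** S ** \<Omega> ** T ** T)"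
    unfolding vertical_operator_def inv by (simp add: mat_simps S(2)[symmetric])
  finally have e: "0 = \<Omega>\<^sup>H ** \<Omega> - (2 * \<alpha>) *\<^sub>R (2 *\<^sub>R (\<Omega>\<^sup>H ** \<Omega>)
      - \<Omega>\<^sup>H ** T ** T ** \<Omega> ** S ** S - \<Omega>\<^sup>H ** S ** S ** \<Omega> ** T ** T)" .
  from arg_cong[OF this, of "\<lambda>X. Re (trace X)"]
  have "0 = \<Omega> \<bullet> \<Omega> + (2 * \<alpha>) * (p \<bullet> p)"
    unfolding inner_eq_trace pp by (simp add: trace_sub trace_add trace_scaleR trace_zero algebra_simps)
  moreover have "(2 * \<alpha>) * (p \<bullet> p) \<ge> 0" using assms(1) by simp
  ultimately have "\<not> 0 < \<Omega> \<bullet> \<Omega>" by linarith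
  then show ?thesis by simp
qed

text \<open>In finite dimension the injective operator is onto, so some \<open>\<Omega>\<close>
  reproduces the defect of \<open>\<xi>\<close>; subtracting its vertical vector leaves defect
  0.\<close>

lemma horizontal_decomposition:
  fixes x :: "('p::finite, 'k::finite) pt"
  assumes "\<alpha> > 0" "x \<in> total_space" "\<xi> \<in> tangent x"
  obtains \<Omega> where "\<Omega>\<^sup>H = - \<Omega>" "vertical_operator \<alpha> (snd x) \<Omega> = defect \<alpha> x \<xi>"
    "\<xi> - vert \<Omega> x \<in> horizontal \<alpha> \<beta> x"
proof -
  have \<Sigma>: "snd x \<in> hpd" using assms(2) by (auto simp: total_space_def)
  note h = hpd_hconj[OF \<Sigma>] hpd_inverse_hermitian[OF \<Sigma>]
  note lin = linear_vertical_operator[of \<alpha> "snd x"]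
  have inj: "inj (vertical_operator \<alpha> (snd x))"
    using vertical_operator_injective[OF assms(1) \<Sigma>] by (simp add: linear_injective_0[OF lin])
  then have "surj (vertical_operator \<alpha> (snd x))" using linear_injective_imp_surjective[OF lin] by blast
  then obtain \<Omega> where \<Omega>: "vertical_operator \<alpha> (snd x) \<Omega> = defect \<alpha> x \<xi>" by (metis surjD)
  have "(defect \<alpha> x \<xi>)\<^sup>H = - defect \<alpha> x \<xi>"
  proof -
    have "(snd \<xi>)\<^sup>H = snd \<xi>" "(fst \<xi>)\<^sup>H ** fst x = - ((fst x)\<^sup>H ** fst \<xi>)"
      using assms(3) by (auto simp: tangent_def case_prod_beta hermitian_def eq_neg_iff_add_eq_0 add.commute)
    then show ?thesis by (simp add: defect_def hconj_simps h scaleR_diff_right)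
  qed
  \<comment> \<open>The operator commutes with the adjoint and its right-hand side is
    skew-Hermitian, so by injectivity the solution is skew-Hermitian too.\<close>
  moreover have "vertical_operator \<alpha> (snd x) (\<Omega>\<^sup>H) = (vertical_operator \<alpha> (snd x) \<Omega>)\<^sup>H"
    by (simp add: vertical_operator_def hconj_simps h matrix_mul_assoc algebra_simps)
  ultimately have "vertical_operator \<alpha> (snd x) (\<Omega>\<^sup>H) = vertical_operator \<alpha> (snd x) (- \<Omega>)"
    using linear_neg[OF lin] by (simp add: \<Omega>)
  then have skew: "\<Omega>\<^sup>H = - \<Omega>" using inj by (simp add: inj_eq)
  have "vert \<Omega> x \<in> tangent x" by (rule vertical_tangent[OF assms(2)]) (use skew in \<open>auto simp: vertical_eq\<close>)
  then have "\<xi> - vert \<Omega> x \<in> tangent x"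
    using assms(3) by (intro subspace_diff subspace_tangent)
  moreover have "defect \<alpha> x (\<xi> - vert \<Omega> x) = defect \<alpha> x \<xi> - defect \<alpha> x (vert \<Omega> x)"
    by (simp add: defect_def mat_simps scaleR_diff_right)
  ultimately have "\<xi> - vert \<Omega> x \<in> horizontal \<alpha> \<beta> x"
    by (simp add: horizontal_iff[OF assms(2)] defect_vert[OF assms(2)] \<Omega>)
  then show thesis using that skew \<Omega> by blast
qed

section \<open>Tangent vectors as velocities\<close>

lemma velocity_tangent:
  assumes "open N" "u \<in> N" "y ` N \<subseteq> total_space" "(y has_derivative y') (at u)"
  shows "y' v \<in> tangent (y u)"
proof -
  let ?U = "\<lambda>u. fst (y u)" and ?S = "\<lambda>u. snd (y u)"
  have tot: "(?U w)\<^sup>H ** ?U w = mat 1 \<and> (?S w)\<^sup>H = ?S w" if "w \<in> N" for w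
    using assms(3) that by (force simp: total_space_def stiefel_def hpd_hconj)
  note d = has_derivative_fst[OF assms(4)] has_derivative_snd[OF assms(4)]
  have "((\<lambda>u. (?U u)\<^sup>H ** ?U u) has_derivative (\<lambda>v. (?U u)\<^sup>H ** fst (y' v) + (fst (y' v))\<^sup>H ** ?U u)) (at u)"
    by (rule has_derivative_matrix_mult[OF has_derivative_hconj[OF d(1)] d(1)])
  moreover have "((\<lambda>u. (?U u)\<^sup>H ** ?U u) has_derivative (\<lambda>v. 0)) (at u)"
    by (rule has_derivative_transform_within_open[OF has_derivative_const[of "mat 1"] assms(1,2)]) (simp add: tot)
  ultimately have 1: "(?U u)\<^sup>H ** fst (y' v) + (fst (y' v))\<^sup>H ** ?U u = 0"
    by (rule fun_cong[OF has_derivative_unique])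
  have "(?S has_derivative (\<lambda>v. (snd (y' v))\<^sup>H)) (at u)"
    by (rule has_derivative_transform_within_open[OF has_derivative_hconj[OF d(2)] assms(1,2)]) (simp add: tot)
  from fun_cong[OF has_derivative_unique[OF this d(2)]] have "(snd (y' v))\<^sup>H = snd (y' v)" .
  then show ?thesis using 1 by (simp add: tangent_def case_prod_beta hermitian_def)
qed

text \<open>Rotating \<open>U\<close> by a one-parameter unitary group and moving
  \<open>\<Sigma>\<close> along \<open>hpd_curve\<close> realises every tangent vector. This lets
  derivatives within the total space be computed along curves.\<close>

lemma tangent_curve:
  fixes x :: "('p::finite, 'k::finite) pt"
  assumes "x \<in> total_space" "\<xi> \<in> tangent x"
  obtains \<gamma> :: "real \<Rightarrow> ('p, 'k) pt"
  where "\<gamma> 0 = x" "\<And>t. \<gamma> t \<in> total_space" "(\<gamma> has_vector_derivative \<xi>) (at 0)"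
proof -
  obtain U \<Sigma> where x: "x = (U, \<Sigma>)" by (cases x)
  obtain a A where \<xi>: "\<xi> = (a, A)" by (cases \<xi>)
  have U: "U\<^sup>H ** U = mat 1" and \<Sigma>: "\<Sigma> \<in> hpd" using assms(1) by (auto simp: x total_space_def stiefel_def)
  have A: "A \<in> hermitian" and a: "a\<^sup>H ** U = - (U\<^sup>H ** a)"
    using assms(2) by (auto simp: x \<xi> tangent_def eq_neg_iff_add_eq_0 add.commute)
  \<comment> \<open>Chosen so that \<open>(K - K\<^sup>H) ** U = a\<close>: the factor 1/2 splits
    the component \<open>U ** (U\<^sup>H ** a)\<close> evenly between \<open>K ** U\<close> and
    \<open>- K\<^sup>H ** U\<close>.\<close>
  define K where "K = (a - (1/2) *\<^sub>R (U ** (U\<^sup>H ** a))) ** U\<^sup>H"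
  define \<Omega> where "\<Omega> = K - K\<^sup>H"
  have skew: "\<Omega>\<^sup>H = - \<Omega>" by (simp add: \<Omega>_def hconj_simps)
  have rU: "C ** U\<^sup>H ** U = C" for C :: "complex^'k^'p"
    using U by (simp add: matrix_mul_assoc[symmetric])
  have ra: "C ** a\<^sup>H ** U = - (C ** U\<^sup>H ** a)" for C :: "complex^'k^'p"
    using a by (simp add: matrix_mul_assoc[symmetric] matrix_mult_minus)
  have \<Omega>U: "\<Omega> ** U = a"
  proof -
    have "\<Omega> ** U = a - (1/2) *\<^sub>R (U ** U\<^sup>H ** a) - (U ** (a\<^sup>H ** U) - (1/2) *\<^sub>R (U ** (a\<^sup>H ** U)))"
      by (simp add: \<Omega>_def K_def hconj_simps mat_simps rU)
    also have "\<dots> = a" unfolding a by (simp add: mat_simps scaleR_left_distrib[symmetric] algebra_simps)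
    finally show ?thesis .
  qed
  define \<gamma> where "\<gamma> t = (matrix_exp (t *\<^sub>R \<Omega>) ** U, hpd_curve \<Sigma> A t)" for t
  note h = hpd_curve[OF \<Sigma> A]
  have "(\<gamma> has_vector_derivative (\<Omega> ** matrix_exp (0 *\<^sub>R \<Omega>) ** U, hpd_velocity \<Sigma> A 0)) (at 0)"
    unfolding \<gamma>_def[abs_def]
    by (intro has_vector_derivative_Pair h(4)
        bounded_linear.has_vector_derivative[OF bounded_linear_matrix_mult_left] matrix_exp_has_derivative)
  then have "(\<gamma> has_vector_derivative \<xi>) (at 0)" by (simp add: matrix_exp_0 \<Omega>U h \<xi>)
  moreover have "\<gamma> t \<in> total_space" for t
  proof -
    have "(matrix_exp (t *\<^sub>R \<Omega>) ** U)\<^sup>H ** (matrix_exp (t *\<^sub>R \<Omega>) ** U)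
        = U\<^sup>H ** ((matrix_exp (t *\<^sub>R \<Omega>))\<^sup>H ** matrix_exp (t *\<^sub>R \<Omega>)) ** U"
      by (simp add: hconj_simps matrix_mul_assoc)
    then show ?thesis
      using unitaryD(1)[OF matrix_exp_skew_unitary[OF skew, of t]]
      by (simp add: \<gamma>_def total_space_def stiefel_def U h)
  qed
  moreover have "\<gamma> 0 = x" by (simp add: \<gamma>_def matrix_exp_0 h x)
  ultimately show thesis using that by blast
qed

section \<open>Charts of the quotient\<close>

text \<open>A derivative within a submanifold is not unique as a linear map on the ambient space,
  but along a curve with velocity \<open>\<xi>\<close> both candidates compute the same vector
  derivative.\<close>

lemma derivative_on_tangent_unique:
  assumes "x \<in> total_space" "\<xi> \<in> tangent x"
    and "(f has_derivative f1) (at x within total_space)" "(f has_derivative f2) (at x within total_space)"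
  shows "f1 \<xi> = f2 \<xi>"
proof -
  obtain \<gamma> where \<gamma>: "\<gamma> 0 = x" "\<And>t::real. \<gamma> t \<in> total_space" "(\<gamma> has_vector_derivative \<xi>) (at 0)"
    by (rule tangent_curve[OF assms(1,2)]) blast
  have "((\<lambda>t. f (\<gamma> t)) has_vector_derivative f' \<xi>) (at 0)"
    if f': "(f has_derivative f') (at x within total_space)" for f'
  proof -
    have "(f has_derivative f') (at (\<gamma> 0) within range \<gamma>)"
      by (rule has_derivative_subset[of _ _ _ total_space]) (use f' \<gamma> in auto)
    from diff_chain_within[OF \<gamma>(3)[unfolded has_vector_derivative_def] this]
    show ?thesis
      by (simp add: has_vector_derivative_def o_def linear_cmul[OF has_derivative_linear[OF f']])
  qed
  from vector_derivative_unique_at[OF this[OF assms(3)] this[OF assms(4)]] show ?thesis .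
qed

lemma differentiable_bounded_linear:
  "bounded_linear L \<Longrightarrow> f differentiable F \<Longrightarrow> (\<lambda>u. L (f u)) differentiable F"
  unfolding differentiable_def using bounded_linear.has_derivative by blast

lemma differentiable_matrix_mult:
  assumes "f differentiable (at u)" "g differentiable (at u)"
  shows "(\<lambda>u. f u ** g u :: complex^'n^'m) differentiable (at u)"
proof -
  obtain f' g' where "(f has_derivative f') (at u)" "(g has_derivative g') (at u)"
    using assms unfolding differentiable_def by blast
  from has_derivative_matrix_mult[OF this] show ?thesis by (rule differentiableI)
qed

lemma differentiable_Pair:
  "f differentiable (at u within S) \<Longrightarrow> g differentiable (at u within S) \<Longrightarrow>
    (\<lambda>u. (f u, g u)) differentiable (at u within S)"
  unfolding differentiable_def using has_derivative_Pair by blast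

locale quotient_chart =
  fixes \<alpha> \<beta> :: real
    and W :: "('p::finite, 'k::finite) pt set set"
    and c :: "('p, 'k) pt set \<Rightarrow> 'e::euclidean_space"
  assumes \<alpha>: "\<alpha> > 0" and \<beta>: "\<beta> > - \<alpha> / real CARD('k)"
    and chart: "(W, c) \<in> quotient_atlas total_space orbit"
begin

definition dom :: "('p, 'k) pt set"
  where "dom = {x \<in> total_space. orbit x \<in> W}"

abbreviation coord :: "('p, 'k) pt \<Rightarrow> 'e"
  where "coord \<equiv> c \<circ> orbit"

definition dcoord :: "('p, 'k) pt \<Rightarrow> ('p, 'k) pt \<Rightarrow> 'e"
  where "dcoord x = frechet_derivative coord (at x within total_space)"

lemma domD: "x \<in> dom \<Longrightarrow> x \<in> total_space" "x \<in> dom \<Longrightarrow> orbit x \<in> W"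
  by (auto simp: dom_def)

lemma chart_facts:
  shows W: "W \<subseteq> orbit ` total_space" and dom_openin: "openin (top_of_set total_space) dom"
    and inj: "inj_on c W" and open_image: "open (c ` W)" and smooth_coord: "smooth_on_subset dom coord"
    and sections: "\<forall>v\<in>c ` W. \<exists>V s. open V \<and> v \<in> V \<and> V \<subseteq> c ` W \<and> smooth_on V s \<and> s ` V \<subseteq> total_space \<and>
       (\<forall>u\<in>V. orbit (s u) \<in> W \<and> c (orbit (s u)) = u)"
  using chart unfolding quotient_atlas_def dom_def by simp_all

lemma coord_image: "x \<in> dom \<Longrightarrow> coord x \<in> c ` W"
  by (simp add: dom_def)

lemma image_coord: "v \<in> c ` W \<Longrightarrow> \<exists>x\<in>dom. coord x = v"
  using W by (fastforce simp: dom_def)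

lemma coord_eq_orbit: "x \<in> dom \<Longrightarrow> y \<in> dom \<Longrightarrow> coord x = coord y \<Longrightarrow> orbit x = orbit y"
  using inj by (auto simp: dom_def inj_on_def)

lemma act_dom: "V \<in> unitary \<Longrightarrow> x \<in> dom \<Longrightarrow> act V x \<in> dom"
  by (simp add: dom_def act_total_space orbit_act)

lemma coord_act: "V \<in> unitary \<Longrightarrow> coord (act V x) = coord x"
  by (simp add: orbit_act)

lemma dom_nhd:
  assumes "x \<in> dom"
  obtains N where "open N" "x \<in> N" "N \<inter> total_space \<subseteq> dom"
proof -
  obtain T where "open T" "dom = total_space \<inter> T" using dom_openin by (auto simp: openin_open)
  then show thesis by (intro that[of T]) (use assms in auto)
qed

lemma coord_extension:
  assumes "x \<in> dom"
  obtains N F where "open N" "x \<in> N" "smooth_on N F" "N \<inter> total_space \<subseteq> dom"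
    "\<And>y. y \<in> N \<inter> total_space \<Longrightarrow> F y = coord y"
proof -
  obtain N F where N: "open N" "x \<in> N" "smooth_on N F" "\<And>y. y \<in> N \<inter> dom \<Longrightarrow> F y = coord y"
    using smooth_coord[unfolded smooth_on_subset_def, rule_format, OF assms] by blast
  obtain N' where N': "open N'" "x \<in> N'" "N' \<inter> total_space \<subseteq> dom" by (rule dom_nhd[OF assms])
  have F: "smooth_on (N \<inter> N') F" using N(3) by (auto simp: smooth_on_def intro: Ck_on_subset)
  show thesis
  proof (rule that[OF open_Int[OF N(1) N'(1)] _ F])
    show "x \<in> N \<inter> N'" "N \<inter> N' \<inter> total_space \<subseteq> dom" using N(2) N'(2,3) by auto
    show "F y = coord y" if "y \<in> N \<inter> N' \<inter> total_space" for y
      by (rule N(4)) (use that N'(3) in auto)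
  qed
qed

lemma coord_has_derivative:
  assumes "x \<in> dom"
  shows "(coord has_derivative dcoord x) (at x within total_space)"
proof -
  obtain N F where N: "open N" "x \<in> N" "smooth_on N F" "N \<inter> total_space \<subseteq> dom"
    "\<And>y. y \<in> N \<inter> total_space \<Longrightarrow> F y = coord y" by (rule coord_extension[OF assms]) blast
  have "Ck_on (Suc 0) N F" using N(3) by (simp only: smooth_on_def)
  from has_derivative_at_withinI[OF Ck_on_has_derivative[OF this N(2)]]
  have F: "(F has_derivative frechet_derivative F (at x)) (at x within total_space)" .
  have "eventually (\<lambda>y. F y = coord y) (at x within total_space)"
    unfolding eventually_at_topological using N(1,2,5) by blast
  from has_derivative_transform_eventually[OF F this]
  have "(coord has_derivative frechet_derivative F (at x)) (at x within total_space)"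
    using N(5)[of x] N(2) domD[OF assms] by (simp add: o_def)
  then show ?thesis unfolding dcoord_def frechet_derivative_works[symmetric] by (rule differentiableI)
qed

lemma linear_dcoord: "x \<in> dom \<Longrightarrow> linear (dcoord x)"
  using has_derivative_linear[OF coord_has_derivative] .

lemma coord_chain:
  assumes "open N" "u \<in> N" "y ` N \<subseteq> total_space" "y u \<in> dom" "(y has_derivative y') (at u)"
  shows "((\<lambda>u. coord (y u)) has_derivative (\<lambda>v. dcoord (y u) (y' v))) (at u)"
proof -
  have "(y has_derivative y') (at u within N)" by (rule has_derivative_at_withinI[OF assms(5)])
  from diff_chain_within[OF this has_derivative_subset[OF coord_has_derivative[OF assms(4)] assms(3)]]
  show ?thesis using at_within_open[OF assms(2,1)] by (simp add: o_def)
qed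

text \<open>Differentiate \<open>coord \<circ> act V = coord\<close>; tangency of
  \<open>\<xi>\<close> makes the two resulting derivatives comparable.\<close>

lemma dcoord_act:
  assumes "V \<in> unitary" "x \<in> dom" "\<xi> \<in> tangent x"
  shows "dcoord (act V x) (act V \<xi>) = dcoord x \<xi>"
proof (rule derivative_on_tangent_unique[OF domD(1)[OF assms(2)] assms(3) _ coord_has_derivative[OF assms(2)]])
  have "(act V has_derivative act V) (at x within total_space)"
    using bounded_linear_imp_has_derivative[OF bounded_linear_act] .
  moreover have "(coord has_derivative dcoord (act V x)) (at (act V x) within act V ` total_space)"
    by (rule has_derivative_subset[OF coord_has_derivative[OF act_dom[OF assms(1,2)]]])
      (use act_total_space[OF assms(1)] in blast)
  ultimately have "(coord \<circ> act V has_derivative dcoord (act V x) \<circ> act V) (at x within total_space)"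
    by (rule diff_chain_within)
  moreover have "coord \<circ> act V = coord" using coord_act[OF assms(1)] by (simp add: fun_eq_iff)
  ultimately show "(coord has_derivative (\<lambda>\<xi>. dcoord (act V x) (act V \<xi>))) (at x within total_space)"
    by (simp add: o_def)
qed

section \<open>Local sections of the orbit map\<close>

definition is_section :: "'e set \<Rightarrow> ('e \<Rightarrow> ('p, 'k) pt) \<Rightarrow> bool"
  where "is_section N s \<longleftrightarrow> open N \<and> N \<subseteq> c ` W \<and> smooth_on N s \<and> (\<forall>u\<in>N. s u \<in> dom \<and> coord (s u) = u)"

text \<open>The atlas supplies a section that meets the orbit of \<open>x\<close>, possibly at
  another point. A fixed unitary matrix translates it so that it passes through
  \<open>x\<close>.\<close>

lemma section_through:
  assumes "x \<in> dom"
  obtains N s where "is_section N s" "coord x \<in> N" "s (coord x) = x"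
proof -
  obtain N s where N: "open N" "coord x \<in> N" "N \<subseteq> c ` W" "smooth_on N s" "s ` N \<subseteq> total_space"
    "\<forall>u\<in>N. orbit (s u) \<in> W \<and> c (orbit (s u)) = u"
    using bspec[OF sections coord_image[OF assms]] by blast
  have s: "s u \<in> dom" "coord (s u) = u" if "u \<in> N" for u
    using N(5,6) that by (auto simp: dom_def)
  have "orbit (s (coord x)) = orbit x"
    by (rule coord_eq_orbit[OF s(1)[OF N(2)] assms s(2)[OF N(2)]])
  then obtain V where V: "V \<in> unitary" "x = act V (s (coord x))" by (rule orbit_eqD)
  have "Ck_on n N (\<lambda>u. act V (s u))" for n
    by (rule Ck_on_linear[OF N(1) bounded_linear_act]) (use N(4) in \<open>simp add: smooth_on_def\<close>)
  then have "is_section N (\<lambda>u. act V (s u))"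
    using N(1,3) act_dom[OF V(1)] coord_act[OF V(1)] s unfolding is_section_def smooth_on_def by simp
  then show thesis using that[OF _ N(2)] V(2) by simp
qed

lemma sectionD:
  assumes "is_section N s"
  shows "open N" "N \<subseteq> c ` W" "Ck_on n N s" "u \<in> N \<Longrightarrow> s u \<in> dom" "u \<in> N \<Longrightarrow> coord (s u) = u"
  using assms unfolding is_section_def smooth_on_def by auto

lemma section_has_derivative:
  assumes "is_section N s" "u \<in> N"
  shows "(s has_derivative frechet_derivative s (at u)) (at u)"
  by (rule Ck_on_has_derivative[OF sectionD(3)[OF assms(1), of "Suc 0"] assms(2)])

lemma section_derivative:
  assumes "is_section N s" "u \<in> N"
  shows "frechet_derivative s (at u) a \<in> tangent (s u)" "dcoord (s u) (frechet_derivative s (at u) a) = a"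
proof -
  note S = sectionD[OF assms(1)]
  have sub: "s ` N \<subseteq> total_space" using S(4) domD by blast
  show "frechet_derivative s (at u) a \<in> tangent (s u)"
    by (rule velocity_tangent[OF S(1) assms(2) sub section_has_derivative[OF assms]])
  have "((\<lambda>u. coord (s u)) has_derivative (\<lambda>a. dcoord (s u) (frechet_derivative s (at u) a))) (at u)"
    by (rule coord_chain[OF S(1) assms(2) sub S(4)[OF assms(2)] section_has_derivative[OF assms]])
  moreover have "((\<lambda>u. coord (s u)) has_derivative (\<lambda>a. a)) (at u)"
    by (rule has_derivative_transform_within_open[OF has_derivative_ident S(1) assms(2)]) (use S(5) in simp)
  ultimately show "dcoord (s u) (frechet_derivative s (at u) a) = a"
    by (rule fun_cong[OF has_derivative_unique])
qed

section \<open>The kernel of the differential of the coordinate map\<close>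

lemma dcoord_vertical:
  assumes "x \<in> dom" "\<zeta> \<in> vertical x"
  shows "dcoord x \<zeta> = 0"
proof -
  obtain \<Omega> where \<Omega>: "\<Omega>\<^sup>H = - \<Omega>" "\<zeta> = vert \<Omega> x" using assms(2) by (auto simp: vertical_eq)
  define \<gamma> where "\<gamma> t = act (matrix_exp (t *\<^sub>R \<Omega>)) x" for t :: real
  have u: "matrix_exp (t *\<^sub>R \<Omega>) \<in> unitary" for t by (rule matrix_exp_skew_unitary[OF \<Omega>(1)])
  have \<gamma>0: "\<gamma> 0 = x" by (simp add: \<gamma>_def matrix_exp_0)
  have "(\<gamma> has_vector_derivative \<zeta>) (at 0)"
  proof -
    have e: "((\<lambda>t. matrix_exp (t *\<^sub>R \<Omega>)) has_vector_derivative \<Omega>) (at 0)"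
      using matrix_exp_has_derivative[of \<Omega> 0] by (simp add: matrix_exp_0)
    have eH: "((\<lambda>t. (matrix_exp (t *\<^sub>R \<Omega>))\<^sup>H) has_vector_derivative - \<Omega>) (at 0)"
      using bounded_linear.has_vector_derivative[OF bounded_linear_hconj e] by (simp add: \<Omega>)
    have 1: "((\<lambda>t. fst x ** matrix_exp (t *\<^sub>R \<Omega>)) has_vector_derivative fst x ** \<Omega>) (at 0)"
      by (rule bounded_linear.has_vector_derivative[OF bounded_linear_matrix_mult_right e])
    have "((\<lambda>t. (matrix_exp (t *\<^sub>R \<Omega>))\<^sup>H ** snd x ** matrix_exp (t *\<^sub>R \<Omega>)) has_vector_derivative
        (matrix_exp (0 *\<^sub>R \<Omega>))\<^sup>H ** snd x ** \<Omega> + - \<Omega> ** snd x ** matrix_exp (0 *\<^sub>R \<Omega>)) (at 0)"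
      by (rule has_vector_derivative_matrix_mult[OF
            bounded_linear.has_vector_derivative[OF bounded_linear_matrix_mult_left eH] e])
    from has_vector_derivative_Pair[OF 1 this]
    show ?thesis unfolding \<gamma>_def[abs_def] act_eq
      by (simp add: \<Omega>(2) vert_def matrix_exp_0 hconj_simps mat_simps)
  qed
  from coord_chain[of UNIV 0 \<gamma>, OF _ _ _ _ this[unfolded has_vector_derivative_def]]
  have "((\<lambda>t. coord (\<gamma> t)) has_derivative (\<lambda>t. dcoord x (t *\<^sub>R \<zeta>))) (at 0)"
    using \<gamma>0 assms(1) act_total_space[OF u domD(1)[OF assms(1)]] by (auto simp: \<gamma>_def)
  moreover have "((\<lambda>t. coord (\<gamma> t)) has_derivative (\<lambda>t. 0)) (at 0)"
    by (simp add: \<gamma>_def orbit_act[OF u])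
  ultimately have "dcoord x (1 *\<^sub>R \<zeta>) = 0" by (rule fun_cong[OF has_derivative_unique])
  then show ?thesis by simp
qed

text \<open>Take a curve \<open>\<gamma>\<close> with velocity \<open>\<xi>\<close> and lift its
  coordinates by a section through \<open>x\<close>. The lift \<open>z\<close> has velocity 0 at
  time 0 and stays in the same orbits as \<open>\<gamma>\<close>, so all of \<open>\<xi>\<close>
  comes from the group element that moves \<open>z t\<close> to \<open>\<gamma> t\<close>.\<close>

lemma dcoord_kernel:
  assumes "x \<in> dom" "\<xi> \<in> tangent x" "dcoord x \<xi> = 0"
  shows "\<xi> \<in> vertical x"
proof -
  obtain N s where s: "is_section N s" "coord x \<in> N" "s (coord x) = x" by (rule section_through[OF assms(1)])
  note S = sectionD[OF s(1)]
  obtain \<gamma> where \<gamma>: "\<gamma> 0 = x" "\<And>t::real. \<gamma> t \<in> total_space" "(\<gamma> has_vector_derivative \<xi>) (at 0)"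
    by (rule tangent_curve[OF domD(1)[OF assms(1)] assms(2)]) blast
  obtain N' where N': "open N'" "x \<in> N'" "N' \<inter> total_space \<subseteq> dom" by (rule dom_nhd[OF assms(1)])
  have "((\<lambda>t. coord (\<gamma> t)) has_derivative (\<lambda>t. dcoord (\<gamma> 0) (t *\<^sub>R \<xi>))) (at 0)"
    by (rule coord_chain[of UNIV, OF _ _ _ _ \<gamma>(3)[unfolded has_vector_derivative_def]])
      (use \<gamma> assms(1) in auto)
  then have dc: "((\<lambda>t. coord (\<gamma> t)) has_derivative (\<lambda>t. 0)) (at 0)"
    using \<gamma>(1) assms(3) by (simp add: linear_cmul[OF linear_dcoord[OF assms(1)]])
  define z where "z t = s (coord (\<gamma> t))" for t
  have z0: "z 0 = x" by (simp add: z_def \<gamma> s(3)[simplified])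
  have "(s has_derivative frechet_derivative s (at (coord x))) (at (coord (\<gamma> 0)))"
    using section_has_derivative[OF s(1,2)] \<gamma>(1) by simp
  from diff_chain_at[OF dc this]
  have dz: "(z has_vector_derivative 0) (at 0)"
    using linear_0[OF has_derivative_linear[OF section_has_derivative[OF s(1,2)]]]
    by (simp add: has_vector_derivative_def o_def z_def[abs_def])
  \<comment> \<open>This formula for the group element is visibly differentiable in
    \<open>t\<close>; its velocity \<open>\<Omega>\<close> generates the vertical vector
    sought.\<close>
  define V where "V t = (fst (z t))\<^sup>H ** fst (\<gamma> t)" for t
  define \<Omega> where "\<Omega> = (fst x)\<^sup>H ** fst \<xi>"
  note pr = bounded_linear.has_vector_derivative[OF bounded_linear_fst] bounded_linear.has_vector_derivative[OF bounded_linear_snd]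
  have dV: "(V has_vector_derivative \<Omega>) (at 0)"
    using has_vector_derivative_matrix_mult[OF bounded_linear.has_vector_derivative[OF bounded_linear_hconj pr(1)[OF dz]] pr(1)[OF \<gamma>(3)]]
    by (simp add: V_def[abs_def] z0 \<Omega>_def hconj_simps)
  have V0: "V 0 = mat 1" using domD(1)[OF assms(1)] by (auto simp: V_def z0 \<gamma> total_space_def stiefel_def)
  have skew: "\<Omega>\<^sup>H = - \<Omega>"
    using assms(2) by (auto simp: \<Omega>_def tangent_def case_prod_beta hconj_simps eq_neg_iff_add_eq_0 add.commute)
  have nhd: "eventually (\<lambda>t. g t \<in> B) (nhds 0)" if "isCont g 0" "open B" "g 0 \<in> B" for g :: "real \<Rightarrow> 'b::topological_space" and B
    using that topological_tendstoD[of g "g 0" "nhds 0"] by (simp add: isCont_def tendsto_at_iff_tendsto_nhds)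
  have "eventually (\<lambda>t. \<gamma> t \<in> N') (nhds 0)"
    by (rule nhd[OF has_vector_derivative_continuous[OF \<gamma>(3)] N'(1)]) (simp add: \<gamma>(1) N'(2))
  moreover have "eventually (\<lambda>t. coord (\<gamma> t) \<in> N) (nhds 0)"
    by (rule nhd[OF has_derivative_continuous[OF dc] S(1)]) (use \<gamma>(1) s(2) in simp)
  ultimately have "eventually (\<lambda>t. act (V t) (z t) = \<gamma> t) (nhds 0)"
  proof eventually_elim
    case (elim t)
    have \<gamma>t: "\<gamma> t \<in> dom" using N'(3) elim(1) \<gamma>(2) by blast
    have zt: "z t \<in> dom" "coord (z t) = coord (\<gamma> t)" using S(4,5) elim(2) by (auto simp: z_def)
    from orbit_eq_unitary(2)[OF coord_eq_orbit[OF zt(1) \<gamma>t zt(2)] domD(1)[OF zt(1)]]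
    show ?case by (simp add: V_def)
  qed
  then obtain T where T: "open T" "0 \<in> T" "\<And>t. t \<in> T \<Longrightarrow> act (V t) (z t) = \<gamma> t"
    unfolding eventually_nhds by blast
  have "((\<lambda>t. act (V t) (z t)) has_vector_derivative
      (fst (z 0) ** \<Omega> + fst (0 :: ('p, 'k) pt) ** V 0,
       (V 0)\<^sup>H ** snd (z 0) ** \<Omega> + ((V 0)\<^sup>H ** snd (0 :: ('p, 'k) pt) + \<Omega>\<^sup>H ** snd (z 0)) ** V 0)) (at 0)"
    unfolding act_eq
    by (intro has_vector_derivative_Pair has_vector_derivative_matrix_mult pr(1)[OF dz] pr(2)[OF dz] dV
        bounded_linear.has_vector_derivative[OF bounded_linear_hconj])
  then have "((\<lambda>t. act (V t) (z t)) has_vector_derivative vert \<Omega> x) (at 0)"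
    by (simp add: V0 z0 skew hconj_simps mat_simps vert_def)
  from has_vector_derivative_transform_within_open[OF this T(1,2)] T(3)
  have "(\<gamma> has_vector_derivative vert \<Omega> x) (at 0)" by blast
  from vector_derivative_unique_at[OF \<gamma>(3) this] show ?thesis using skew by (auto simp: vertical_eq)
qed

section \<open>Horizontal lifts\<close>

lemma metric_horizontal_vertical:
  "\<xi> \<in> horizontal \<alpha> \<beta> x \<Longrightarrow> \<zeta> \<in> vertical x \<Longrightarrow> total_metric \<alpha> \<beta> x \<xi> \<zeta> = 0"
  by (simp add: horizontal_def)

lemma horizontal_tangent: "\<xi> \<in> horizontal \<alpha> \<beta> x \<Longrightarrow> \<xi> \<in> tangent x"
  by (simp add: horizontal_def)

lemma subspace_horizontal: "subspace (horizontal \<alpha> \<beta> x)"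
  unfolding subspace_def horizontal_def
  using subspace_tangent[of x]
  by (auto simp: subspace_def linear_0[OF linear_total_metric_left] linear_add[OF linear_total_metric_left]
      linear_cmul[OF linear_total_metric_left] simp del: split_paired_All)

lemma metric_pos:
  fixes x :: "('p, 'k) pt"
  assumes "x \<in> total_space" "\<xi> \<in> tangent x" "\<xi> \<noteq> 0"
  shows "total_metric \<alpha> \<beta> x \<xi> \<xi> > 0"
proof -
  obtain U \<Sigma> where x: "x = (U, \<Sigma>)" by (cases x)
  obtain a A where \<xi>: "\<xi> = (a, A)" by (cases \<xi>)
  show ?thesis using total_metric_pos[OF \<alpha> \<beta>] assms unfolding x \<xi> by blast
qed

text \<open>The difference of two lifts is both horizontal and vertical, hence orthogonal to
  itself.\<close>

lemma horizontal_unique: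
  assumes "x \<in> dom" "\<xi> \<in> horizontal \<alpha> \<beta> x" "\<eta> \<in> horizontal \<alpha> \<beta> x" "dcoord x \<xi> = dcoord x \<eta>"
  shows "\<xi> = \<eta>"
proof (rule ccontr)
  assume "\<xi> \<noteq> \<eta>"
  have h: "\<xi> - \<eta> \<in> horizontal \<alpha> \<beta> x" by (rule subspace_diff[OF subspace_horizontal assms(2,3)])
  have "dcoord x (\<xi> - \<eta>) = 0" using assms(4) by (simp add: linear_diff[OF linear_dcoord[OF assms(1)]])
  from metric_horizontal_vertical[OF h dcoord_kernel[OF assms(1) horizontal_tangent[OF h] this]]
  show False using metric_pos[OF domD(1)[OF assms(1)] horizontal_tangent[OF h]] \<open>\<xi> \<noteq> \<eta>\<close> by simp
qed

lemma horizontal_part: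
  assumes "x \<in> dom" "\<xi> \<in> tangent x"
  obtains \<eta> where "\<eta> \<in> horizontal \<alpha> \<beta> x" "dcoord x \<eta> = dcoord x \<xi>" "\<xi> - \<eta> \<in> vertical x"
proof -
  obtain \<Omega> where \<Omega>: "\<Omega>\<^sup>H = - \<Omega>" "\<xi> - vert \<Omega> x \<in> horizontal \<alpha> \<beta> x"
    using horizontal_decomposition[OF \<alpha> domD(1)[OF assms(1)] assms(2)] by blast
  have v: "vert \<Omega> x \<in> vertical x" using \<Omega>(1) by (auto simp: vertical_eq)
  show thesis
  proof (rule that[OF \<Omega>(2)])
    show "dcoord x (\<xi> - vert \<Omega> x) = dcoord x \<xi>"
      by (simp add: linear_diff[OF linear_dcoord[OF assms(1)]] dcoord_vertical[OF assms(1) v])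
  qed (simp add: v)
qed

lemma horizontal_exists:
  assumes "x \<in> dom"
  shows "\<exists>\<xi>\<in>horizontal \<alpha> \<beta> x. dcoord x \<xi> = a"
proof -
  obtain N s where s: "is_section N s" "coord x \<in> N" "s (coord x) = x" by (rule section_through[OF assms])
  note d = section_derivative[OF s(1,2), of a, unfolded s(3)]
  show ?thesis by (rule horizontal_part[OF assms d(1)]) (use d(2) in auto)
qed

definition hlift :: "('p, 'k) pt \<Rightarrow> 'e \<Rightarrow> ('p, 'k) pt"
  where "hlift x a = (THE \<xi>. \<xi> \<in> horizontal \<alpha> \<beta> x \<and> dcoord x \<xi> = a)"

lemma hlift_eqI:
  assumes "x \<in> dom" "\<xi> \<in> horizontal \<alpha> \<beta> x" "dcoord x \<xi> = a"
  shows "hlift x a = \<xi>"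
  unfolding hlift_def by (rule the_equality) (use assms horizontal_unique[OF assms(1)] in auto)

lemma hlift:
  assumes "x \<in> dom"
  shows "hlift x a \<in> horizontal \<alpha> \<beta> x" "dcoord x (hlift x a) = a"
  using horizontal_exists[OF assms, of a] hlift_eqI[OF assms] by auto

lemma linear_hlift:
  assumes "x \<in> dom"
  shows "linear (hlift x)"
proof (rule linearI)
  note lin = linear_dcoord[OF assms]
  show "hlift x (a + b) = hlift x a + hlift x b" for a b
    by (rule hlift_eqI[OF assms subspace_add[OF subspace_horizontal hlift(1)[OF assms] hlift(1)[OF assms]]])
      (simp add: linear_add[OF lin] hlift(2)[OF assms])
  show "hlift x (r *\<^sub>R a) = r *\<^sub>R hlift x a" for r a
    by (rule hlift_eqI[OF assms subspace_scale[OF subspace_horizontal hlift(1)[OF assms]]])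
      (simp add: linear_cmul[OF lin] hlift(2)[OF assms])
qed

lemma hlift_act:
  assumes "V \<in> unitary" "x \<in> dom"
  shows "hlift (act V x) a = act V (hlift x a)"
  using dcoord_act[OF assms horizontal_tangent[OF hlift(1)[OF assms(2)]]] hlift[OF assms(2)]
  by (intro hlift_eqI act_dom horizontal_act assms domD(1)[OF assms(2)]) auto

section \<open>The quotient metric in coordinates\<close>

abbreviation G :: "'e \<Rightarrow> 'e \<Rightarrow> 'e \<Rightarrow> real"
  where "G \<equiv> quotient_metric \<alpha> \<beta> (W, c)"

text \<open>The description defining the metric constrains all points of a fibre at once.
  Equivariance of lifts and invariance of \<open>total_metric\<close> make the value computed at
  \<open>x\<close> valid on its whole orbit; surjectivity of \<open>dcoord x\<close> on horizontal
  vectors leaves no other choice.\<close>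

lemma G_eq:
  assumes "x \<in> dom"
  shows "G (coord x) a b = total_metric \<alpha> \<beta> x (hlift x a) (hlift x b)"
proof -
  define g0 where "g0 a b = total_metric \<alpha> \<beta> x (hlift x a) (hlift x b)" for a b
  have pd: "proj_differential total_space orbit y \<xi> (W, c) = dcoord y \<xi>" if "orbit y \<in> W" for y \<xi>
    using that chart by (simp add: proj_differential_def dcoord_def)
  have "G (coord x) = g0"
    unfolding quotient_metric_def submersion_metric_def prod.case
  proof (rule the_equality)
    show "\<forall>y\<in>total_space. orbit y \<in> W \<and> c (orbit y) = coord x \<longrightarrow> (\<forall>\<xi>\<in>horizontal \<alpha> \<beta> y. \<forall>\<eta>\<in>horizontal \<alpha> \<beta> y.
      g0 (proj_differential total_space orbit y \<xi> (W, c)) (proj_differential total_space orbit y \<eta> (W, c))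
        = total_metric \<alpha> \<beta> y \<xi> \<eta>)"
    proof (intro ballI impI, elim conjE)
      fix y \<xi> \<eta>
      assume y: "y \<in> total_space" "orbit y \<in> W" "c (orbit y) = coord x"
        and h: "\<xi> \<in> horizontal \<alpha> \<beta> y" "\<eta> \<in> horizontal \<alpha> \<beta> y"
      have yd: "y \<in> dom" using y by (simp add: dom_def)
      have "orbit x = orbit y" by (rule coord_eq_orbit[OF assms yd]) (simp add: y(3))
      then obtain V where V: "V \<in> unitary" "y = act V x" by (rule orbit_eqD)
      have "\<xi> = act V (hlift x (dcoord y \<xi>))" "\<eta> = act V (hlift x (dcoord y \<eta>))"
        using hlift_eqI[OF yd h(1) refl] hlift_eqI[OF yd h(2) refl]
        by (simp_all add: hlift_act[OF V(1) assms, symmetric] V(2))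
      then have "total_metric \<alpha> \<beta> y \<xi> \<eta> = g0 (dcoord y \<xi>) (dcoord y \<eta>)"
        using total_metric_act[OF V(1) domD(1)[OF assms]] V(2) unfolding g0_def by metis
      then show "g0 (proj_differential total_space orbit y \<xi> (W, c)) (proj_differential total_space orbit y \<eta> (W, c))
        = total_metric \<alpha> \<beta> y \<xi> \<eta>" by (simp add: pd[OF y(2)])
    qed
  next
    fix g
    assume g: "\<forall>y\<in>total_space. orbit y \<in> W \<and> c (orbit y) = coord x \<longrightarrow> (\<forall>\<xi>\<in>horizontal \<alpha> \<beta> y. \<forall>\<eta>\<in>horizontal \<alpha> \<beta> y.
      g (proj_differential total_space orbit y \<xi> (W, c)) (proj_differential total_space orbit y \<eta> (W, c))
        = total_metric \<alpha> \<beta> y \<xi> \<eta>)"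
    have "g a b = g0 a b" for a b
      using bspec[OF g domD(1)[OF assms]] hlift[OF assms, of a] hlift[OF assms, of b] domD(2)[OF assms]
      by (simp add: pd[OF domD(2)[OF assms]] g0_def) metis
    then show "g = g0" by (intro ext)
  qed
  then show ?thesis by (simp add: g0_def)
qed

text \<open>One horizontal argument is enough, since it is orthogonal to the vertical part of the
  other.\<close>

lemma G_horizontal:
  assumes "x \<in> dom" "\<xi> \<in> horizontal \<alpha> \<beta> x" "\<zeta> \<in> tangent x"
  shows "G (coord x) (dcoord x \<xi>) (dcoord x \<zeta>) = total_metric \<alpha> \<beta> x \<xi> \<zeta>"
proof -
  obtain \<eta> where \<eta>: "\<eta> \<in> horizontal \<alpha> \<beta> x" "dcoord x \<eta> = dcoord x \<zeta>" "\<zeta> - \<eta> \<in> vertical x"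
    by (rule horizontal_part[OF assms(1,3)])
  have "total_metric \<alpha> \<beta> x \<xi> \<zeta> = total_metric \<alpha> \<beta> x \<xi> \<eta>"
    using metric_horizontal_vertical[OF assms(2) \<eta>(3)] by (simp add: linear_diff[OF linear_total_metric])
  then show ?thesis
    unfolding G_eq[OF assms(1)] using hlift_eqI[OF assms(1,2) refl] hlift_eqI[OF assms(1) \<eta>(1,2)] by simp
qed

text \<open>Pythagoras: projecting discards the vertical component, whose square is
  nonnegative.\<close>

lemma G_le:
  assumes "x \<in> dom" "\<zeta> \<in> tangent x"
  shows "G (coord x) (dcoord x \<zeta>) (dcoord x \<zeta>) \<le> total_metric \<alpha> \<beta> x \<zeta> \<zeta>"
proof -
  obtain \<eta> where \<eta>: "\<eta> \<in> horizontal \<alpha> \<beta> x" "dcoord x \<eta> = dcoord x \<zeta>" "\<zeta> - \<eta> \<in> vertical x"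
    by (rule horizontal_part[OF assms])
  define \<nu> where "\<nu> = \<zeta> - \<eta>"
  have \<zeta>: "\<zeta> = \<eta> + \<nu>" by (simp add: \<nu>_def)
  have 0: "total_metric \<alpha> \<beta> x \<eta> \<nu> = 0"
    using metric_horizontal_vertical[OF \<eta>(1)] \<eta>(3) by (simp add: \<nu>_def)
  have "total_metric \<alpha> \<beta> x \<nu> \<nu> \<ge> 0"
    using metric_pos[OF domD(1)[OF assms(1)] vertical_tangent[OF domD(1)[OF assms(1)] \<eta>(3)]]
      linear_0[OF linear_total_metric, of \<alpha> \<beta> x] by (cases "\<nu> = 0") (auto simp: \<nu>_def)
  moreover have "total_metric \<alpha> \<beta> x \<zeta> \<zeta> = total_metric \<alpha> \<beta> x \<eta> \<eta> + total_metric \<alpha> \<beta> x \<nu> \<nu>"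
    unfolding \<zeta> using 0 total_metric_sym[of \<alpha> \<beta> x \<nu> \<eta>]
    by (simp add: linear_add[OF linear_total_metric] linear_add[OF linear_total_metric_left])
  moreover have "G (coord x) (dcoord x \<zeta>) (dcoord x \<zeta>) = total_metric \<alpha> \<beta> x \<eta> \<eta>"
    using G_horizontal[OF assms(1) \<eta>(1) horizontal_tangent[OF \<eta>(1)]] \<eta>(2) by simp
  ultimately show ?thesis by linarith
qed

lemma G_properties:
  assumes "v \<in> c ` W"
  shows linear_G: "linear (G v a)" and linear_G_left: "linear (\<lambda>a. G v a b)"
    and G_pos: "a \<noteq> 0 \<Longrightarrow> G v a a > 0"
proof -
  obtain x where x: "x \<in> dom" "coord x = v" using image_coord[OF assms] by blast
  have G: "G v a b = total_metric \<alpha> \<beta> x (hlift x a) (hlift x b)" for a b using G_eq[OF x(1)] x(2) by simp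
  note lin = linear_hlift[OF x(1)]
  show "linear (G v a)" unfolding G[abs_def]
    by (rule linear_compose[OF lin linear_total_metric, unfolded o_def])
  show "linear (\<lambda>a. G v a b)" unfolding G[abs_def]
    by (rule linear_compose[OF lin linear_total_metric_left, unfolded o_def])
  show "G v a a > 0" if "a \<noteq> 0"
  proof -
    have "hlift x a \<noteq> 0" using hlift(2)[OF x(1), of a] linear_0[OF linear_dcoord[OF x(1)]] that by metis
    then show ?thesis unfolding G
      by (rule metric_pos[OF domD(1)[OF x(1)] horizontal_tangent[OF hlift(1)[OF x(1)]]])
  qed
qed

text \<open>Along a section the lift of \<open>a\<close> is the derivative of the section minus
  \<open>vert (\<Omega> u) (s u)\<close>, and \<open>\<Omega> u\<close> solves a linear system whose
  coefficients are differentiable in \<open>u\<close>.\<close>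

lemma hlift_section_differentiable:
  assumes "is_section N s" "u \<in> N"
  shows "(\<lambda>u. hlift (s u) a) differentiable (at u)"
proof -
  note S = sectionD[OF assms(1)]
  define \<zeta> where "\<zeta> u = frechet_derivative s (at u) a" for u
  have C: "Ck_on (Suc (Suc 0)) N s" by (rule S(3))
  have ds: "s differentiable (at u)" and d\<zeta>: "\<zeta> differentiable (at u)"
    using C assms(2) unfolding \<zeta>_def[abs_def] Ck_on.simps by blast+
  have tot: "s u \<in> total_space" and hpd: "snd (s u) \<in> hpd" if "u \<in> N" for u
    using domD(1)[OF S(4)[OF that]] by (auto simp: total_space_def)
  have "\<exists>\<Omega>. vertical_operator \<alpha> (snd (s u)) \<Omega> = defect \<alpha> (s u) (\<zeta> u) \<and> hlift (s u) a = \<zeta> u - vert \<Omega> (s u)"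
    if u: "u \<in> N" for u
  proof -
    note d = section_derivative[OF assms(1) u, of a, folded \<zeta>_def]
    obtain \<Omega> where \<Omega>: "\<Omega>\<^sup>H = - \<Omega>" "vertical_operator \<alpha> (snd (s u)) \<Omega> = defect \<alpha> (s u) (\<zeta> u)"
      "\<zeta> u - vert \<Omega> (s u) \<in> horizontal \<alpha> \<beta> (s u)"
      by (rule horizontal_decomposition[OF \<alpha> tot[OF u] d(1)])
    have "vert \<Omega> (s u) \<in> vertical (s u)" using \<Omega>(1) by (auto simp: vertical_eq)
    then have "dcoord (s u) (\<zeta> u - vert \<Omega> (s u)) = a"
      by (simp add: linear_diff[OF linear_dcoord[OF S(4)[OF u]]] dcoord_vertical[OF S(4)[OF u]] d(2))
    from hlift_eqI[OF S(4)[OF u] \<Omega>(3) this] show ?thesis using \<Omega>(2) by blast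
  qed
  then obtain \<Omega> where \<Omega>: "\<And>u. u \<in> N \<Longrightarrow> vertical_operator \<alpha> (snd (s u)) (\<Omega> u) = defect \<alpha> (s u) (\<zeta> u)"
    "\<And>u. u \<in> N \<Longrightarrow> hlift (s u) a = \<zeta> u - vert (\<Omega> u) (s u)" by metis
  note D = differentiable_matrix_mult differentiable_diff differentiable_add differentiable_const
    differentiable_bounded_linear[OF bounded_linear_scaleR_right] differentiable_bounded_linear[OF bounded_linear_hconj]
  have d: "(\<lambda>u. fst (s u)) differentiable (at u)" "(\<lambda>u. snd (s u)) differentiable (at u)"
    "(\<lambda>u. fst (\<zeta> u)) differentiable (at u)" "(\<lambda>u. snd (\<zeta> u)) differentiable (at u)"
    using ds d\<zeta> by (auto intro: differentiable_bounded_linear bounded_linear_fst bounded_linear_snd)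
  have J: "(\<lambda>u. matrix_inv (snd (s u))) differentiable (at u)"
    by (rule differentiable_matrix_inv[OF S(1) assms(2) hpd d(2)])
  have "\<Omega> differentiable (at u)"
  proof (rule differentiable_linear_solve[OF S(1) assms(2), where A = "\<lambda>u. vertical_operator \<alpha> (snd (s u))"])
    show "linear (vertical_operator \<alpha> (snd (s w)))" for w by (rule linear_vertical_operator)
    show "(\<lambda>u. vertical_operator \<alpha> (snd (s u)) X) differentiable (at u)" for X
      unfolding vertical_operator_def by (intro D d J)
    show "X = 0" if "vertical_operator \<alpha> (snd (s u)) X = 0" for X
      by (rule vertical_operator_injective[OF \<alpha> hpd[OF assms(2)] that])
    show "(\<lambda>u. defect \<alpha> (s u) (\<zeta> u)) differentiable (at u)"
      unfolding defect_def by (intro D d J)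
  qed (rule \<Omega>(1))
  then obtain L where L: "((\<lambda>u. (\<zeta> u - (fst (s u) ** \<Omega> u, snd (s u) ** \<Omega> u - \<Omega> u ** snd (s u)))) has_derivative L) (at u)"
    using differentiable_diff[OF d\<zeta> differentiable_Pair[OF differentiable_matrix_mult[OF d(1)]
          differentiable_diff[OF differentiable_matrix_mult[OF d(2)] differentiable_matrix_mult[OF _ d(2)]]]]
    unfolding differentiable_def by blast
  have "((\<lambda>u. hlift (s u) a) has_derivative L) (at u)"
    by (rule has_derivative_transform_within_open[OF L S(1) assms(2)]) (simp add: \<Omega>(2) vert_def)
  then show ?thesis by (rule differentiableI)
qed

text \<open>Needed so that the \<open>frechet_derivative\<close> terms inside
  \<open>christoffel\<close> are genuine derivatives.\<close>

lemma G_differentiable: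
  assumes "v \<in> c ` W"
  shows "(\<lambda>u. G u a b) differentiable (at v)"
proof -
  obtain x where x: "x \<in> dom" "coord x = v" using image_coord[OF assms] by blast
  obtain N s where s: "is_section N s" "coord x \<in> N" "s (coord x) = x" by (rule section_through[OF x(1)])
  note S = sectionD[OF s(1)] and v = s(2)[unfolded x(2)]
  obtain A where A: "((\<lambda>u. hlift (s u) a) has_derivative A) (at v)"
    using hlift_section_differentiable[OF s(1) v] unfolding differentiable_def by blast
  obtain B where B: "((\<lambda>u. hlift (s u) b) has_derivative B) (at v)"
    using hlift_section_differentiable[OF s(1) v] unfolding differentiable_def by blast
  have tot: "s u \<in> total_space" if "u \<in> N" for u using domD(1)[OF S(4)[OF that]] .
  note m = total_metric_has_derivative[OF S(1) v tot section_has_derivative[OF s(1) v] A B, of \<alpha> \<beta>]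
  have G: "G u a b = total_metric \<alpha> \<beta> (s u) (hlift (s u) a) (hlift (s u) b)" if "u \<in> N" for u
    using G_eq[OF S(4)[OF that]] S(5)[OF that] by simp
  from has_derivative_transform_within_open[OF m S(1) v, of "\<lambda>u. G u a b"] G
  show ?thesis by (auto intro: differentiableI)
qed

end

section \<open>Horizontal geodesics descend\<close>

lemma has_real_derivative_of_has_derivative:
  assumes "(f has_derivative F) (at t)"
  shows "(f has_real_derivative F 1) (at t)"
proof -
  have "F = (*) (F 1)"
  proof
    show "F h = F 1 * h" for h
      using linear_cmul[OF has_derivative_linear[OF assms], of h 1] by (simp add: mult.commute)
  qed
  then show ?thesis using assms by (simp add: has_field_derivative_def)
qed

text \<open>Here \<open>x''\<close> is the acceleration in the ambient vector space and may leave
  the tangent space; \<open>geodesic\<close> is the Euler-Lagrange equation tested against tangent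
  vectors.\<close>

locale horizontal_geodesic = quotient_chart \<alpha> \<beta> W c
  for \<alpha> \<beta> :: real
    and W :: "('p::finite, 'k::finite) pt set set"
    and c :: "('p, 'k) pt set \<Rightarrow> 'e::euclidean_space" +
  fixes x x' x'' :: "real \<Rightarrow> ('p, 'k) pt"
  assumes smooth: "Ck_on n UNIV x"
    and total: "x t \<in> total_space"
    and x': "(x has_vector_derivative x' t) (at t)"
    and x'': "(x' has_vector_derivative x'' t) (at t)"
    and horizontal: "x' t \<in> horizontal \<alpha> \<beta> (x t)"
    and geodesic: "z \<in> tangent (x t) \<Longrightarrow>
      total_metric \<alpha> \<beta> (x t) (x'' t) z + metric_derivative \<alpha> \<beta> (x t) (x' t) (x' t) z
      = 1/2 * metric_derivative \<alpha> \<beta> (x t) z (x' t) (x' t)"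
begin

definition T :: "real set" where "T = {t. orbit (x t) \<in> W}"

definition u :: "real \<Rightarrow> 'e" where "u t = coord (x t)"

definition u' :: "real \<Rightarrow> 'e" where "u' t = dcoord (x t) (x' t)"

lemma T_dom: "t \<in> T \<longleftrightarrow> x t \<in> dom"
  by (simp add: T_def dom_def total)

lemma continuous_x: "continuous_on UNIV x"
  using Ck_on_continuous[OF smooth] .

lemma open_T: "open T"
proof -
  obtain B where B: "open B" "dom = total_space \<inter> B" using dom_openin by (auto simp: openin_open)
  have "T = x -` B" by (intro set_eqI) (simp add: T_dom B(2) total)
  then show ?thesis using open_vimage[OF B(1) continuous_x] by simp
qed

lemma Ck_on_u: "Ck_on n T u"
proof (rule Ck_on_local)
  fix t assume "t \<in> T"
  then have "x t \<in> dom" by (simp add: T_dom)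
  then obtain N F where N: "open N" "x t \<in> N" "smooth_on N F" "N \<inter> total_space \<subseteq> dom"
    "\<And>y. y \<in> N \<inter> total_space \<Longrightarrow> F y = coord y" by (rule coord_extension) blast
  have o: "open (x -` N)" by (rule open_vimage[OF N(1) continuous_x])
  have "Ck_on n (x -` N) (\<lambda>t. F (x t))"
    by (rule Ck_on_compose[OF o N(1) Ck_on_subset[OF smooth]]) (use N(3) in \<open>auto simp: smooth_on_def\<close>)
  then have "Ck_on n (x -` N) u"
    by (rule Ck_on_cong[OF o, rotated]) (use N(5) total in \<open>simp add: u_def\<close>)
  then show "\<exists>N. open N \<and> t \<in> N \<and> Ck_on n N u" using o N(2) by blast
qed

lemma u_has_derivative:
  assumes "t \<in> T"
  shows "(u has_vector_derivative u' t) (at t)"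
proof -
  have d: "x t \<in> dom" using assms by (simp add: T_dom)
  have "((\<lambda>t. coord (x t)) has_derivative (\<lambda>h. dcoord (x t) (h *\<^sub>R x' t))) (at t)"
    by (rule coord_chain[OF open_UNIV UNIV_I _ d x'[unfolded has_vector_derivative_def]]) (use total in blast)
  then show ?thesis
    by (simp add: has_vector_derivative_def u_def[abs_def] u'_def linear_cmul[OF linear_dcoord[OF d]])
qed

lemma u'_has_derivative:
  assumes "t \<in> T"
  obtains a where "(u' has_vector_derivative a) (at t)"
proof -
  let ?d = "\<lambda>s. frechet_derivative u (at s) 1"
  have "Ck_on (Suc (Suc 0)) T u" by (rule Ck_on_u)
  then have "?d differentiable (at t)" using assms unfolding Ck_on.simps by blast
  then have "(?d has_vector_derivative vector_derivative ?d (at t)) (at t)"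
    by (rule vector_derivative_works[THEN iffD1])
  moreover have "?d s = u' s" if "s \<in> T" for s
    using fun_cong[OF frechet_derivative_at[OF u_has_derivative[OF that, unfolded has_vector_derivative_def]], of 1]
    by simp
  ultimately have "(u' has_vector_derivative vector_derivative ?d (at t)) (at t)"
    by (rule has_vector_derivative_transform_within_open[OF _ open_T assms])
  then show thesis by (rule that)
qed

text \<open>A section lifts \<open>u t + \<epsilon> w\<close>, but at \<open>\<epsilon> = 0\<close>
  it yields \<open>s (u t)\<close>, which agrees with \<open>x t\<close> only up to a unitary
  \<open>V t\<close>. Acting with \<open>V t\<close> for all \<open>\<epsilon>\<close> keeps the
  coordinates and makes the lift extend the given curve.\<close>

lemma variation:
  assumes "t0 \<in> T"
  obtains P T' Y where "open P" "(0, t0) \<in> P" "open T'" "t0 \<in> T'" "T' \<subseteq> T" "\<And>t. t \<in> T' \<Longrightarrow> (0, t) \<in> P"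
    "\<And>q. q \<in> P \<Longrightarrow> snd q \<in> T'" "\<And>n. Ck_on n P Y" "\<And>q. q \<in> P \<Longrightarrow> Y q \<in> dom"
    "\<And>q. q \<in> P \<Longrightarrow> coord (Y q) = u (snd q) + fst q *\<^sub>R w" "\<And>t. t \<in> T' \<Longrightarrow> Y (0, t) = x t"
proof -
  have x0: "x t0 \<in> dom" using assms by (simp add: T_dom)
  obtain N s where s: "is_section N s" "coord (x t0) \<in> N" "s (coord (x t0)) = x t0" by (rule section_through[OF x0])
  note S = sectionD[OF s(1)]
  define T' where "T' = T \<inter> u -` N"
  have T': "open T'" unfolding T'_def
    by (rule continuous_open_preimage[OF Ck_on_continuous[OF Ck_on_u] open_T S(1)])
  have t0: "t0 \<in> T'" using assms s(2) by (simp add: T'_def u_def)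
  define B where "B = (UNIV :: real set) \<times> T'"
  have B: "open B" by (simp add: B_def open_Times T')
  have sndC: "Ck_on n B snd" and fstC: "Ck_on n B fst" for n
    using Ck_on_linear[OF B bounded_linear_snd Ck_on_id] Ck_on_linear[OF B bounded_linear_fst Ck_on_id] by simp_all
  have uB: "Ck_on n B (\<lambda>q. u (snd q))" for n
    by (rule Ck_on_compose[OF B T' sndC Ck_on_subset[OF Ck_on_u]]) (auto simp: T'_def B_def)
  have lin: "Ck_on n B (\<lambda>q. u (snd q) + fst q *\<^sub>R w)" for n
    by (intro Ck_on_add[OF B] uB Ck_on_linear[OF B bounded_linear_scaleR_left] fstC)
  define P where "P = B \<inter> (\<lambda>q. u (snd q) + fst q *\<^sub>R w) -` N"
  have P: "open P" unfolding P_def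
    by (rule continuous_open_preimage[OF Ck_on_continuous[OF lin] B S(1)])
  have PB: "P \<subseteq> B" by (auto simp: P_def)
  define V where "V t = (fst (s (u t)))\<^sup>H ** fst (x t)" for t
  have V: "V t \<in> unitary" "x t = act (V t) (s (u t))" if "t \<in> T'" for t
  proof -
    have d: "s (u t) \<in> dom" "coord (s (u t)) = coord (x t)" "x t \<in> dom"
      using S(4,5) that by (auto simp: T'_def T_dom u_def)
    from orbit_eq_unitary[OF coord_eq_orbit[OF d(1,3,2)] domD(1)[OF d(1)]]
    show "V t \<in> unitary" "x t = act (V t) (s (u t))" by (auto simp: V_def)
  qed
  define Y where "Y q = act (V (snd q)) (s (u (snd q) + fst q *\<^sub>R w))" for q
  have sC: "Ck_on n P (\<lambda>q. s (u (snd q) + fst q *\<^sub>R w))" for n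
    by (rule Ck_on_compose[OF P S(1) Ck_on_subset[OF lin PB] S(3)]) (auto simp: P_def)
  have suC: "Ck_on n P (\<lambda>q. s (u (snd q)))" for n
    by (rule Ck_on_compose[OF P S(1) Ck_on_subset[OF uB PB] S(3)]) (auto simp: P_def B_def T'_def)
  have xC: "Ck_on n P (\<lambda>q. x (snd q))" for n
    by (rule Ck_on_compose[OF P open_UNIV Ck_on_subset[OF sndC PB] smooth]) simp
  note C = Ck_on_bilinear[OF P bounded_bilinear_matrix_mult] Ck_on_linear[OF P bounded_linear_hconj]
    Ck_on_linear[OF P bounded_linear_fst] Ck_on_linear[OF P bounded_linear_snd]
  have VC: "Ck_on n P (\<lambda>q. V (snd q))" for n
    unfolding V_def by (intro C suC xC)
  have YC: "Ck_on n P Y" for n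
    unfolding Y_def[abs_def] act_eq by (intro Ck_on_Pair[OF P] C sC VC)
  have Yd: "Y q \<in> dom" "coord (Y q) = u (snd q) + fst q *\<^sub>R w" if "q \<in> P" for q
  proof -
    have q: "snd q \<in> T'" "u (snd q) + fst q *\<^sub>R w \<in> N" using that by (auto simp: P_def B_def)
    show "Y q \<in> dom" unfolding Y_def by (rule act_dom[OF V(1)[OF q(1)] S(4)[OF q(2)]])
    show "coord (Y q) = u (snd q) + fst q *\<^sub>R w"
      unfolding Y_def coord_act[OF V(1)[OF q(1)]] by (rule S(5)[OF q(2)])
  qed
  show thesis
  proof (rule that[OF P _ T' t0 _ _ _ YC Yd])
    show "Y (0, t) = x t" if "t \<in> T'" for t using V(2)[OF that] by (simp add: Y_def)
  qed (use t0 in \<open>auto simp: P_def B_def T'_def\<close>)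
qed

text \<open>Comparing \<open>G\<close> with the metric of the total space along the lifted variation \<open>Y (\<epsilon>, t)\<close> of
  \<open>u t + \<epsilon> w\<close> avoids differentiating horizontal lifts: \<open>\<partial>\<^sub>tY\<close> is horizontal only for \<open>\<epsilon> = 0\<close>, but
  its squared length dominates that of its projection, with equality there, so the two lengths
  have the same derivative in \<open>\<epsilon>\<close> at \<open>0\<close>.\<close>

lemma euler_lagrange:
  assumes t0: "t0 \<in> T"
  shows "((\<lambda>t. G (u t) (u' t) w) has_real_derivative
    1/2 * frechet_derivative (\<lambda>v. G v (u' t0) (u' t0)) (at (u t0)) w) (at t0)"
proof -
  obtain P T' Y where P: "open P" "(0, t0) \<in> P" and T': "open T'" "t0 \<in> T'" "T' \<subseteq> T" "\<And>t. t \<in> T' \<Longrightarrow> (0, t) \<in> P"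
    "\<And>q. q \<in> P \<Longrightarrow> snd q \<in> T'" and C: "\<And>n. Ck_on n P Y" and Yd: "\<And>q. q \<in> P \<Longrightarrow> Y q \<in> dom"
    and cY: "\<And>q. q \<in> P \<Longrightarrow> coord (Y q) = u (snd q) + fst q *\<^sub>R w" and Y0: "\<And>t. t \<in> T' \<Longrightarrow> Y (0, t) = x t"
    by (rule variation[OF t0, of w]) blast
  define DY where "DY v q = frechet_derivative Y (at q) v" for v q
  have dY: "(Y has_derivative (\<lambda>v. DY v q)) (at q)" if "q \<in> P" for q
    unfolding DY_def by (rule Ck_on_has_derivative[OF C[of "Suc 0"] that])
  have dDY: "(DY v has_derivative frechet_derivative (DY v) (at q)) (at q)" if "q \<in> P" for q v
  proof -
    have "Ck_on (Suc (Suc 0)) P Y" by (rule C)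
    then have "Ck_on (Suc 0) P (DY v)" unfolding DY_def[abs_def] Ck_on.simps by blast
    then show ?thesis by (rule Ck_on_has_derivative[OF _ that])
  qed
  have YP: "Y ` P \<subseteq> total_space" using Yd domD(1) by blast
  have tan: "DY v q \<in> tangent (Y q)" if "q \<in> P" for q v
    by (rule velocity_tangent[OF P(1) that YP dY[OF that]])
  have dcY: "dcoord (Y q) (DY v q) = snd v *\<^sub>R u' (snd q) + fst v *\<^sub>R w" if q: "q \<in> P" for q v
  proof -
    have "((\<lambda>q. coord (Y q)) has_derivative (\<lambda>v. dcoord (Y q) (DY v q))) (at q)"
      by (rule coord_chain[OF P(1) q YP Yd[OF q] dY[OF q]])
    moreover have "(u has_derivative (\<lambda>h. h *\<^sub>R u' (snd q))) (at (snd q))"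
      by (rule u_has_derivative[OF subsetD[OF T'(3) T'(5)[OF q]], unfolded has_vector_derivative_def])
    from diff_chain_at[OF bounded_linear_imp_has_derivative[OF bounded_linear_snd] this]
    have 1: "((\<lambda>q. u (snd q)) has_derivative (\<lambda>v. snd v *\<^sub>R u' (snd q))) (at q)"
      by (simp add: o_def)
    have 2: "((\<lambda>q. fst q *\<^sub>R w) has_derivative (\<lambda>v. fst v *\<^sub>R w)) (at q)"
      by (rule bounded_linear_imp_has_derivative[OF bounded_linear_compose[OF bounded_linear_scaleR_left bounded_linear_fst]])
    from has_derivative_add[OF 1 2] have "((\<lambda>q. coord (Y q)) has_derivative (\<lambda>v. snd v *\<^sub>R u' (snd q) + fst v *\<^sub>R w)) (at q)"
      by (rule has_derivative_transform_within_open[OF _ P(1) q]) (simp add: cY del: o_apply)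
    ultimately show ?thesis by (rule fun_cong[OF has_derivative_unique])
  qed
  let ?q = "(0, t0) :: real \<times> real"
  have along_t: "((\<lambda>t. f (0, t)) has_derivative (\<lambda>h. h *\<^sub>R f' (0, 1))) (at t)"
    and along_e: "((\<lambda>e. f (e, t)) has_derivative (\<lambda>h. h *\<^sub>R f' (1, 0))) (at 0)"
    if f: "(f has_derivative f') (at (0, t))" for f :: "real \<times> real \<Rightarrow> ('p, 'k) pt" and f' t
  proof -
    have lin: "(\<lambda>h. f' (h *\<^sub>R v)) = (\<lambda>h. h *\<^sub>R f' v)" for v
      by (rule ext) (rule linear_cmul[OF has_derivative_linear[OF f]])
    have "((\<lambda>t. (0::real, t)) has_derivative (\<lambda>h. (0, h))) (at t)" "((\<lambda>e. (e, t)) has_derivative (\<lambda>h. (h, 0))) (at 0)"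
      by (rule has_derivative_Pair[OF has_derivative_const has_derivative_ident],
          rule has_derivative_Pair[OF has_derivative_ident has_derivative_const])
    from diff_chain_at[OF this(1) f] diff_chain_at[OF this(2) f]
    show "((\<lambda>t. f (0, t)) has_derivative (\<lambda>h. h *\<^sub>R f' (0, 1))) (at t)"
      "((\<lambda>e. f (e, t)) has_derivative (\<lambda>h. h *\<^sub>R f' (1, 0))) (at 0)"
      using lin[of "(0, 1)"] lin[of "(1, 0)"] by (simp_all only: o_def scaleR_Pair real_scaleR_def mult_zero_right mult_1_right)
  qed
  have Yt: "DY (0, 1) (0, t) = x' t" if t: "t \<in> T'" for t
  proof -
    have "(x has_vector_derivative DY (0, 1) (0, t)) (at t)"
      unfolding has_vector_derivative_def
      by (rule has_derivative_transform_within_open[OF along_t[OF dY[OF T'(4)[OF t]]] T'(1) t]) (simp add: Y0)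
    from vector_derivative_unique_at[OF this x'] show ?thesis .
  qed
  define z where "z = DY (1, 0) ?q"
  define z' where "z' = frechet_derivative (DY (1, 0)) (at ?q) (0, 1)"
  \<comment> \<open>Exchanging the partial derivatives identifies the
    \<open>\<epsilon>\<close>-derivative of the velocity with the time derivative of the variation
    field, so both computations below share the term containing \<open>z'\<close>.\<close>
  have mixed: "frechet_derivative (DY (0, 1)) (at ?q) (1, 0) = z'"
    using mixed_partials[OF P C[of 2]] unfolding z'_def DY_def[abs_def] by simp
  have z: "z \<in> tangent (x t0)" using tan[OF P(2), of "(1, 0)"] Y0[OF T'(2)] by (simp add: z_def)
  define m :: "('p, 'k) pt \<Rightarrow> ('p, 'k) pt \<Rightarrow> ('p, 'k) pt \<Rightarrow> real" where "m = total_metric \<alpha> \<beta>"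
  define dm :: "('p, 'k) pt \<Rightarrow> ('p, 'k) pt \<Rightarrow> ('p, 'k) pt \<Rightarrow> ('p, 'k) pt \<Rightarrow> real" where "dm = metric_derivative \<alpha> \<beta>"
  note xt = x'[unfolded has_vector_derivative_def] and xt' = x''[unfolded has_vector_derivative_def]
  have f: "((\<lambda>t. m (x t) (x' t) (DY (1, 0) (0, t))) has_real_derivative
      m (x t0) (x'' t0) z + m (x t0) (x' t0) z' + dm (x t0) (x' t0) (x' t0) z) (at t0)"
    using has_real_derivative_of_has_derivative[OF total_metric_has_derivative[OF open_UNIV UNIV_I total xt xt'
          along_t[OF dDY[OF P(2)]], of \<alpha> \<beta> "(1, 0)"]]
    by (simp add: z_def z'_def m_def dm_def)
  have "m (x t) (x' t) (DY (1, 0) (0, t)) = G (u t) (u' t) w" if t: "t \<in> T'" for t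
  proof -
    have d: "x t \<in> dom" using t T'(3) by (auto simp: T_dom)
    show ?thesis
      using G_horizontal[OF d horizontal tan[OF T'(4)[OF t], of "(1, 0)", unfolded Y0[OF t]]]
        dcY[OF T'(4)[OF t], of "(1, 0)"] by (simp add: Y0[OF t] u_def u'_def m_def)
  qed
  from has_field_derivative_transform_within_open[OF f T'(1,2) this]
  have LHS: "((\<lambda>t. G (u t) (u' t) w) has_real_derivative
      m (x t0) (x'' t0) z + m (x t0) (x' t0) z' + dm (x t0) (x' t0) (x' t0) z) (at t0)" .
  define a where "a = u' t0"
  define P' where "P' = (\<lambda>e. (e, t0)) -` P"
  have P': "open P'" unfolding P'_def by (rule open_vimage[OF P(1)]) (intro continuous_intros)
  have P'0: "0 \<in> P'" using P(2) by (simp add: P'_def)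
  have eP: "(e, t0) \<in> P" if "e \<in> P'" for e using that by (simp add: P'_def)
  have tot: "Y (e, t0) \<in> total_space" if "e \<in> P'" for e using domD(1)[OF Yd[OF eP[OF that]]] .
  have h: "((\<lambda>e. m (Y (e, t0)) (DY (0, 1) (e, t0)) (DY (0, 1) (e, t0))) has_real_derivative
      m (x t0) z' (x' t0) + m (x t0) (x' t0) z' + dm (x t0) z (x' t0) (x' t0)) (at 0)"
    using has_real_derivative_of_has_derivative[OF total_metric_has_derivative[OF P' P'0 tot along_e[OF dY[OF P(2)]]
          along_e[OF dDY[OF P(2)]] along_e[OF dDY[OF P(2)]], of \<alpha> \<beta> "(0, 1)" "(0, 1)"]]
    by (simp add: mixed Y0[OF T'(2)] Yt[OF T'(2)] z_def m_def dm_def)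
  have u0: "u t0 \<in> c ` W" using coord_image t0 by (simp add: T_dom u_def)
  define g where "g v = G v a a" for v
  have dg: "(g has_derivative frechet_derivative g (at (u t0))) (at (u t0))"
    unfolding g_def[abs_def] frechet_derivative_works[symmetric] by (rule G_differentiable[OF u0])
  have "((\<lambda>e. u t0 + e *\<^sub>R w) has_derivative (\<lambda>h. h *\<^sub>R w)) (at 0)"
    by (auto intro!: derivative_eq_intros)
  from diff_chain_at[OF this, of g "frechet_derivative g (at (u t0))"] dg
  have "((\<lambda>e. g (u t0 + e *\<^sub>R w)) has_derivative (\<lambda>h. frechet_derivative g (at (u t0)) (h *\<^sub>R w))) (at 0)"
    by (simp add: o_def)
  from has_real_derivative_of_has_derivative[OF this]
  have k: "((\<lambda>e. g (u t0 + e *\<^sub>R w)) has_real_derivative frechet_derivative g (at (u t0)) w) (at 0)" by simp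
  \<comment> \<open>The variation adds a multiple of the fixed vector \<open>w\<close>, so its
    coordinate velocity at time \<open>t0\<close> is \<open>a\<close> for every
    \<open>e\<close>.\<close>
  have le: "g (u t0 + e *\<^sub>R w) \<le> m (Y (e, t0)) (DY (0, 1) (e, t0)) (DY (0, 1) (e, t0))" if "e \<in> P'" for e
    using G_le[OF Yd[OF eP[OF that]] tan[OF eP[OF that], of "(0, 1)"]] cY[OF eP[OF that]] dcY[OF eP[OF that], of "(0, 1)"]
    by (simp add: g_def a_def m_def)
  have eq: "g (u t0) = m (x t0) (x' t0) (x' t0)"
    using G_horizontal[OF _ horizontal horizontal_tangent[OF horizontal], of t0] t0
    by (simp add: T_dom g_def a_def m_def u_def u'_def)
  \<comment> \<open>The squared vertical length of the lifted velocity: nonnegative, and 0 at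
    \<open>e = 0\<close>, so its derivative there vanishes.\<close>
  define H where "H e = m (Y (e, t0)) (DY (0, 1) (e, t0)) (DY (0, 1) (e, t0)) - g (u t0 + e *\<^sub>R w)" for e
  have dH: "(H has_real_derivative (m (x t0) z' (x' t0) + m (x t0) (x' t0) z' + dm (x t0) z (x' t0) (x' t0))
      - frechet_derivative g (at (u t0)) w) (at 0)"
    unfolding H_def[abs_def] by (rule DERIV_diff[OF h k])
  obtain r where r: "r > 0" "ball 0 r \<subseteq> P'" using P' P'0 open_contains_ball by blast
  have "\<forall>y. \<bar>0 - y\<bar> < r \<longrightarrow> H 0 \<le> H y"
  proof (intro allI impI)
    fix y :: real assume "\<bar>0 - y\<bar> < r"
    then have "y \<in> P'" using r(2) by (auto simp: dist_real_def subset_iff)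
    moreover have "H 0 = 0" by (simp add: H_def eq Y0[OF T'(2)] Yt[OF T'(2)])
    ultimately show "H 0 \<le> H y" using le[of y] by (simp add: H_def)
  qed
  from DERIV_local_min[OF dH r(1) this]
  have "(m (x t0) z' (x' t0) + m (x t0) (x' t0) z' + dm (x t0) z (x' t0) (x' t0))
      - frechet_derivative g (at (u t0)) w = 0" .
  moreover have "m (x t0) z' (x' t0) = m (x t0) (x' t0) z'" unfolding m_def by (rule total_metric_sym)
  moreover have "m (x t0) (x'' t0) z + dm (x t0) (x' t0) (x' t0) z = 1/2 * dm (x t0) z (x' t0) (x' t0)"
    unfolding m_def dm_def by (rule geodesic[OF z])
  \<comment> \<open>The vanishing derivative of \<open>H\<close> gives
    \<open>m (x t0) (x' t0) z'\<close> plus half of the \<open>dm\<close> term in direction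
    \<open>z\<close> as half the derivative of \<open>g\<close>; the geodesic equation supplies that
    half.\<close>
  ultimately have "m (x t0) (x'' t0) z + m (x t0) (x' t0) z' + dm (x t0) (x' t0) (x' t0) z
      = 1/2 * frechet_derivative g (at (u t0)) w" by linarith
  with LHS show ?thesis by (simp add: g_def[abs_def] a_def)
qed

text \<open>Expanding the time derivative in the Euler-Lagrange equation by the product rule yields
  Koszul's formula with two equal arguments, solved by minus the coordinate acceleration.\<close>

lemma covariant_acceleration:
  assumes t0: "t0 \<in> T"
  defines "v \<equiv> \<lambda>s. vector_derivative u (at s)"
  shows "vector_derivative v (at t0) + christoffel G (u t0) (v t0) (v t0) = 0"
proof -
  obtain a' where a': "(u' has_vector_derivative a') (at t0)" by (rule u'_has_derivative[OF t0])
  define a where "a = u' t0"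
  have vu: "v s = u' s" if "s \<in> T" for s
    unfolding v_def by (rule vector_derivative_at[OF u_has_derivative[OF that]])
  have "(v has_vector_derivative a') (at t0)"
    by (rule has_vector_derivative_transform_within_open[OF a' open_T t0]) (simp add: vu)
  then have acc: "vector_derivative v (at t0) = a'" by (rule vector_derivative_at)
  have u0: "u t0 \<in> c ` W" using coord_image t0 by (simp add: T_dom u_def)
  let ?D = "\<lambda>b w h. frechet_derivative (\<lambda>v. G v b w) (at (u t0)) h"
  have dG: "((\<lambda>v. G v b w) has_derivative ?D b w) (at (u t0))" for b w
    unfolding frechet_derivative_works[symmetric] by (rule G_differentiable[OF u0])
  have dGu: "((\<lambda>t. G (u t) b w) has_real_derivative ?D b w a) (at t0)" for b w
    using has_real_derivative_of_has_derivative[OF diff_chain_at[OF u_has_derivative[OF t0, unfolded has_vector_derivative_def] dG[of b w]]]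
    by (simp add: o_def a_def)
  have koszul: "G (u t0) a' w = 1/2 * ?D a a w - ?D a w a" for w
  proof -
    have coef: "((\<lambda>t. (u' t - a) \<bullet> b) has_real_derivative a' \<bullet> b) (at t0)" for b
      using bounded_linear.has_vector_derivative[OF bounded_linear_inner_left has_vector_derivative_diff[OF a' has_vector_derivative_const]]
      by (simp add: has_real_derivative_iff_has_vector_derivative)
    \<comment> \<open>Differentiability of \<open>G\<close> is available only for constant
      arguments, so \<open>u' t\<close> is split into \<open>a\<close> and a basis expansion of
      \<open>u' t - a\<close>. The coefficients of the latter vanish at \<open>t0\<close>, so there
      only their derivatives contribute.\<close>
    have "((\<lambda>t. (\<Sum>b\<in>Basis. ((u' t - a) \<bullet> b) * G (u t) b w) + G (u t) a w) has_real_derivative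
        (\<Sum>b\<in>Basis. (u' t0 - a) \<bullet> b * ?D b w a + a' \<bullet> b * G (u t0) b w) + ?D a w a) (at t0)"
      by (intro DERIV_add DERIV_sum DERIV_mult' coef dGu)
    moreover have expand: "(\<Sum>b\<in>Basis. (y \<bullet> b) * G (u t) b w) = G (u t) y w" if "t \<in> T" for t y
    proof -
      have ut: "u t \<in> c ` W" using coord_image that by (simp add: T_dom u_def)
      have "G (u t) (\<Sum>b\<in>Basis. (y \<bullet> b) *\<^sub>R b) w = (\<Sum>b\<in>Basis. (y \<bullet> b) * G (u t) b w)"
        by (simp add: linear_sum[OF linear_G_left[OF ut]] linear_cmul[OF linear_G_left[OF ut]])
      then show ?thesis by (simp only: euclidean_representation)
    qed
    ultimately have "((\<lambda>t. (\<Sum>b\<in>Basis. ((u' t - a) \<bullet> b) * G (u t) b w) + G (u t) a w) has_real_derivative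
        G (u t0) a' w + ?D a w a) (at t0)"
      using expand[OF t0] by (simp add: a_def)
    moreover have "(\<Sum>b\<in>Basis. ((u' t - a) \<bullet> b) * G (u t) b w) + G (u t) a w = G (u t) (u' t) w" if "t \<in> T" for t
    proof -
      have ut: "u t \<in> c ` W" using coord_image that by (simp add: T_dom u_def)
      show ?thesis unfolding expand[OF that] by (simp add: linear_diff[OF linear_G_left[OF ut]])
    qed
    ultimately have "((\<lambda>t. G (u t) (u' t) w) has_real_derivative G (u t0) a' w + ?D a w a) (at t0)"
      by (rule has_field_derivative_transform_within_open[OF _ open_T t0])
    from DERIV_unique[OF this euler_lagrange[OF t0, of w]] show ?thesis by (simp add: a_def)
  qed
  have "christoffel G (u t0) a a = - a'"
    unfolding christoffel_def
  proof (rule the_equality)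
    show "\<forall>w. G (u t0) (- a') w = (?D a w a + ?D a w a - ?D a a w) / 2"
      using koszul by (simp add: linear_neg[OF linear_G_left[OF u0]])
  next
    fix y assume y: "\<forall>w. G (u t0) y w = (?D a w a + ?D a w a - ?D a a w) / 2"
    have "r + s = 0" if "r = (p + p - q) / 2" "s = 1/2 * q - p" for r s p q :: real
      using that by (simp add: field_simps)
    \<comment> \<open>So \<open>y + a'\<close> is orthogonal to every vector, and positivity forces
      it to be 0.\<close>
    from this[OF spec[OF y] koszul] have "G (u t0) (y + a') w = 0" for w
      by (simp only: linear_add[OF linear_G_left[OF u0]])
    then have "y + a' = 0" using G_pos[OF u0, of "y + a'"] by fastforce
    then show "y = - a'" by (simp add: eq_neg_iff_add_eq_0)
  qed
  then show ?thesis by (simp add: acc vu[OF t0] a_def[symmetric])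
qed

end

text \<open>The hypotheses mention no chart, so the locale can be interpreted separately in every
  chart of the atlas.\<close>

lemma represents_geodesicI:
  fixes x x' x'' :: "real \<Rightarrow> ('p::finite, 'k::finite) pt"
  assumes \<alpha>: "\<alpha> > 0" and \<beta>: "\<beta> > - \<alpha> / real CARD('k)"
    and smooth: "\<And>n. Ck_on n UNIV x"
    and total: "\<And>t. x t \<in> total_space"
    and x': "\<And>t. (x has_vector_derivative x' t) (at t)"
    and x'': "\<And>t. (x' has_vector_derivative x'' t) (at t)"
    and horizontal: "\<And>t. x' t \<in> horizontal \<alpha> \<beta> (x t)"
    and geodesic: "\<And>t z. z \<in> tangent (x t) \<Longrightarrow>
      total_metric \<alpha> \<beta> (x t) (x'' t) z + metric_derivative \<alpha> \<beta> (x t) (x' t) (x' t) z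
      = 1/2 * metric_derivative \<alpha> \<beta> (x t) z (x' t) (x' t)"
  shows "represents_geodesic \<alpha> \<beta> x (orbit (x 0))
    (proj_differential total_space orbit (x 0) (x' 0) :: (('p, 'k) pt set, 'e::euclidean_space) chart \<Rightarrow> 'e)"
proof -
  let ?A = "quotient_atlas total_space orbit :: (('p, 'k) pt set, 'e) chart set"
  have loc: "horizontal_geodesic \<alpha> \<beta> W c x x' x''" if "(W, c) \<in> ?A" for W c
    using that assms by unfold_locales auto
  have "is_geodesic ?A (quotient_metric \<alpha> \<beta>) (orbit \<circ> x)"
    unfolding is_geodesic_def
  proof (intro ballI, clarify)
    fix W and c :: "('p, 'k) pt set \<Rightarrow> 'e" assume "(W, c) \<in> ?A"
    then interpret horizontal_geodesic \<alpha> \<beta> W c x x' x'' by (rule loc)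
    have u: "c \<circ> (orbit \<circ> x) = u" by (simp add: fun_eq_iff u_def)
    have T: "{t. (orbit \<circ> x) t \<in> W} = T" by (simp add: T_def)
    show "open {t. (orbit \<circ> x) t \<in> W} \<and> smooth_on {t. (orbit \<circ> x) t \<in> W} (c \<circ> (orbit \<circ> x)) \<and>
      (\<forall>t. (orbit \<circ> x) t \<in> W \<longrightarrow> (let v = \<lambda>s. vector_derivative (c \<circ> (orbit \<circ> x)) (at s)
        in vector_derivative v (at t) + christoffel (quotient_metric \<alpha> \<beta> (W, c)) (c ((orbit \<circ> x) t)) (v t) (v t) = 0))"
      unfolding u T Let_def
      using open_T Ck_on_u covariant_acceleration by (auto simp: smooth_on_def T_def u_def)
  qed
  moreover have "velocity ?A (orbit \<circ> x) 0 = proj_differential total_space orbit (x 0) (x' 0)"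
  proof (intro ext, clarify)
    fix W and c :: "('p, 'k) pt set \<Rightarrow> 'e"
    show "velocity ?A (orbit \<circ> x) 0 (W, c) = proj_differential total_space orbit (x 0) (x' 0) (W, c)"
    proof (cases "(W, c) \<in> ?A \<and> orbit (x 0) \<in> W")
      case True
      then interpret horizontal_geodesic \<alpha> \<beta> W c x x' x'' using loc by blast
      have u: "c \<circ> (orbit \<circ> x) = u" by (simp add: fun_eq_iff u_def)
      have "0 \<in> T" using True by (simp add: T_def)
      then have "vector_derivative u (at 0) = dcoord (x 0) (x' 0)"
        using vector_derivative_at[OF u_has_derivative] by (simp add: u'_def)
      then show ?thesis using True by (simp add: velocity_def proj_differential_def u dcoord_def)
    next
      \<comment> \<open>Both families of coordinate vectors take the default value 0 here.\<close>
      case False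
      then show ?thesis by (auto simp: velocity_def proj_differential_def)
    qed
  qed
  ultimately show ?thesis using total by (simp add: represents_geodesic_def)
qed

section \<open>The explicit geodesics\<close>

text \<open>The number of columns of \<open>Q\<close> is left free so that one argument covers the
  thin QR factor, with \<open>k\<close> columns, and an orthonormal complement of \<open>U\<close>,
  with \<open>p - k\<close> columns.\<close>

lemma explicit_geodesic:
  fixes U \<xi>U :: "complex^'k::finite^'p::finite" and Q :: "complex^'q::finite^'p" and R :: "complex^'k^'q"
  assumes \<alpha>: "\<alpha> > 0" and \<beta>: "\<beta> > - \<alpha> / real CARD('k)"
    and tot: "(U, \<Sigma>) \<in> total_space" and hor: "(\<xi>U, \<xi>\<Sigma>) \<in> horizontal \<alpha> \<beta> (U, \<Sigma>)"
    and Q: "Q \<in> stiefel" "Q ** R = (mat 1 - U ** U\<^sup>H) ** \<xi>U"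
  shows "represents_geodesic \<alpha> \<beta>
      (\<lambda>t. (stiefel_curve U Q (U\<^sup>H ** \<xi>U) R t, hpd_curve \<Sigma> \<xi>\<Sigma> t)) (orbit (U, \<Sigma>))
      (proj_differential total_space orbit (U, \<Sigma>) (\<xi>U, \<xi>\<Sigma>) :: (('p, 'k) pt set, 'e::euclidean_space) chart \<Rightarrow> 'e)"
proof -
  define A where "A = U\<^sup>H ** \<xi>U"
  have U: "U \<in> stiefel" "U\<^sup>H ** U = mat 1" and \<Sigma>: "\<Sigma> \<in> hpd" using tot by (auto simp: total_space_def stiefel_def)
  have QQ: "Q\<^sup>H ** Q = mat 1" using Q(1) by (simp add: stiefel_def)
  have tan: "(\<xi>U, \<xi>\<Sigma>) \<in> tangent (U, \<Sigma>)" using hor by (simp add: horizontal_def)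
  then have \<xi>\<Sigma>: "\<xi>\<Sigma> \<in> hermitian" and A: "A\<^sup>H = - A"
    by (auto simp: tangent_def A_def hconj_simps eq_neg_iff_add_eq_0 add.commute)
  have hA: "A = (2 * \<alpha>) *\<^sub>R (matrix_inv \<Sigma> ** \<xi>\<Sigma> - \<xi>\<Sigma> ** matrix_inv \<Sigma>)"
    using hor by (simp add: horizontal_explicit[OF tot] A_def)
  \<comment> \<open>\<open>Q ** R\<close> is a projection onto the orthogonal complement of the
    columns of \<open>U\<close>, although \<open>Q\<close> alone need not be orthogonal to
    them.\<close>
  have "U\<^sup>H ** (Q ** R) = 0" unfolding Q(2) by (simp add: mat_simps U)
  then have UQR: "U\<^sup>H ** Q ** R = 0" by (simp add: matrix_mul_assoc)
  let ?u = "stiefel_curve U Q A R" and ?u' = "stiefel_velocity U Q A R"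
  let ?s = "hpd_curve \<Sigma> \<xi>\<Sigma>" and ?s' = "hpd_velocity \<Sigma> \<xi>\<Sigma>"
  note st = stiefel_curve_products[OF U(1) QQ A UQR]
  note h = hpd_curve[OF \<Sigma> \<xi>\<Sigma>]
  define x where "x t = (?u t, ?s t)" for t
  define x' where "x' t = (?u' t, ?s' t)" for t
  define x'' where "x'' t = (?u' t ** A - ?u t ** (R\<^sup>H ** R), ?s' t ** matrix_inv (?s t) ** ?s' t)" for t
  have total: "x t \<in> total_space" for t
    using st(1) h(1) by (simp add: x_def total_space_def stiefel_def)
  have dx: "(x has_vector_derivative x' t) (at t)" for t
    unfolding x_def[abs_def] x'_def by (rule has_vector_derivative_Pair[OF stiefel_curve_has_derivative h(4)])
  have dx': "(x' has_vector_derivative x'' t) (at t)" for t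
    unfolding x'_def[abs_def] x''_def by (rule has_vector_derivative_Pair[OF stiefel_velocity_has_derivative h(5)])
  have smooth: "Ck_on n UNIV x" for n
    unfolding x_def[abs_def] stiefel_curve_eq
    by (rule Ck_on_Pair[OF open_UNIV Ck_on_matrix_exp_curve h(8)])
  have "x' t \<in> tangent (x t)" for t
    using velocity_tangent[OF open_UNIV UNIV_I _ dx[unfolded has_vector_derivative_def], of 1 t] total by auto
  \<comment> \<open>Every product in the defect is constant in time, so the defect keeps its initial
    value 0.\<close>
  then have horizontal: "x' t \<in> horizontal \<alpha> \<beta> (x t)" for t
    using horizontal_iff[OF total] by (simp add: defect_def x_def x'_def st h hA[symmetric])
  have geodesic: "total_metric \<alpha> \<beta> (x t) (x'' t) z + metric_derivative \<alpha> \<beta> (x t) (x' t) (x' t) z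
      = 1/2 * metric_derivative \<alpha> \<beta> (x t) z (x' t) (x' t)" if "z \<in> tangent (x t)" for t z
  proof -
    obtain zU z\<Sigma> where z: "z = (zU, z\<Sigma>)" by (cases z)
    show ?thesis unfolding z x_def x'_def x''_def
      by (rule total_metric_geodesic_equation[OF st A])
        (use that in \<open>simp_all add: z x_def tangent_def hconj_simps\<close>)
  qed
  \<comment> \<open>The initial velocity \<open>U ** A + Q ** R\<close> reassembles
    \<open>\<xi>U\<close> from its components along and orthogonal to the columns of
    \<open>U\<close>.\<close>
  have "?u' 0 = \<xi>U"
    unfolding stiefel_velocity_0 Q(2) by (simp add: A_def mat_simps)
  then have 0: "x 0 = (U, \<Sigma>)" "x' 0 = (\<xi>U, \<xi>\<Sigma>)"
    by (simp_all add: x_def x'_def stiefel_curve_0 h)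
  from represents_geodesicI[OF \<alpha> \<beta> smooth total dx dx' horizontal geodesic]
  show ?thesis unfolding 0 unfolding x_def[abs_def] A_def .
qed

theorem proposition3:
  fixes \<alpha> \<beta> :: real
    and U \<xi>U Q :: "complex^'k::{finite,linorder}^'p::finite"
    and \<Sigma> \<xi>\<Sigma> R :: "complex^'k::{finite,linorder}^'k::{finite,linorder}"
    and \<theta> :: "('p, 'k::{finite,linorder}) pt set"
    and \<xi> :: "(('p, 'k::{finite,linorder}) pt set, 'e::euclidean_space) chart \<Rightarrow> 'e"
  assumes "CARD('k) < CARD('p)"
    and "\<alpha> > 0" and "\<beta> > - \<alpha> / real CARD('k)"
    and "(U, \<Sigma>) \<in> total_space" and "\<theta> = orbit (U, \<Sigma>)"
    and "(\<xi>U, \<xi>\<Sigma>) \<in> horizontal \<alpha> \<beta> (U, \<Sigma>)"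
    and "\<xi> = proj_differential total_space orbit (U, \<Sigma>) (\<xi>U, \<xi>\<Sigma>)"
    and "qr_decomposition ((mat 1 - U ** U\<^sup>H) ** \<xi>U) Q R"
  shows "represents_geodesic \<alpha> \<beta>
      (\<lambda>t. (stiefel_curve U Q (U\<^sup>H ** \<xi>U) R t, hpd_curve \<Sigma> \<xi>\<Sigma> t)) \<theta> \<xi>
    \<and> (\<forall>Uperp :: complex^'q::finite^'p.
        CARD('q) = CARD('p) - CARD('k) \<and> Uperp \<in> stiefel \<and> U\<^sup>H ** Uperp = 0 \<longrightarrow>
        represents_geodesic \<alpha> \<beta>
          (\<lambda>t. (stiefel_curve U Uperp (U\<^sup>H ** \<xi>U) (Uperp\<^sup>H ** \<xi>U) t, hpd_curve \<Sigma> \<xi>\<Sigma> t)) \<theta> \<xi>)"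
proof (intro conjI allI impI)
  note QR = assms(8)[unfolded qr_decomposition_def]
  show "represents_geodesic \<alpha> \<beta>
      (\<lambda>t. (stiefel_curve U Q (U\<^sup>H ** \<xi>U) R t, hpd_curve \<Sigma> \<xi>\<Sigma> t)) \<theta> \<xi>"
    unfolding assms(5,7)
    by (rule explicit_geodesic[OF assms(2-4,6)]) (use QR in auto)
next
  fix Uperp :: "complex^'q::finite^'p"
  assume "CARD('q) = CARD('p) - CARD('k) \<and> Uperp \<in> stiefel \<and> U\<^sup>H ** Uperp = 0"
  then have perp: "CARD('q) = CARD('p) - CARD('k)" "Uperp \<in> stiefel" "U\<^sup>H ** Uperp = 0" by auto
  have UU: "U\<^sup>H ** U = mat 1" using assms(4) by (simp add: total_space_def stiefel_def)
  have PP: "Uperp\<^sup>H ** Uperp = mat 1" using perp(2) by (simp add: stiefel_def)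
  have PU: "Uperp\<^sup>H ** U = 0" using arg_cong[OF perp(3), of hconj] by (simp add: hconj_simps)
  \<comment> \<open>The dimensions make \<open>[U Uperp]\<close> square, so its orthonormal columns
    give a resolution of the identity, and \<open>Uperp ** Uperp\<^sup>H\<close> is the projector
    complementary to \<open>U ** U\<^sup>H\<close>.\<close>
  have "CARD('k + 'q) = CARD('p)" using perp(1) assms(1) by simp
  moreover have "(beside U Uperp)\<^sup>H ** beside U Uperp = mat 1"
    unfolding hconj_beside above_mult by (simp add: mult_beside UU PP PU perp(3) above_beside_mat_1)
  ultimately have "beside U Uperp ** (beside U Uperp)\<^sup>H = mat 1" by (rule isometry_of_full_dim)
  then have "Uperp ** Uperp\<^sup>H = mat 1 - U ** U\<^sup>H"
    by (simp add: hconj_beside beside_above eq_diff_eq add.commute)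
  then have "Uperp ** (Uperp\<^sup>H ** \<xi>U) = (mat 1 - U ** U\<^sup>H) ** \<xi>U"
    by (simp add: matrix_mul_assoc)
  from explicit_geodesic[OF assms(2-4,6) perp(2) this]
  show "represents_geodesic \<alpha> \<beta>
          (\<lambda>t. (stiefel_curve U Uperp (U\<^sup>H ** \<xi>U) (Uperp\<^sup>H ** \<xi>U) t, hpd_curve \<Sigma> \<xi>\<Sigma> t)) \<theta> \<xi>"
    unfolding assms(5,7) .
qed

end
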